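(* Let $k$ be a field, $F$ a sheaf on a finite poset $\Pi$, and $\alpha:F\hookrightarrow I^0$ the minimal injective hull of $F$. Starting with $\alpha$, iterative application of the step algorithm described in the context (the first application using $\mathrm{im}\,\alpha(\pi)$ in place of $\mathrm{im}\,\eta^{-1}(\pi)$ and producing $\eta^0$, and each following application producing $\eta^d$ from $\eta^{d-1}$) yields the minimal injective resolution of $F$.
   Context: A sheaf on a finite poset $\Pi$ is a functor from $\Pi$ to finite-dimensional $k$-vector spaces; morphisms are natural transformations, with kernels, images etc. pointwise. $\mathrm{St}\,\pi=\{\tau\in\Pi:\pi\le\tau\}$. $[\pi]$ is the sheaf with $[\pi](\sigma)=k$ for $\sigma\le\pi$ and $0$ otherwise (identity maps between copies of $k$); injective sheaves are exactly the sheaves isomorphic to finite direct sums of these. An injective resolution of $F$ is an exact sequence $0\to F\xrightarrow{\alpha}I^0\xrightarrow{\eta^0}I^1\xrightarrow{\eta^1}\cdots$ with all $I^d$ injective. It is minimal if in each degree $d$ the number of indecomposable summands of $I^d$ is least among all bounded complexes of injective sheaves quasi-isomorphic to $I^\bullet$; the minimal injective resolution exists and is unique up to isomorphism. An injective hull of $F$ is an injective natural transformation $F\hookrightarrow I^0$ into an injective sheaf; it is minimal if the minimal injective resolution of $F$ starts with it. Labeled matrices. A $\Pi$-labeled matrix is a matrix over $k$ with each row and column labeled by an element of $\Pi$ (repetitions allowed), such that the entry in a row labeled $\sigma$ and column labeled $\pi$ is nonzero only if $\sigma\le\pi$. $M[S,P]$ denotes the submatrix of rows with labels in $S$ and columns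 with labels in $P$; $M(\pi):=M[\mathrm{St}\,\pi,\mathrm{St}\,\pi]$. A labeled matrix with column labels $\pi_1,\dots,\pi_m$ and row labels $\sigma_1,\dots,\sigma_n$ represents the natural transformation $\bigoplus_i[\pi_i]\to\bigoplus_j[\sigma_j]$ whose component at $\pi$ is the matrix $M(\pi)$. Empty matrices are allowed. Procedure MakeExact$(A,B,\pi)$ (for labeled matrices $A,B$ with $BA=0$, columns of $B$ labeled as rows of $A$): choose a basis of $(\mathrm{im}\,A(\pi))^\perp$, the space of vectors $v$ with $v\cdot u=0$ for all $u\in\mathrm{im}\,A(\pi)$; for each basis vector $b$ in turn, if $b$ is linearly independent of the current rows of $B(\pi)$, append to $B$ a new row labeled $\pi$, equal to $b$ in the columns labeled by $\mathrm{St}\,\pi$ and $0$ elsewhere; return $B$. Step algorithm: on input $\eta^{d-1}$, let $\eta^d$ be the labeled matrix with no rows and with columns labeled as the rows of $\eta^{d-1}$ (for $d=0$: labeled by the summands of $I^0$); for all $\pi\in\Pi$ in a non-increasing order (every element processed after all larger elements), replace $\eta^d$ by MakeExact$(\eta^{d-1},\eta^d,\pi)$; output $\eta^d$. The row labels of $\eta^d$ define $I^{d+1}$. (The procedure uses $\eta^{d-1}$ only through the subspaces $\mathrm{im}\,\eta^{d-1}(\pi)\subseteq I^d(\pi)$.) *)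

theory Defs
  imports "HOL.Vector_Spaces" "HOL-Library.Function_Algebras"
begin

section \<open>Sheaves on a finite poset\<close>

text \<open>
  The stalks of a sheaf are finite-dimensional subspaces of one ambient vector space, whose
  scalar multiplication is an explicit argument of the definitions below. This is no loss of
  generality: up to isomorphism, the ambient space can be taken to be the direct sum of all
  stalks. The map \<open>res F \<sigma> \<tau>\<close> is only meaningful for \<open>\<sigma> \<le> \<tau>\<close>, and only on \<open>stalk F \<sigma>\<close>.
\<close>

record ('p, 'v) sheaf =
  stalk :: "'p \<Rightarrow> 'v set"
  res :: "'p \<Rightarrow> 'p \<Rightarrow> 'v \<Rightarrow> 'v"

definition linear_between ::
  "('k::field \<Rightarrow> 'v::ab_group_add \<Rightarrow> 'v) \<Rightarrow> 'v set \<Rightarrow>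
   ('k \<Rightarrow> 'w::ab_group_add \<Rightarrow> 'w) \<Rightarrow> 'w set \<Rightarrow> ('v \<Rightarrow> 'w) \<Rightarrow> bool" where
  "linear_between s V t W f \<longleftrightarrow>
     (\<forall>x\<in>V. f x \<in> W) \<and>
     (\<forall>x\<in>V. \<forall>y\<in>V. f (x + y) = f x + f y) \<and>
     (\<forall>c. \<forall>x\<in>V. f (s c x) = t c (f x))"

definition fin_dim_subspace :: "('k::field \<Rightarrow> 'v::ab_group_add \<Rightarrow> 'v) \<Rightarrow> 'v set \<Rightarrow> bool" where
  "fin_dim_subspace s V \<longleftrightarrow> (\<exists>B. finite B \<and> V = module.span s B)"

definition is_sheaf ::
  "('k::field \<Rightarrow> 'v::ab_group_add \<Rightarrow> 'v) \<Rightarrow> ('p::order, 'v) sheaf \<Rightarrow> bool" where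
  "is_sheaf s F \<longleftrightarrow>
     vector_space s \<and>
     (\<forall>\<pi>. fin_dim_subspace s (stalk F \<pi>)) \<and>
     (\<forall>\<sigma> \<tau>. \<sigma> \<le> \<tau> \<longrightarrow> linear_between s (stalk F \<sigma>) s (stalk F \<tau>) (res F \<sigma> \<tau>)) \<and>
     (\<forall>\<pi>. \<forall>x\<in>stalk F \<pi>. res F \<pi> \<pi> x = x) \<and>
     (\<forall>\<rho> \<sigma> \<tau>. \<rho> \<le> \<sigma> \<longrightarrow> \<sigma> \<le> \<tau> \<longrightarrow>
        (\<forall>x\<in>stalk F \<rho>. res F \<sigma> \<tau> (res F \<rho> \<sigma> x) = res F \<rho> \<tau> x))"

definition nat_trans ::
  "('k::field \<Rightarrow> 'v::ab_group_add \<Rightarrow> 'v) \<Rightarrow> ('p::order, 'v) sheaf \<Rightarrow>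
   ('k \<Rightarrow> 'w::ab_group_add \<Rightarrow> 'w) \<Rightarrow> ('p, 'w) sheaf \<Rightarrow> ('p \<Rightarrow> 'v \<Rightarrow> 'w) \<Rightarrow> bool" where
  "nat_trans s F t G \<phi> \<longleftrightarrow>
     (\<forall>\<pi>. linear_between s (stalk F \<pi>) t (stalk G \<pi>) (\<phi> \<pi>)) \<and>
     (\<forall>\<sigma> \<tau>. \<sigma> \<le> \<tau> \<longrightarrow> (\<forall>x\<in>stalk F \<sigma>. \<phi> \<tau> (res F \<sigma> \<tau> x) = res G \<sigma> \<tau> (\<phi> \<sigma> x)))"

definition sheaf_iso ::
  "('k::field \<Rightarrow> 'v::ab_group_add \<Rightarrow> 'v) \<Rightarrow> ('p::order, 'v) sheaf \<Rightarrow>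
   ('k \<Rightarrow> 'w::ab_group_add \<Rightarrow> 'w) \<Rightarrow> ('p, 'w) sheaf \<Rightarrow> bool" where
  "sheaf_iso s F t G \<longleftrightarrow>
     (\<exists>\<phi>. nat_trans s F t G \<phi> \<and> (\<forall>\<pi>. bij_betw (\<phi> \<pi>) (stalk F \<pi>) (stalk G \<pi>)))"

definition star :: "'p::order \<Rightarrow> 'p set" where
  "star \<pi> = {\<tau>. \<pi> \<le> \<tau>}"


section \<open>Injective sheaves\<close>

text \<open>
  Coordinate vectors are functions \<open>nat \<Rightarrow> 'k\<close>, with pointwise operations. Every
  finite-dimensional space embeds into this space, so every sheaf is isomorphic to one whose
  stalks are subspaces of \<open>nat \<Rightarrow> 'k\<close>.
\<close>

definition fscale :: "'k::field \<Rightarrow> (nat \<Rightarrow> 'k) \<Rightarrow> nat \<Rightarrow> 'k" where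
  "fscale c v = (\<lambda>i. c * v i)"

lemma vector_space_fscale: "vector_space fscale"
  by unfold_locales (simp_all add: fscale_def fun_eq_iff algebra_simps)

text \<open>
  The direct sum of the sheaves \<open>[\<pi>\<^sub>0], \<dots>, [\<pi>\<^sub>m\<^sub>-\<^sub>1]\<close> for \<open>ls = [\<pi>\<^sub>0, \<dots>, \<pi>\<^sub>m\<^sub>-\<^sub>1]\<close>. The summand \<open>[\<pi>\<^sub>i]\<close>
  has stalk \<open>k\<close> at \<open>\<sigma>\<close> if \<open>\<sigma> \<le> \<pi>\<^sub>i\<close> and zero otherwise, so the stalk of the sum at \<open>\<sigma>\<close> consists
  of the vectors supported on the coordinates \<open>i\<close> with \<open>\<pi>\<^sub>i \<in> star \<sigma>\<close>.
\<close>

definition inj_sheaf :: "'p::order list \<Rightarrow> ('p, nat \<Rightarrow> 'k::field) sheaf" where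
  "inj_sheaf ls =
     \<lparr> stalk = (\<lambda>\<sigma>. {v. \<forall>i. v i \<noteq> 0 \<longrightarrow> i < length ls \<and> ls ! i \<in> star \<sigma>}),
       res = (\<lambda>\<sigma> \<tau> v i. if i < length ls \<and> ls ! i \<in> star \<tau> then v i else 0) \<rparr>"

definition injective_sheaf :: "('p::order, nat \<Rightarrow> 'k::field) sheaf \<Rightarrow> bool" where
  "injective_sheaf I \<longleftrightarrow>
     is_sheaf fscale I \<and> (\<exists>ls. sheaf_iso fscale I fscale (inj_sheaf ls :: ('p, nat \<Rightarrow> 'k) sheaf))"

text \<open>
  \<open>I\<close> is a direct sum of \<open>n\<close> indecomposable injective sheaves; this \<open>n\<close> is determined by \<open>I\<close>.
\<close>

definition num_summands :: "('p::order, nat \<Rightarrow> 'k::field) sheaf \<Rightarrow> nat \<Rightarrow> bool" where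
  "num_summands I n \<longleftrightarrow>
     (\<exists>ls. length ls = n \<and> sheaf_iso fscale I fscale (inj_sheaf ls :: ('p, nat \<Rightarrow> 'k) sheaf))"


section \<open>Complexes and minimal injective resolutions\<close>

record ('p, 'v) cochain =
  obj :: "int \<Rightarrow> ('p, 'v) sheaf"
  diff :: "int \<Rightarrow> 'p \<Rightarrow> 'v \<Rightarrow> 'v"

definition is_complex :: "('p::order, nat \<Rightarrow> 'k::field) cochain \<Rightarrow> bool" where
  "is_complex C \<longleftrightarrow>
     (\<forall>d. is_sheaf fscale (obj C d)) \<and>
     (\<forall>d. nat_trans fscale (obj C d) fscale (obj C (d + 1)) (diff C d)) \<and>
     (\<forall>d \<pi>. \<forall>x\<in>stalk (obj C d) \<pi>. diff C (d + 1) \<pi> (diff C d \<pi> x) = 0)"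

definition bounded_complex :: "('p::order, nat \<Rightarrow> 'k::field) cochain \<Rightarrow> bool" where
  "bounded_complex C \<longleftrightarrow> is_complex C \<and> (\<exists>N. \<forall>d. \<bar>d\<bar> > N \<longrightarrow> (\<forall>\<pi>. stalk (obj C d) \<pi> = {0}))"

definition cocycles :: "('p::order, nat \<Rightarrow> 'k::field) cochain \<Rightarrow> int \<Rightarrow> 'p \<Rightarrow> (nat \<Rightarrow> 'k) set" where
  "cocycles C d \<pi> = {x \<in> stalk (obj C d) \<pi>. diff C d \<pi> x = 0}"

definition coboundaries :: "('p::order, nat \<Rightarrow> 'k::field) cochain \<Rightarrow> int \<Rightarrow> 'p \<Rightarrow> (nat \<Rightarrow> 'k) set" where
  "coboundaries C d \<pi> = diff C (d - 1) \<pi> ` stalk (obj C (d - 1)) \<pi>"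

definition chain_map ::
  "('p::order, nat \<Rightarrow> 'k::field) cochain \<Rightarrow> ('p, nat \<Rightarrow> 'k) cochain \<Rightarrow>
   (int \<Rightarrow> 'p \<Rightarrow> (nat \<Rightarrow> 'k) \<Rightarrow> nat \<Rightarrow> 'k) \<Rightarrow> bool" where
  "chain_map A B f \<longleftrightarrow>
     (\<forall>d. nat_trans fscale (obj A d) fscale (obj B d) (f d)) \<and>
     (\<forall>d \<pi>. \<forall>x\<in>stalk (obj A d) \<pi>. f (d + 1) \<pi> (diff A d \<pi> x) = diff B d \<pi> (f d \<pi> x))"

text \<open>
  The last two conjuncts say that the induced maps from cocycles modulo coboundaries of \<open>A\<close> to
  those of \<open>B\<close> are injective and surjective.
\<close>

definition quasi_isomorphism ::
  "('p::order, nat \<Rightarrow> 'k::field) cochain \<Rightarrow> ('p, nat \<Rightarrow> 'k) cochain \<Rightarrow>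
   (int \<Rightarrow> 'p \<Rightarrow> (nat \<Rightarrow> 'k) \<Rightarrow> nat \<Rightarrow> 'k) \<Rightarrow> bool" where
  "quasi_isomorphism A B f \<longleftrightarrow>
     chain_map A B f \<and>
     (\<forall>d \<pi>. \<forall>x\<in>cocycles A d \<pi>. f d \<pi> x \<in> coboundaries B d \<pi> \<longrightarrow> x \<in> coboundaries A d \<pi>) \<and>
     (\<forall>d \<pi>. \<forall>y\<in>cocycles B d \<pi>. \<exists>x\<in>cocycles A d \<pi>. f d \<pi> x - y \<in> coboundaries B d \<pi>)"

text \<open>Connected by a finite zigzag of quasi-isomorphisms.\<close>

definition quasi_isomorphic ::
  "('p::order, nat \<Rightarrow> 'k::field) cochain \<Rightarrow> ('p, nat \<Rightarrow> 'k) cochain \<Rightarrow> bool" where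
  "quasi_isomorphic =
     equivclp (\<lambda>A B. is_complex A \<and> is_complex B \<and> (\<exists>f. quasi_isomorphism A B f))"

definition minimal_complex :: "('p::order, nat \<Rightarrow> 'k::field) cochain \<Rightarrow> bool" where
  "minimal_complex C \<longleftrightarrow>
     (\<forall>J. bounded_complex J \<and> (\<forall>d. injective_sheaf (obj J d)) \<and> quasi_isomorphic J C \<longrightarrow>
        (\<forall>d m n. num_summands (obj C d) m \<and> num_summands (obj J d) n \<longrightarrow> m \<le> n))"

text \<open>
  The resolution \<open>0 \<rightarrow> F \<rightarrow> I\<^sup>0 \<rightarrow> I\<^sup>1 \<rightarrow> \<dots>\<close>, with \<open>I\<close> extended by zero to negative degrees.
\<close>

definition injective_resolution ::
  "('k::field \<Rightarrow> 'v::ab_group_add \<Rightarrow> 'v) \<Rightarrow> ('p::order, 'v) sheaf \<Rightarrow>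
   ('p \<Rightarrow> 'v \<Rightarrow> nat \<Rightarrow> 'k) \<Rightarrow> ('p, nat \<Rightarrow> 'k) cochain \<Rightarrow> bool" where
  "injective_resolution s F \<alpha> I \<longleftrightarrow>
     is_complex I \<and>
     (\<forall>d<0. \<forall>\<pi>. stalk (obj I d) \<pi> = {0}) \<and>
     (\<forall>d. injective_sheaf (obj I d)) \<and>
     nat_trans s F fscale (obj I 0) \<alpha> \<and>
     (\<forall>\<pi>. inj_on (\<alpha> \<pi>) (stalk F \<pi>)) \<and>
     (\<forall>\<pi>. \<alpha> \<pi> ` stalk F \<pi> = cocycles I 0 \<pi>) \<and>
     (\<forall>d>0. \<forall>\<pi>. coboundaries I d \<pi> = cocycles I d \<pi>)"

definition minimal_injective_resolution ::
  "('k::field \<Rightarrow> 'v::ab_group_add \<Rightarrow> 'v) \<Rightarrow> ('p::order, 'v) sheaf \<Rightarrow>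
   ('p \<Rightarrow> 'v \<Rightarrow> nat \<Rightarrow> 'k) \<Rightarrow> ('p, nat \<Rightarrow> 'k) cochain \<Rightarrow> bool" where
  "minimal_injective_resolution s F \<alpha> I \<longleftrightarrow> injective_resolution s F \<alpha> I \<and> minimal_complex I"

definition injective_hull ::
  "('k::field \<Rightarrow> 'v::ab_group_add \<Rightarrow> 'v) \<Rightarrow> ('p::order, 'v) sheaf \<Rightarrow>
   ('p \<Rightarrow> 'v \<Rightarrow> nat \<Rightarrow> 'k) \<Rightarrow> ('p, nat \<Rightarrow> 'k) sheaf \<Rightarrow> bool" where
  "injective_hull s F \<alpha> I\<^sub>0 \<longleftrightarrow>
     injective_sheaf I\<^sub>0 \<and> nat_trans s F fscale I\<^sub>0 \<alpha> \<and> (\<forall>\<pi>. inj_on (\<alpha> \<pi>) (stalk F \<pi>))"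

definition minimal_injective_hull ::
  "('k::field \<Rightarrow> 'v::ab_group_add \<Rightarrow> 'v) \<Rightarrow> ('p::order, 'v) sheaf \<Rightarrow>
   ('p \<Rightarrow> 'v \<Rightarrow> nat \<Rightarrow> 'k) \<Rightarrow> ('p, nat \<Rightarrow> 'k) sheaf \<Rightarrow> bool" where
  "minimal_injective_hull s F \<alpha> I\<^sub>0 \<longleftrightarrow>
     injective_hull s F \<alpha> I\<^sub>0 \<and>
     (\<exists>I. minimal_injective_resolution s F \<alpha> I \<and> obj I 0 = I\<^sub>0)"


section \<open>Labeled matrices\<close>

text \<open>
  \<open>entry M j i\<close> is the entry in row \<open>j\<close> and column \<open>i\<close>; it is zero outside the matrix.
\<close>

record ('p, 'k) lmat =
  col_lab :: "'p list"
  row_lab :: "'p list"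
  entry :: "nat \<Rightarrow> nat \<Rightarrow> 'k"

definition labeled_matrix :: "('p::order, 'k::field) lmat \<Rightarrow> bool" where
  "labeled_matrix M \<longleftrightarrow>
     (\<forall>j i. entry M j i \<noteq> 0 \<longrightarrow>
        j < length (row_lab M) \<and> i < length (col_lab M) \<and> row_lab M ! j \<le> col_lab M ! i)"

text \<open>
  Submatrices keep the row and column numbers of the full matrix: \<open>M[S, P]\<close> is extended by zero
  to the rows and columns it does not contain. Likewise a vector indexed by the columns of
  \<open>M[S, P]\<close> is a vector indexed by all columns that vanishes outside \<open>P\<close>.
\<close>

definition submat :: "('p::order, 'k::field) lmat \<Rightarrow> 'p set \<Rightarrow> 'p set \<Rightarrow> nat \<Rightarrow> nat \<Rightarrow> 'k" where
  "submat M S P = (\<lambda>j i.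
     if j < length (row_lab M) \<and> row_lab M ! j \<in> S \<and> i < length (col_lab M) \<and> col_lab M ! i \<in> P
     then entry M j i else 0)"

definition mat_at :: "('p::order, 'k::field) lmat \<Rightarrow> 'p \<Rightarrow> nat \<Rightarrow> nat \<Rightarrow> 'k" where
  "mat_at M \<pi> = submat M (star \<pi>) (star \<pi>)"

definition dot :: "nat \<Rightarrow> (nat \<Rightarrow> 'k::field) \<Rightarrow> (nat \<Rightarrow> 'k) \<Rightarrow> 'k" where
  "dot n v u = (\<Sum>i<n. v i * u i)"

definition mat_trans :: "('p::order, 'k::field) lmat \<Rightarrow> 'p \<Rightarrow> (nat \<Rightarrow> 'k) \<Rightarrow> nat \<Rightarrow> 'k" where
  "mat_trans M \<pi> v = (\<lambda>j. dot (length (col_lab M)) (mat_at M \<pi> j) v)"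

definition im_at :: "('p::order, 'k::field) lmat \<Rightarrow> 'p \<Rightarrow> (nat \<Rightarrow> 'k) set" where
  "im_at M \<pi> = mat_trans M \<pi> ` stalk (inj_sheaf (col_lab M)) \<pi>"

definition rows_at :: "('p::order, 'k::field) lmat \<Rightarrow> 'p \<Rightarrow> (nat \<Rightarrow> 'k) set" where
  "rows_at M \<pi> = {mat_at M \<pi> j | j. j < length (row_lab M) \<and> row_lab M ! j \<in> star \<pi>}"

definition append_row ::
  "'p::order \<Rightarrow> (nat \<Rightarrow> 'k::field) \<Rightarrow> ('p, 'k) lmat \<Rightarrow> ('p, 'k) lmat" where
  "append_row \<pi> b M =
     M\<lparr> row_lab := row_lab M @ [\<pi>], entry := (entry M)(length (row_lab M) := b) \<rparr>"

definition no_rows :: "'p::order list \<Rightarrow> ('p, 'k::field) lmat" where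
  "no_rows ls = \<lparr> col_lab = ls, row_lab = [], entry = (\<lambda>j i. 0) \<rparr>"


section \<open>The algorithm\<close>

text \<open>
  The choices of bases and of the order in which the poset is processed are left open: each
  step is a relation between inputs and possible outputs. The input \<open>A\<close> of MakeExact enters only
  through \<open>V = im A(\<pi>)\<close>.
\<close>

definition perp :: "'p::order list \<Rightarrow> 'p \<Rightarrow> (nat \<Rightarrow> 'k::field) set \<Rightarrow> (nat \<Rightarrow> 'k) set" where
  "perp ls \<pi> V = {v \<in> stalk (inj_sheaf ls) \<pi>. \<forall>u\<in>V. dot (length ls) v u = 0}"

definition is_basis_of :: "(nat \<Rightarrow> 'k::field) list \<Rightarrow> (nat \<Rightarrow> 'k) set \<Rightarrow> bool" where
  "is_basis_of bs W \<longleftrightarrow>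
     distinct bs \<and> \<not> module.dependent fscale (set bs) \<and> module.span fscale (set bs) = W"

definition add_row_if_indep ::
  "'p::order \<Rightarrow> (nat \<Rightarrow> 'k::field) \<Rightarrow> ('p, 'k) lmat \<Rightarrow> ('p, 'k) lmat" where
  "add_row_if_indep \<pi> b B =
     (if b \<in> module.span fscale (rows_at B \<pi>) then B else append_row \<pi> b B)"

definition make_exact ::
  "(nat \<Rightarrow> 'k::field) set \<Rightarrow> ('p::order, 'k) lmat \<Rightarrow> 'p \<Rightarrow> ('p, 'k) lmat \<Rightarrow> bool" where
  "make_exact V B \<pi> B' \<longleftrightarrow>
     (\<exists>bs. is_basis_of bs (perp (col_lab B) \<pi> V) \<and> B' = fold (add_row_if_indep \<pi>) bs B)"

fun make_exact_along ::
  "('p::order \<Rightarrow> (nat \<Rightarrow> 'k::field) set) \<Rightarrow> 'p list \<Rightarrow> ('p, 'k) lmat \<Rightarrow> ('p, 'k) lmat \<Rightarrow> bool" where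
  "make_exact_along V [] B B' \<longleftrightarrow> B' = B"
| "make_exact_along V (\<pi> # \<pi>s) B B' \<longleftrightarrow>
     (\<exists>B''. make_exact (V \<pi>) B \<pi> B'' \<and> make_exact_along V \<pi>s B'' B')"

definition non_increasing_order :: "'p::order list \<Rightarrow> bool" where
  "non_increasing_order \<pi>s \<longleftrightarrow>
     distinct \<pi>s \<and> set \<pi>s = UNIV \<and> sorted_wrt (\<lambda>\<sigma> \<tau>. \<not> \<sigma> < \<tau>) \<pi>s"

definition step_output ::
  "'p::order list \<Rightarrow> ('p \<Rightarrow> (nat \<Rightarrow> 'k::field) set) \<Rightarrow> ('p, 'k) lmat \<Rightarrow> bool" where
  "step_output ls V M \<longleftrightarrow>
     (\<exists>\<pi>s. non_increasing_order \<pi>s \<and> make_exact_along V \<pi>s (no_rows ls) M)"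

definition algorithm_run ::
  "('p::order, 'v) sheaf \<Rightarrow> ('p \<Rightarrow> 'v \<Rightarrow> nat \<Rightarrow> 'k::field) \<Rightarrow> 'p list \<Rightarrow>
   (nat \<Rightarrow> ('p, 'k) lmat) \<Rightarrow> bool" where
  "algorithm_run F \<alpha> ls \<eta> \<longleftrightarrow>
     step_output ls (\<lambda>\<pi>. \<alpha> \<pi> ` stalk F \<pi>) (\<eta> 0) \<and>
     (\<forall>d. step_output (row_lab (\<eta> d)) (im_at (\<eta> d)) (\<eta> (Suc d)))"

definition label_list :: "'p::order list \<Rightarrow> (nat \<Rightarrow> ('p, 'k::field) lmat) \<Rightarrow> int \<Rightarrow> 'p list" where
  "label_list ls \<eta> d =
     (if d < 0 then [] else if d = 0 then ls else row_lab (\<eta> (nat (d - 1))))"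

definition output_complex ::
  "'p::order list \<Rightarrow> (nat \<Rightarrow> ('p, 'k::field) lmat) \<Rightarrow> ('p, nat \<Rightarrow> 'k) cochain" where
  "output_complex ls \<eta> =
     \<lparr> obj = (\<lambda>d. inj_sheaf (label_list ls \<eta> d)),
       diff = (\<lambda>d. if d < 0 then (\<lambda>\<pi> v. 0) else mat_trans (\<eta> (nat d))) \<rparr>"

end

theory Submission
  imports Defs "HOL-Library.Product_Plus"
begin

text \<open>
  The socle of a sheaf at \<open>\<pi>\<close> consists of the sections over \<open>\<pi>\<close> killed by all restrictions to larger
  elements; the multiplicity of \<open>[\<pi>]\<close> in an injective sheaf is the dimension of its socle at \<open>\<pi>\<close>.
  A complex of injective sheaves, zero in low degrees, whose differentials vanish on socles is
  minimal: a quasi-isomorphic bounded complex \<open>J\<close> of injective sheaves is homotopy equivalent to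
  it, homotopies contribute nothing on socles, so the socles of the complex embed into those of
  \<open>J\<close>.

  In the output of a step the rows at \<open>\<pi>\<close> span the annihilator of the given subspace, which by
  double annihilation gives exactness, and the rows labeled \<open>\<pi>\<close> are independent modulo the rows
  with larger labels, which gives that the image contains all socles, so that the next
  differential vanishes on them. For degree 0 one needs that the image of a minimal hull contains
  all socles. Otherwise a summand could be split off; a hull with the least number of summands
  does contain all socles, hence the algorithm extends it to a bounded resolution, because labels
  strictly decrease from each degree to the next, and this resolution contradicts minimality.
\<close>

section \<open>Linear algebra\<close>

text \<open>Minimality quantifies over complexes joined to the given one by an arbitrary zigzag,
  whose intermediate complexes need be neither injective nor bounded. The zigzag is straightened
  starting from the end at the injective, bounded below complex \<open>C\<close>: an arrow
  \<open>B \<rightarrow> A\<close> pointing the wrong way is bypassed by extending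
  \<open>B \<rightarrow> C\<close> along it up to homotopy, which works because its mapping cone is
  acyclic. On socles both homotopy terms vanish, since natural transformations carry socles into
  socles and the differentials kill socles on either side. The processing order is what makes the
  rows independent: when an element is processed, no row carries a strictly smaller label, so a new
  row cannot disturb independence already obtained. A minimal hull is known only through some
  minimal resolution that starts with it, and minimality compares only with bounded complexes. The
  competitor built from a least hull must therefore be shown bounded, which is where finiteness of
  the poset enters.\<close>

interpretation fs: vector_space fscale
  by (rule vector_space_fscale)

lemma fscale_apply [simp]: "fscale c v i = c * v i"
  by (simp add: fscale_def)

lemma sum_apply [simp]: "sum f A i = (\<Sum>x\<in>A. f x i)"
  by (induction A rule: infinite_finite_induct) auto

lemma linear_betweenD:
  assumes "linear_between s V t W f"
  shows "x \<in> V \<Longrightarrow> f x \<in> W"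
    and "x \<in> V \<Longrightarrow> y \<in> V \<Longrightarrow> f (x + y) = f x + f y"
    and "x \<in> V \<Longrightarrow> f (s c x) = t c (f x)"
  using assms by (auto simp: linear_between_def)

lemma linear_between_0:
  assumes "vector_space s" "vector_space t" "module.subspace s V" "linear_between s V t W f"
  shows "f 0 = 0"
proof -
  interpret s: vector_space s by fact
  interpret t: vector_space t by fact
  have "f (s 0 0) = t 0 (f 0)"
    using assms(3,4) by (intro linear_betweenD(3)) (auto simp: s.subspace_0)
  then show ?thesis by simp
qed

lemma linear_between_diff:
  assumes "vector_space s" "vector_space t" "module.subspace s V" "linear_between s V t W f"
    and "x \<in> V" "y \<in> V"
  shows "f (x - y) = f x - f y"
proof -
  interpret s: vector_space s by fact
  have "x - y \<in> V" using assms by (simp add: s.subspace_diff)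
  then have "f ((x - y) + y) = f (x - y) + f y"
    using assms linear_betweenD(2) by blast
  then show ?thesis by simp
qed

text \<open>Maps of sheaves are linear on stalks only; extending from a basis of the stalk turns
  such a map into one defined on the whole space, to which the theory of linear maps
  applies.\<close>

lemma linear_extension:
  assumes "vector_space s" "vector_space t" "module.subspace s V" "linear_between s V t W f"
  obtains g where "Vector_Spaces.linear s t g" "\<And>x. x \<in> V \<Longrightarrow> g x = f x"
proof -
  interpret s: vector_space s by fact
  interpret t: vector_space t by fact
  interpret st: vector_space_pair s t ..
  obtain B where B: "B \<subseteq> V" "s.independent B" "V \<subseteq> s.span B"
    using s.maximal_independent_subset by blast
  then obtain g where g: "Vector_Spaces.linear s t g" "\<And>x. x \<in> B \<Longrightarrow> g x = f x"
    using st.linear_independent_extend by blast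
  have "x \<in> V \<and> g x = f x" if "x \<in> s.span B" for x
    using that
  proof (induction rule: s.span_induct_alt)
    case base
    show ?case
      using linear_between_0[OF assms] assms(3) g(1) by (simp add: s.subspace_0 st.linear_0)
  next
    case (step c x y)
    have "x \<in> V" using step B by blast
    moreover have "s c x \<in> V" using assms(3) \<open>x \<in> V\<close> by (simp add: s.subspace_scale)
    moreover have "s c x + y \<in> V" using assms(3) calculation step by (simp add: s.subspace_add)
    ultimately show ?case
      using step g st.linear_add[OF g(1)] st.linear_scale[OF g(1)]
        linear_betweenD(2,3)[OF assms(4)] by simp
  qed
  then show thesis using that g(1) B(3) by blast
qed

text \<open>As \<open>g\<close> vanishes on the kernel of \<open>f\<close>, it descends to the image
  of \<open>f\<close>, and a functional on a subspace extends to the whole space. This is the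
  pointwise content of the injectivity of \<open>[\<pi>]\<close>.\<close>

lemma functional_factors:
  fixes s :: "'k::field \<Rightarrow> 'v::ab_group_add \<Rightarrow> 'v" and t :: "'k \<Rightarrow> 'w::ab_group_add \<Rightarrow> 'w"
  assumes "vector_space s" "vector_space t" "module.subspace s V"
    and f: "linear_between s V t W f" and g: "linear_between s V (*) UNIV g"
    and ker: "\<And>x. x \<in> V \<Longrightarrow> f x = 0 \<Longrightarrow> g x = 0"
  obtains l :: "'w \<Rightarrow> 'k" where "Vector_Spaces.linear t (*) l" "\<And>x. x \<in> V \<Longrightarrow> l (f x) = g x"
proof -
  interpret s: vector_space s by fact
  interpret t: vector_space t by fact
  interpret k: vector_space "(*) :: 'k \<Rightarrow> 'k \<Rightarrow> 'k"
    by unfold_locales (auto simp: algebra_simps)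
  \<comment> \<open>Any preimage in \<open>V\<close> will do: two of them differ by an element of
    the kernel of \<open>f\<close>, where \<open>g\<close> vanishes.\<close>
  define h where "h y = g (SOME x. x \<in> V \<and> f x = y)" for y
  have h: "h (f x) = g x" if "x \<in> V" for x
  proof -
    define z where "z = (SOME z. z \<in> V \<and> f z = f x)"
    have z: "z \<in> V \<and> f z = f x" unfolding z_def by (rule someI) (use that in auto)
    have "z - x \<in> V" using z that assms(3) by (simp add: s.subspace_diff)
    moreover have "f (z - x) = 0"
      using linear_between_diff[OF assms(1-3) f] z that by simp
    ultimately have "g (z - x) = 0" by (rule ker)
    then have "g z = g x"
      using linear_between_diff[OF assms(1) k.vector_space_axioms assms(3) g] z that by simp
    then show ?thesis by (simp add: h_def z_def)
  qed
  have sub: "t.subspace (f ` V)"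
  proof (rule t.subspaceI)
    show "0 \<in> f ` V"
      using linear_between_0[OF assms(1-3) f] s.subspace_0[OF assms(3)] by force
  next
    fix y z c
    assume "y \<in> f ` V"
    then obtain x where x: "x \<in> V" "y = f x" by blast
    then show "t c y \<in> f ` V"
      using linear_betweenD(3)[OF f, of x c] assms(3) by (metis imageI s.subspace_scale)
    assume "z \<in> f ` V"
    then obtain x' where "x' \<in> V" "z = f x'" by blast
    then show "y + z \<in> f ` V"
      using x linear_betweenD(2)[OF f, of x x'] assms(3) by (metis imageI s.subspace_add)
  qed
  have "linear_between t (f ` V) (*) UNIV h"
    unfolding linear_between_def
    using h assms(3) linear_betweenD(2,3)[OF f] linear_betweenD(2,3)[OF g]
    by (auto; metis s.subspace_add s.subspace_scale)
  from linear_extension[OF \<open>vector_space t\<close> k.vector_space_axioms sub this]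
  obtain l where "Vector_Spaces.linear t (*) l" "\<And>y. y \<in> f ` V \<Longrightarrow> l y = h y" by blast
  then show thesis using that h by (metis imageI)
qed

definition unit_vec :: "nat \<Rightarrow> nat \<Rightarrow> 'k::field" where
  "unit_vec i = (\<lambda>j. if j = i then 1 else 0)"

lemma unit_vec_expansion:
  assumes "finite S" "\<And>i. i \<notin> S \<Longrightarrow> x i = 0"
  shows "x = (\<Sum>i\<in>S. fscale (x i) (unit_vec i))"
proof
  fix j
  have "(\<Sum>i\<in>S. x i * unit_vec i j) = (\<Sum>i\<in>S. if i = j then x j else 0)"
    by (rule sum.cong) (auto simp: unit_vec_def)
  also have "\<dots> = x j" using assms by simp
  finally show "x j = (\<Sum>i\<in>S. fscale (x i) (unit_vec i)) j" by simp
qed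

text \<open>Independence provides a functional that vanishes on a basis of \<open>U\<close> and is 1
  at \<open>x\<close>; as all vectors involved are supported on the finite set \<open>S\<close>, its
  values on unit vectors represent it as a dot product. This is the source of double
  annihilation.\<close>

lemma coordinate_separation:
  fixes x :: "nat \<Rightarrow> 'k::field"
  assumes U: "fs.subspace U" and "x \<notin> U"
    and S: "finite S" "\<And>u i. u \<in> insert x U \<Longrightarrow> i \<notin> S \<Longrightarrow> u i = 0"
  obtains v where "\<And>i. i \<notin> S \<Longrightarrow> v i = 0"
    and "\<And>u. u \<in> U \<Longrightarrow> (\<Sum>i\<in>S. v i * u i) = 0" and "(\<Sum>i\<in>S. v i * x i) \<noteq> 0"
proof -
  interpret k: vector_space "(*) :: 'k \<Rightarrow> 'k \<Rightarrow> 'k"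
    by unfold_locales (auto simp: algebra_simps)
  interpret fk: vector_space_pair fscale "(*) :: 'k \<Rightarrow> 'k \<Rightarrow> 'k" ..
  obtain B where B: "B \<subseteq> U" "fs.independent B" "U \<subseteq> fs.span B"
    using fs.maximal_independent_subset by blast
  have spB: "fs.span B = U" using B U fs.span_subspace by blast
  have "fs.independent (insert x B)"
    using \<open>x \<notin> U\<close> B spB by (simp add: fs.independent_insertI)
  then obtain l where l: "Vector_Spaces.linear fscale (*) l"
      "\<And>y. y \<in> insert x B \<Longrightarrow> l y = (if y = x then 1 else 0)"
    using fk.linear_independent_extend[of _ "\<lambda>y. if y = x then 1 else 0"] by blast
  have lx: "l x = 1" using l(2) by simp
  have l0: "l u = 0" if "u \<in> U" for u
  proof -
    have "u \<in> fs.span B" using that spB by simp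
    then show ?thesis
    proof (induction rule: fs.span_induct_alt)
      case base
      show ?case by (rule fk.linear_0[OF l(1)])
    next
      case (step c y z)
      have "l y = 0" using step B(1) l(2)[of y] \<open>x \<notin> U\<close> by auto
      moreover have "l (fscale c y + z) = c * l y + l z"
        by (simp only: fk.linear_add[OF l(1)] fk.linear_scale[OF l(1)])
      ultimately show ?case using step by (simp only: mult_zero_right add_0)
    qed
  qed
  have rep: "(\<Sum>i\<in>S. (if i \<in> S then l (unit_vec i) else 0) * u i) = l u"
    if "u \<in> insert x U" for u
  proof -
    have "l u = l (\<Sum>i\<in>S. fscale (u i) (unit_vec i))"
      using unit_vec_expansion[of S u] S that by metis
    also have "\<dots> = (\<Sum>i\<in>S. u i * l (unit_vec i))"
      by (simp add: fk.linear_sum[OF l(1)] fk.linear_scale[OF l(1)])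
    also have "\<dots> = (\<Sum>i\<in>S. (if i \<in> S then l (unit_vec i) else 0) * u i)"
      by (rule sum.cong) (auto simp: mult.commute)
    finally show ?thesis ..
  qed
  show thesis
    by (rule that[of "\<lambda>i. if i \<in> S then l (unit_vec i) else 0"])
      (use rep l0 lx in auto)
qed

section \<open>Natural transformations\<close>

lemma is_sheafD:
  assumes "is_sheaf s F"
  shows "vector_space s"
    and "fin_dim_subspace s (stalk F \<pi>)"
    and "\<sigma> \<le> \<tau> \<Longrightarrow> linear_between s (stalk F \<sigma>) s (stalk F \<tau>) (res F \<sigma> \<tau>)"
    and "x \<in> stalk F \<pi> \<Longrightarrow> res F \<pi> \<pi> x = x"
    and "\<rho> \<le> \<sigma> \<Longrightarrow> \<sigma> \<le> \<tau> \<Longrightarrow> x \<in> stalk F \<rho> \<Longrightarrow> res F \<sigma> \<tau> (res F \<rho> \<sigma> x) = res F \<rho> \<tau> x"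
  using assms by (auto simp: is_sheaf_def)

lemma stalk_subspace:
  assumes "is_sheaf s F"
  shows "module.subspace s (stalk F \<pi>)"
proof -
  interpret vector_space s using assms by (rule is_sheafD)
  show ?thesis using is_sheafD(2)[OF assms, of \<pi>] by (auto simp: fin_dim_subspace_def)
qed

lemma stalk_closed:
  assumes "is_sheaf s F"
  shows "0 \<in> stalk F \<pi>"
    and "x \<in> stalk F \<pi> \<Longrightarrow> y \<in> stalk F \<pi> \<Longrightarrow> x + y \<in> stalk F \<pi>"
    and "x \<in> stalk F \<pi> \<Longrightarrow> y \<in> stalk F \<pi> \<Longrightarrow> x - y \<in> stalk F \<pi>"
    and "x \<in> stalk F \<pi> \<Longrightarrow> s c x \<in> stalk F \<pi>"
proof -
  interpret vector_space s using assms by (rule is_sheafD)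
  note sub = stalk_subspace[OF assms, of \<pi>]
  show "0 \<in> stalk F \<pi>"
    "x \<in> stalk F \<pi> \<Longrightarrow> y \<in> stalk F \<pi> \<Longrightarrow> x + y \<in> stalk F \<pi>"
    "x \<in> stalk F \<pi> \<Longrightarrow> y \<in> stalk F \<pi> \<Longrightarrow> x - y \<in> stalk F \<pi>"
    "x \<in> stalk F \<pi> \<Longrightarrow> s c x \<in> stalk F \<pi>"
    using sub by (auto simp: subspace_0 subspace_add subspace_diff subspace_scale)
qed

lemma res_in_stalk:
  "is_sheaf s F \<Longrightarrow> \<sigma> \<le> \<tau> \<Longrightarrow> x \<in> stalk F \<sigma> \<Longrightarrow> res F \<sigma> \<tau> x \<in> stalk F \<tau>"
  using is_sheafD(3) linear_betweenD(1) by blast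

lemma res_diff:
  assumes "is_sheaf s F" "\<sigma> \<le> \<tau>" "x \<in> stalk F \<sigma>" "y \<in> stalk F \<sigma>"
  shows "res F \<sigma> \<tau> (x - y) = res F \<sigma> \<tau> x - res F \<sigma> \<tau> y"
  by (rule linear_between_diff[OF is_sheafD(1) is_sheafD(1) stalk_subspace is_sheafD(3)])
    (use assms in auto)

lemma res_0:
  assumes "is_sheaf s F" "\<sigma> \<le> \<tau>"
  shows "res F \<sigma> \<tau> 0 = 0"
  by (rule linear_between_0[OF is_sheafD(1) is_sheafD(1) stalk_subspace is_sheafD(3)])
    (use assms in auto)

lemma nat_transD:
  assumes "nat_trans s F t G \<phi>"
  shows "linear_between s (stalk F \<pi>) t (stalk G \<pi>) (\<phi> \<pi>)"
    and "x \<in> stalk F \<pi> \<Longrightarrow> \<phi> \<pi> x \<in> stalk G \<pi>"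
    and "x \<in> stalk F \<pi> \<Longrightarrow> y \<in> stalk F \<pi> \<Longrightarrow> \<phi> \<pi> (x + y) = \<phi> \<pi> x + \<phi> \<pi> y"
    and "x \<in> stalk F \<pi> \<Longrightarrow> \<phi> \<pi> (s c x) = t c (\<phi> \<pi> x)"
    and "\<sigma> \<le> \<tau> \<Longrightarrow> x \<in> stalk F \<sigma> \<Longrightarrow> \<phi> \<tau> (res F \<sigma> \<tau> x) = res G \<sigma> \<tau> (\<phi> \<sigma> x)"
  using assms by (auto simp: nat_trans_def linear_between_def)

lemma nat_transI:
  assumes "\<And>\<pi> x. x \<in> stalk F \<pi> \<Longrightarrow> \<phi> \<pi> x \<in> stalk G \<pi>"
    and "\<And>\<pi> x y. x \<in> stalk F \<pi> \<Longrightarrow> y \<in> stalk F \<pi> \<Longrightarrow> \<phi> \<pi> (x + y) = \<phi> \<pi> x + \<phi> \<pi> y"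
    and "\<And>\<pi> x c. x \<in> stalk F \<pi> \<Longrightarrow> \<phi> \<pi> (s c x) = t c (\<phi> \<pi> x)"
    and "\<And>\<sigma> \<tau> x. \<sigma> \<le> \<tau> \<Longrightarrow> x \<in> stalk F \<sigma> \<Longrightarrow> \<phi> \<tau> (res F \<sigma> \<tau> x) = res G \<sigma> \<tau> (\<phi> \<sigma> x)"
  shows "nat_trans s F t G \<phi>"
  using assms by (auto simp: nat_trans_def linear_between_def)

lemma nat_trans_0_diff:
  assumes "is_sheaf s F" "is_sheaf t G" "nat_trans s F t G \<phi>"
  shows "\<phi> \<pi> 0 = 0"
    and "x \<in> stalk F \<pi> \<Longrightarrow> y \<in> stalk F \<pi> \<Longrightarrow> \<phi> \<pi> (x - y) = \<phi> \<pi> x - \<phi> \<pi> y"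
proof -
  note * = is_sheafD(1)[OF assms(1)] is_sheafD(1)[OF assms(2)] stalk_subspace[OF assms(1)]
    nat_transD(1)[OF assms(3)]
  show "\<phi> \<pi> 0 = 0" by (rule linear_between_0[OF *])
  show "x \<in> stalk F \<pi> \<Longrightarrow> y \<in> stalk F \<pi> \<Longrightarrow> \<phi> \<pi> (x - y) = \<phi> \<pi> x - \<phi> \<pi> y"
    by (rule linear_between_diff[OF *])
qed

lemma nat_trans_comp:
  assumes "nat_trans s F t G \<phi>" "nat_trans t G u H \<psi>"
  shows "nat_trans s F u H (\<lambda>\<pi> x. \<psi> \<pi> (\<phi> \<pi> x))"
  by (rule nat_transI) (simp_all add: nat_transD[OF assms(1)] nat_transD[OF assms(2)])

lemma nat_trans_minus:
  assumes "is_sheaf s F" "is_sheaf t G" "nat_trans s F t G \<phi>" "nat_trans s F t G \<psi>"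
  shows "nat_trans s F t G (\<lambda>\<pi> x. \<phi> \<pi> x - \<psi> \<pi> x)"
proof (rule nat_transI)
  interpret t: vector_space t using assms(2) by (rule is_sheafD)
  note D = nat_transD[OF assms(3)] nat_transD[OF assms(4)]
  fix \<pi> x assume x: "x \<in> stalk F \<pi>"
  show "\<phi> \<pi> x - \<psi> \<pi> x \<in> stalk G \<pi>"
    using x D assms(2) by (simp add: stalk_closed)
  show "\<phi> \<pi> (s c x) - \<psi> \<pi> (s c x) = t c (\<phi> \<pi> x - \<psi> \<pi> x)" for c
    using x D by (simp add: t.scale_right_diff_distrib)
  show "\<phi> \<pi> (x + y) - \<psi> \<pi> (x + y) = \<phi> \<pi> x - \<psi> \<pi> x + (\<phi> \<pi> y - \<psi> \<pi> y)"
    if "y \<in> stalk F \<pi>" for y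
    using x that by (simp only: D) (simp only: algebra_simps)
next
  fix \<sigma> \<tau> x
  assume *: "\<sigma> \<le> \<tau>" "x \<in> stalk F \<sigma>"
  note D = nat_transD[OF assms(3)] nat_transD[OF assms(4)]
  have "res G \<sigma> \<tau> (\<phi> \<sigma> x - \<psi> \<sigma> x) = res G \<sigma> \<tau> (\<phi> \<sigma> x) - res G \<sigma> \<tau> (\<psi> \<sigma> x)"
    by (rule linear_between_diff[OF is_sheafD(1) is_sheafD(1) stalk_subspace is_sheafD(3)])
      (use * D assms(2) in auto)
  then show "\<phi> \<tau> (res F \<sigma> \<tau> x) - \<psi> \<tau> (res F \<sigma> \<tau> x) = res G \<sigma> \<tau> (\<phi> \<sigma> x - \<psi> \<sigma> x)"
    using * by (simp only: D)
qed

lemma nat_trans_zero: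
  assumes "is_sheaf s F" "is_sheaf t G"
  shows "nat_trans s F t G (\<lambda>\<pi> x. 0)"
proof (rule nat_transI)
  interpret t: vector_space t using assms(2) by (rule is_sheafD)
  show "0 = t c 0" for c by simp
  show "0 = res G \<sigma> \<tau> 0" if "\<sigma> \<le> \<tau>" for \<sigma> \<tau>
    using linear_between_0[OF is_sheafD(1) is_sheafD(1) stalk_subspace is_sheafD(3)]
      that assms(2) by metis
qed (use assms in \<open>auto simp: stalk_closed\<close>)

lemma nat_trans_id: "nat_trans s F s F (\<lambda>\<pi> x. x)"
  by (rule nat_transI) auto

lemma nat_trans_inverse:
  assumes "is_sheaf s F" "nat_trans s F t G \<phi>"
    and bij: "\<And>\<pi>. bij_betw (\<phi> \<pi>) (stalk F \<pi>) (stalk G \<pi>)"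
  shows "nat_trans t G s F (\<lambda>\<pi>. inv_into (stalk F \<pi>) (\<phi> \<pi>))"
proof (rule nat_transI)
  let ?i = "\<lambda>\<pi>. inv_into (stalk F \<pi>) (\<phi> \<pi>)"
  note D = nat_transD[OF assms(2)]
  have i: "?i \<pi> x \<in> stalk F \<pi>" "\<phi> \<pi> (?i \<pi> x) = x" if "x \<in> stalk G \<pi>" for \<pi> x
    using bij[of \<pi>] that
    by (auto simp: bij_betw_def intro: inv_into_into f_inv_into_f)
  have i': "?i \<pi> (\<phi> \<pi> x) = x" if "x \<in> stalk F \<pi>" for \<pi> x
    using bij[of \<pi>] that by (simp add: bij_betw_def)
  show "?i \<pi> x \<in> stalk F \<pi>" if "x \<in> stalk G \<pi>" for \<pi> x
    by (rule i(1)[OF that])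
  show "?i \<pi> (x + y) = ?i \<pi> x + ?i \<pi> y" if "x \<in> stalk G \<pi>" "y \<in> stalk G \<pi>" for \<pi> x y
    using i'[of "?i \<pi> x + ?i \<pi> y"] D(3) i that assms(1) by (metis stalk_closed(2))
  show "?i \<pi> (t c x) = s c (?i \<pi> x)" if "x \<in> stalk G \<pi>" for \<pi> x c
    using i'[of "s c (?i \<pi> x)"] D(4) i that assms(1) by (metis stalk_closed(4))
  show "?i \<tau> (res G \<sigma> \<tau> x) = res F \<sigma> \<tau> (?i \<sigma> x)" if "\<sigma> \<le> \<tau>" "x \<in> stalk G \<sigma>" for \<sigma> \<tau> x
    using i'[of "res F \<sigma> \<tau> (?i \<sigma> x)" \<tau>] D(5) i that assms(1) by (metis res_in_stalk)
qed

section \<open>Injectivity\<close>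

lemma inj_sheaf_simps:
  "v \<in> stalk (inj_sheaf ls) \<sigma> \<longleftrightarrow> (\<forall>i. v i \<noteq> 0 \<longrightarrow> i < length ls \<and> \<sigma> \<le> ls ! i)"
  "res (inj_sheaf ls) \<sigma> \<tau> v i = (if i < length ls \<and> \<tau> \<le> ls ! i then v i else 0)"
  by (simp_all add: inj_sheaf_def star_def)

lemma subspace_inj_sheaf: "fs.subspace (stalk (inj_sheaf ls) \<sigma>)"
proof (rule fs.subspaceI)
  show "x + y \<in> stalk (inj_sheaf ls) \<sigma>"
    if "x \<in> stalk (inj_sheaf ls) \<sigma>" "y \<in> stalk (inj_sheaf ls) \<sigma>" for x y
    using that by (simp add: inj_sheaf_simps) (metis add_0)
qed (auto simp: inj_sheaf_simps)

lemma subspace_finite_support: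
  assumes "fs.subspace U" "finite S" "\<And>u i. u \<in> U \<Longrightarrow> i \<notin> S \<Longrightarrow> u i = 0"
  shows "\<exists>B. finite B \<and> fs.independent B \<and> fs.span B = U"
proof -
  obtain B where B: "B \<subseteq> U" "fs.independent B" "U \<subseteq> fs.span B"
    using fs.maximal_independent_subset by blast
  have "u \<in> fs.span (unit_vec ` S)" if "u \<in> U" for u
  proof -
    have "u = (\<Sum>i\<in>S. fscale (u i) (unit_vec i))"
      by (rule unit_vec_expansion) (use assms that in auto)
    also have "\<dots> \<in> fs.span (unit_vec ` S)"
      by (intro fs.span_sum fs.span_scale fs.span_base) auto
    finally show ?thesis .
  qed
  then have "finite B"
    using fs.independent_span_bound[of "unit_vec ` S" B] B assms(2) by blast
  then show ?thesis using B assms(1) fs.span_subspace by blast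
qed

lemma is_sheaf_inj_sheaf: "is_sheaf fscale (inj_sheaf ls)"
  unfolding is_sheaf_def
proof (intro conjI allI impI ballI)
  show "fin_dim_subspace fscale (stalk (inj_sheaf ls) \<pi>)" for \<pi>
    using subspace_finite_support[OF subspace_inj_sheaf, of "{..<length ls}" ls \<pi>]
    unfolding fin_dim_subspace_def by (force simp: inj_sheaf_simps)
  show "linear_between fscale (stalk (inj_sheaf ls) \<sigma>) fscale (stalk (inj_sheaf ls) \<tau>)
      (res (inj_sheaf ls) \<sigma> \<tau>)" for \<sigma> \<tau>
    unfolding linear_between_def by (simp add: inj_sheaf_simps fun_eq_iff)
  show "res (inj_sheaf ls) \<pi> \<pi> x = x" if "x \<in> stalk (inj_sheaf ls) \<pi>" for \<pi> x
    using that by (auto simp: inj_sheaf_simps(1)) (auto simp: fun_eq_iff inj_sheaf_simps(2))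
  show "res (inj_sheaf ls) \<sigma> \<tau> (res (inj_sheaf ls) \<rho> \<sigma> x) = res (inj_sheaf ls) \<rho> \<tau> x"
    if "\<sigma> \<le> \<tau>" for \<rho> \<sigma> \<tau> x
    using that by (fastforce simp: fun_eq_iff inj_sheaf_simps(2))
qed (rule vector_space_fscale)

lemma injective_inj_sheaf: "injective_sheaf (inj_sheaf ls)"
  unfolding injective_sheaf_def sheaf_iso_def
  by (intro conjI exI[of _ ls] exI[of _ "\<lambda>\<pi> x. x"] is_sheaf_inj_sheaf nat_trans_id allI)
    (simp add: bij_betw_def)

text \<open>A morphism into \<open>[\<pi>]\<close> amounts to a functional on the stalk at
  \<open>\<pi>\<close>, so one functional per summand is factored through \<open>\<delta>\<close>.
  Asking that \<open>\<psi>\<close> vanish on the kernel of \<open>\<delta>\<close>, instead of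
  asking that \<open>\<delta>\<close> be injective, spares quotient sheaves when homotopies are
  built.\<close>

lemma inj_sheaf_extension:
  fixes \<psi> :: "'p::order \<Rightarrow> 'v::ab_group_add \<Rightarrow> nat \<Rightarrow> 'k::field"
  assumes K: "is_sheaf s K" and L: "is_sheaf t L" and \<delta>: "nat_trans s K t L \<delta>"
    and \<psi>: "nat_trans s K fscale (inj_sheaf ls) \<psi>"
    and ker: "\<And>\<pi> x. x \<in> stalk K \<pi> \<Longrightarrow> \<delta> \<pi> x = 0 \<Longrightarrow> \<psi> \<pi> x = 0"
  obtains \<chi> where "nat_trans t L fscale (inj_sheaf ls) \<chi>"
    and "\<And>\<pi> x. x \<in> stalk K \<pi> \<Longrightarrow> \<chi> \<pi> (\<delta> \<pi> x) = \<psi> \<pi> x"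
proof -
  have "\<exists>l. Vector_Spaces.linear t (*) l \<and> (\<forall>x\<in>stalk K (ls!i). l (\<delta> (ls!i) x) = \<psi> (ls!i) x i)"
    for i
  proof -
    have "linear_between s (stalk K (ls!i)) (*) UNIV (\<lambda>x. \<psi> (ls!i) x i)"
      using nat_transD[OF \<psi>] by (auto simp: linear_between_def)
    from functional_factors[OF is_sheafD(1)[OF K] is_sheafD(1)[OF L] stalk_subspace[OF K]
        nat_transD(1)[OF \<delta>] this]
    obtain l where "Vector_Spaces.linear t (*) l"
        "\<And>x. x \<in> stalk K (ls!i) \<Longrightarrow> l (\<delta> (ls!i) x) = \<psi> (ls!i) x i"
      using ker by (metis zero_fun_apply)
    then show ?thesis by blast
  qed
  then obtain l where l: "\<And>i. Vector_Spaces.linear t (*) (l i)"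
      "\<And>i x. x \<in> stalk K (ls!i) \<Longrightarrow> l i (\<delta> (ls!i) x) = \<psi> (ls!i) x i"
    by metis
  \<comment> \<open>Naturality forces this formula: coordinate \<open>i\<close> is unchanged by
    restriction to \<open>ls!i\<close>, and there it is given by the functional
    \<open>l i\<close>.\<close>
  define \<chi> where "\<chi> \<sigma> y i = (if i < length ls \<and> \<sigma> \<le> ls!i then l i (res L \<sigma> (ls!i) y) else 0)"
    for \<sigma> y i
  show thesis
  proof (rule that)
    show "nat_trans t L fscale (inj_sheaf ls) \<chi>"
    proof (rule nat_transI)
      fix \<pi> x assume x: "x \<in> stalk L \<pi>"
      show "\<chi> \<pi> x \<in> stalk (inj_sheaf ls) \<pi>" by (auto simp: inj_sheaf_simps \<chi>_def)
      show "\<chi> \<pi> (x + y) = \<chi> \<pi> x + \<chi> \<pi> y" if "y \<in> stalk L \<pi>" for y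
        using x that linear_betweenD(2)[OF is_sheafD(3)[OF L]]
        by (auto simp: \<chi>_def fun_eq_iff Vector_Spaces.linear.axioms(3)[OF l(1), THEN module_hom.add])
      show "\<chi> \<pi> (t c x) = fscale c (\<chi> \<pi> x)" for c
        using x linear_betweenD(3)[OF is_sheafD(3)[OF L]]
        by (auto simp: \<chi>_def fun_eq_iff Vector_Spaces.linear.axioms(3)[OF l(1), THEN module_hom.scale])
    next
      fix \<sigma> \<tau> :: 'p and x assume "\<sigma> \<le> \<tau>" "x \<in> stalk L \<sigma>"
      then show "\<chi> \<tau> (res L \<sigma> \<tau> x) = res (inj_sheaf ls) \<sigma> \<tau> (\<chi> \<sigma> x)"
        using is_sheafD(5)[OF L] by (auto simp: \<chi>_def inj_sheaf_simps fun_eq_iff)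
    qed
    show "\<chi> \<pi> (\<delta> \<pi> x) = \<psi> \<pi> x" if x: "x \<in> stalk K \<pi>" for \<pi> x
    proof
      fix i
      show "\<chi> \<pi> (\<delta> \<pi> x) i = \<psi> \<pi> x i"
      proof (cases "i < length ls \<and> \<pi> \<le> ls!i")
        case True
        then have "\<chi> \<pi> (\<delta> \<pi> x) i = l i (\<delta> (ls!i) (res K \<pi> (ls!i) x))"
          using x nat_transD(5)[OF \<delta>] by (simp add: \<chi>_def)
        also have "\<dots> = \<psi> (ls!i) (res K \<pi> (ls!i) x) i"
          using True x by (intro l(2) res_in_stalk[OF K]) auto
        also have "\<dots> = \<psi> \<pi> x i"
          using True x nat_transD(5)[OF \<psi>] by (simp add: inj_sheaf_simps)
        finally show ?thesis .
      next
        case False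
        then show ?thesis
          using nat_transD(2)[OF \<psi> x] by (auto simp: \<chi>_def inj_sheaf_simps)
      qed
    qed
  qed
qed

lemma injective_sheaf_extension:
  fixes \<psi> :: "'p::order \<Rightarrow> 'v::ab_group_add \<Rightarrow> nat \<Rightarrow> 'k::field"
  assumes K: "is_sheaf s K" and L: "is_sheaf t L" and \<delta>: "nat_trans s K t L \<delta>"
    and I: "injective_sheaf I" and \<psi>: "nat_trans s K fscale I \<psi>"
    and ker: "\<And>\<pi> x. x \<in> stalk K \<pi> \<Longrightarrow> \<delta> \<pi> x = 0 \<Longrightarrow> \<psi> \<pi> x = 0"
  obtains \<chi> where "nat_trans t L fscale I \<chi>"
    and "\<And>\<pi> x. x \<in> stalk K \<pi> \<Longrightarrow> \<chi> \<pi> (\<delta> \<pi> x) = \<psi> \<pi> x"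
proof -
  obtain ls \<iota> where sh: "is_sheaf fscale I"
    and \<iota>: "nat_trans fscale I fscale (inj_sheaf ls) \<iota>"
    and bij: "\<And>\<pi>. bij_betw (\<iota> \<pi>) (stalk I \<pi>) (stalk (inj_sheaf ls) \<pi>)"
    using I by (auto simp: injective_sheaf_def sheaf_iso_def)
  obtain \<chi> where \<chi>: "nat_trans t L fscale (inj_sheaf ls) \<chi>"
    and \<chi>\<delta>: "\<And>\<pi> x. x \<in> stalk K \<pi> \<Longrightarrow> \<chi> \<pi> (\<delta> \<pi> x) = \<iota> \<pi> (\<psi> \<pi> x)"
    by (rule inj_sheaf_extension[OF K L \<delta> nat_trans_comp[OF \<psi> \<iota>]])
      (use ker nat_trans_0_diff(1)[OF sh is_sheaf_inj_sheaf \<iota>] in auto)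
  show thesis
  proof (rule that)
    show "nat_trans t L fscale I (\<lambda>\<pi> x. inv_into (stalk I \<pi>) (\<iota> \<pi>) (\<chi> \<pi> x))"
      by (rule nat_trans_comp[OF \<chi> nat_trans_inverse[OF sh \<iota> bij]])
    show "inv_into (stalk I \<pi>) (\<iota> \<pi>) (\<chi> \<pi> (\<delta> \<pi> x)) = \<psi> \<pi> x" if "x \<in> stalk K \<pi>" for \<pi> x
      using \<chi>\<delta>[OF that] bij[of \<pi>] nat_transD(2)[OF \<psi> that] by (simp add: bij_betw_def)
  qed
qed

section \<open>Homotopies into complexes of injective sheaves\<close>

lemma is_complexD:
  assumes "is_complex C"
  shows "is_sheaf fscale (obj C d)"
    and "nat_trans fscale (obj C d) fscale (obj C (d + 1)) (diff C d)"
    and "nat_trans fscale (obj C (d - 1)) fscale (obj C d) (diff C (d - 1))"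
    and "x \<in> stalk (obj C d) \<pi> \<Longrightarrow> diff C (d + 1) \<pi> (diff C d \<pi> x) = 0"
    and "x \<in> stalk (obj C (d - 1)) \<pi> \<Longrightarrow> diff C d \<pi> (diff C (d - 1) \<pi> x) = 0"
proof -
  show "is_sheaf fscale (obj C d)"
    "nat_trans fscale (obj C d) fscale (obj C (d + 1)) (diff C d)"
    "x \<in> stalk (obj C d) \<pi> \<Longrightarrow> diff C (d + 1) \<pi> (diff C d \<pi> x) = 0"
    using assms by (auto simp: is_complex_def)
  have "nat_trans fscale (obj C (d - 1)) fscale (obj C (d - 1 + 1)) (diff C (d - 1))"
    "x \<in> stalk (obj C (d - 1)) \<pi> \<Longrightarrow> diff C (d - 1 + 1) \<pi> (diff C (d - 1) \<pi> x) = 0"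
    using assms unfolding is_complex_def by blast+
  then show "nat_trans fscale (obj C (d - 1)) fscale (obj C d) (diff C (d - 1))"
    "x \<in> stalk (obj C (d - 1)) \<pi> \<Longrightarrow> diff C d \<pi> (diff C (d - 1) \<pi> x) = 0"
    by simp_all
qed

text \<open>The homotopy is built upwards from degree \<open>N\<close>. At each stage
  \<open>\<phi>\<close> minus the homotopy term already known vanishes on the image of the preceding
  \<open>\<delta>\<close>, hence by exactness on the kernel of the next one, so it extends by
  injectivity; the extension is the next component.\<close>

lemma acyclic_null_homotopic:
  fixes K :: "int \<Rightarrow> ('p::order, 'v::ab_group_add) sheaf" and C :: "('p, nat \<Rightarrow> 'k::field) cochain"
  assumes K: "\<And>d. is_sheaf s (K d)"
    and \<delta>: "\<And>d. nat_trans s (K d) s (K (d + 1)) (\<delta> d)"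
    and exact: "\<And>d \<pi> x. x \<in> stalk (K (d + 1)) \<pi> \<Longrightarrow> \<delta> (d + 1) \<pi> x = 0 \<Longrightarrow>
      \<exists>y\<in>stalk (K d) \<pi>. \<delta> d \<pi> y = x"
    and C: "is_complex C" and inj: "\<And>d. injective_sheaf (obj C d)"
    and bdd: "\<And>d \<pi>. d < N \<Longrightarrow> stalk (obj C d) \<pi> = {0}"
    and \<phi>: "\<And>d. nat_trans s (K d) fscale (obj C d) (\<phi> d)"
    and chain: "\<And>d \<pi> x. x \<in> stalk (K d) \<pi> \<Longrightarrow> \<phi> (d + 1) \<pi> (\<delta> d \<pi> x) = diff C d \<pi> (\<phi> d \<pi> x)"
  obtains h where "\<And>d. nat_trans s (K d) fscale (obj C (d - 1)) (h d)"
    and "\<And>d \<pi> x. x \<in> stalk (K d) \<pi> \<Longrightarrow>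
      \<phi> d \<pi> x = diff C (d - 1) \<pi> (h d \<pi> x) + h (d + 1) \<pi> (\<delta> d \<pi> x)"
proof -
  \<comment> \<open>\<open>P\<close> keeps the vanishing on the image of the preceding
    \<open>\<delta>\<close> as induction invariant; \<open>Q\<close> is the homotopy identity
    linking consecutive components.\<close>
  define P where "P n \<tau> \<longleftrightarrow> nat_trans s (K (N + int n)) fscale (obj C (N + int n - 1)) \<tau> \<and>
     (\<forall>\<pi>. \<forall>x\<in>stalk (K (N + int n - 1)) \<pi>. \<phi> (N + int n) \<pi> (\<delta> (N + int n - 1) \<pi> x) =
       diff C (N + int n - 1) \<pi> (\<tau> \<pi> (\<delta> (N + int n - 1) \<pi> x)))" for n \<tau>
  define Q where "Q n \<tau> \<tau>' \<longleftrightarrow> (\<forall>\<pi>. \<forall>x\<in>stalk (K (N + int n)) \<pi>.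
      \<phi> (N + int n) \<pi> x = diff C (N + int n - 1) \<pi> (\<tau> \<pi> x) + \<tau>' \<pi> (\<delta> (N + int n) \<pi> x))"
    for n and \<tau> \<tau>' :: "'p \<Rightarrow> 'v \<Rightarrow> nat \<Rightarrow> 'k"
  have diff0: "diff C d \<pi> 0 = 0" for d \<pi>
    using nat_trans_0_diff(1)[OF is_complexD(1)[OF C] is_complexD(1,2)[OF C]] .
  have "\<exists>\<tau>. (\<forall>n. P n (\<tau> n)) \<and> \<tau> 0 = (\<lambda>\<pi> x. 0) \<and> (\<forall>n. Q n (\<tau> n) (\<tau> (Suc n)))"
  proof -
    \<comment> \<open>The clause for \<open>n = 0\<close> fixes the starting component as zero, so
      that it fits the zero homotopy used below \<open>N\<close>, in particular in degree
      \<open>N - 1\<close>, whose identity involves this component.\<close>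
    have "\<exists>\<tau>. \<forall>n. (P n (\<tau> n) \<and> (n = 0 \<longrightarrow> \<tau> n = (\<lambda>\<pi> x. 0))) \<and> Q n (\<tau> n) (\<tau> (Suc n))"
    proof (rule dependent_nat_choice)
      have "\<phi> N \<pi> (\<delta> (N - 1) \<pi> x) = 0" if "x \<in> stalk (K (N - 1)) \<pi>" for \<pi> x
        using chain[OF that] nat_transD(2)[OF \<phi> that] bdd[of "N - 1"] diff0 by simp
      then have "P 0 (\<lambda>\<pi> x. 0)"
        unfolding P_def using nat_trans_zero[OF K is_complexD(1)[OF C]] diff0 by simp
      then show "\<exists>\<tau>. P 0 \<tau> \<and> ((0::nat) = 0 \<longrightarrow> \<tau> = (\<lambda>\<pi> x. 0))" by blast
    next
      fix \<tau> :: "'p \<Rightarrow> 'v \<Rightarrow> nat \<Rightarrow> 'k" and n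
      assume asm: "P n \<tau> \<and> (n = 0 \<longrightarrow> \<tau> = (\<lambda>\<pi> x. 0))"
      define d where "d = N + int n"
      have \<tau>: "nat_trans s (K d) fscale (obj C (d - 1)) \<tau>"
        and \<tau>\<delta>: "\<And>\<pi> x. x \<in> stalk (K (d - 1)) \<pi> \<Longrightarrow>
          \<phi> d \<pi> (\<delta> (d - 1) \<pi> x) = diff C (d - 1) \<pi> (\<tau> \<pi> (\<delta> (d - 1) \<pi> x))"
        using asm by (auto simp: P_def d_def)
      define \<psi> where "\<psi> \<pi> x = \<phi> d \<pi> x - diff C (d - 1) \<pi> (\<tau> \<pi> x)" for \<pi> x
      have \<psi>: "nat_trans s (K d) fscale (obj C d) \<psi>"
        unfolding \<psi>_def
        by (intro nat_trans_minus K is_complexD(1)[OF C] \<phi> nat_trans_comp[OF \<tau> is_complexD(3)[OF C]])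
      have ker: "\<psi> \<pi> x = 0" if x: "x \<in> stalk (K d) \<pi>" and x0: "\<delta> d \<pi> x = 0" for \<pi> x
      proof -
        obtain y where "y \<in> stalk (K (d - 1)) \<pi>" "\<delta> (d - 1) \<pi> y = x"
          using exact[of x "d - 1" \<pi>] x x0 by auto
        then show ?thesis using \<tau>\<delta> by (auto simp: \<psi>_def)
      qed
      obtain \<tau>' where \<tau>': "nat_trans s (K (d + 1)) fscale (obj C d) \<tau>'"
        and \<tau>'\<delta>: "\<And>\<pi> x. x \<in> stalk (K d) \<pi> \<Longrightarrow> \<tau>' \<pi> (\<delta> d \<pi> x) = \<psi> \<pi> x"
        using injective_sheaf_extension[OF K K \<delta> inj \<psi> ker] by blast
      have "\<phi> (d + 1) \<pi> (\<delta> d \<pi> x) = diff C d \<pi> (\<tau>' \<pi> (\<delta> d \<pi> x))" if x: "x \<in> stalk (K d) \<pi>" for \<pi> x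
      proof -
        have "diff C d \<pi> (\<tau>' \<pi> (\<delta> d \<pi> x)) = diff C d \<pi> (\<phi> d \<pi> x) - diff C d \<pi> (diff C (d - 1) \<pi> (\<tau> \<pi> x))"
          unfolding \<tau>'\<delta>[OF x] \<psi>_def
          by (rule nat_trans_0_diff(2)[OF is_complexD(1)[OF C] is_complexD(1,2)[OF C]])
            (use x nat_transD(2)[OF \<phi>] nat_transD(2)[OF \<tau>] nat_transD(2)[OF is_complexD(3)[OF C]] in auto)
        also have "\<dots> = \<phi> (d + 1) \<pi> (\<delta> d \<pi> x)"
          using is_complexD(5)[OF C nat_transD(2)[OF \<tau> x]] chain[OF x] by simp
        finally show ?thesis ..
      qed
      moreover have eq: "N + int (Suc n) = d + 1" "d + 1 - 1 = d" by (simp_all add: d_def)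
      ultimately have "P (Suc n) \<tau>'"
        unfolding P_def eq using \<tau>' by simp
      moreover have "Q n \<tau> \<tau>'"
        unfolding Q_def d_def[symmetric] using \<tau>'\<delta> by (simp add: \<psi>_def)
      ultimately show "\<exists>\<tau>'. (P (Suc n) \<tau>' \<and> (Suc n = 0 \<longrightarrow> \<tau>' = (\<lambda>\<pi> x. 0))) \<and> Q n \<tau> \<tau>'"
        by blast
    qed
    then show ?thesis by metis
  qed
  then obtain \<tau> where \<tau>P: "\<And>n. P n (\<tau> n)" and \<tau>0: "\<tau> 0 = (\<lambda>\<pi> x. 0)"
    and \<tau>Q: "\<And>n. Q n (\<tau> n) (\<tau> (Suc n))" by blast
  define h where "h d = (if d < N then (\<lambda>\<pi> x. 0) else \<tau> (nat (d - N)))" for d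
  show thesis
  proof (rule that)
    fix d
    show "nat_trans s (K d) fscale (obj C (d - 1)) (h d)"
    proof (cases "d < N")
      case True
      then show ?thesis by (simp add: h_def nat_trans_zero[OF K is_complexD(1)[OF C]])
    next
      case False
      then show ?thesis using \<tau>P[of "nat (d - N)"] by (simp add: h_def P_def)
    qed
    fix \<pi> x assume x: "x \<in> stalk (K d) \<pi>"
    show "\<phi> d \<pi> x = diff C (d - 1) \<pi> (h d \<pi> x) + h (d + 1) \<pi> (\<delta> d \<pi> x)"
    proof (cases "d < N")
      case True
      then have "h (d + 1) = (\<lambda>\<pi> x. 0)" using \<tau>0 by (auto simp: h_def)
      moreover have "\<phi> d \<pi> x = 0" using nat_transD(2)[OF \<phi> x] bdd[OF True] by simp
      ultimately show ?thesis using True diff0 by (simp add: h_def)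
    next
      case False
      then have "nat (d + 1 - N) = Suc (nat (d - N))" by simp
      then show ?thesis using False \<tau>Q[of "nat (d - N)"] x by (simp add: h_def Q_def)
    qed
  qed
qed

section \<open>Mapping cones and extension of chain maps along quasi-isomorphisms\<close>

lemma chain_mapD:
  assumes "chain_map A B f"
  shows "nat_trans fscale (obj A d) fscale (obj B d) (f d)"
    and "x \<in> stalk (obj A d) \<pi> \<Longrightarrow> f (d + 1) \<pi> (diff A d \<pi> x) = diff B d \<pi> (f d \<pi> x)"
  using assms by (auto simp: chain_map_def)

text \<open>Objects of a \<open>cochain\<close> are carried by \<open>nat \<Rightarrow> 'k\<close>,
  but the mapping cone is needed only as a sequence of sheaves; a product type avoids recoding pairs
  as coordinate vectors.\<close>

definition pair_scale :: "('k \<Rightarrow> 'v \<Rightarrow> 'v) \<Rightarrow> ('k \<Rightarrow> 'w \<Rightarrow> 'w) \<Rightarrow> 'k \<Rightarrow> 'v \<times> 'w \<Rightarrow> 'v \<times> 'w" where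
  "pair_scale s t c p = (s c (fst p), t c (snd p))"

lemma pair_scale_Pair: "pair_scale s t c (x, y) = (s c x, t c y)"
  by (simp add: pair_scale_def)

definition sheaf_sum :: "('p, 'v) sheaf \<Rightarrow> ('p, 'w) sheaf \<Rightarrow> ('p, 'v \<times> 'w) sheaf" where
  "sheaf_sum F G = \<lparr> stalk = (\<lambda>\<pi>. stalk F \<pi> \<times> stalk G \<pi>),
     res = (\<lambda>\<sigma> \<tau> (x, y). (res F \<sigma> \<tau> x, res G \<sigma> \<tau> y)) \<rparr>"

lemma sheaf_sum_simps:
  "stalk (sheaf_sum F G) \<pi> = stalk F \<pi> \<times> stalk G \<pi>"
  "res (sheaf_sum F G) \<sigma> \<tau> (x, y) = (res F \<sigma> \<tau> x, res G \<sigma> \<tau> y)"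
  by (simp_all add: sheaf_sum_def)

lemma is_sheaf_sheaf_sum:
  fixes s :: "'k::field \<Rightarrow> 'v::ab_group_add \<Rightarrow> 'v" and t :: "'k \<Rightarrow> 'w::ab_group_add \<Rightarrow> 'w"
    and F :: "('p::order, 'v) sheaf" and G :: "('p, 'w) sheaf"
  assumes F: "is_sheaf s F" and G: "is_sheaf t G"
  shows "is_sheaf (pair_scale s t) (sheaf_sum F G)"
proof -
  interpret s: vector_space s using F by (rule is_sheafD)
  interpret t: vector_space t using G by (rule is_sheafD)
  interpret p: vector_space "pair_scale s t"
    by unfold_locales
      (auto simp: pair_scale_def s.scale_right_distrib t.scale_right_distrib
        s.scale_left_distrib t.scale_left_distrib)
  show ?thesis
    unfolding is_sheaf_def
  proof (intro conjI allI impI ballI p.vector_space_axioms)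
    fix \<pi>
    obtain A B where A: "finite A" "stalk F \<pi> = s.span A" and B: "finite B" "stalk G \<pi> = t.span B"
      using is_sheafD(2)[OF F, of \<pi>] is_sheafD(2)[OF G, of \<pi>] by (auto simp: fin_dim_subspace_def)
    define D where "D = (\<lambda>x. (x, 0)) ` A \<union> (\<lambda>y. (0, y)) ` B"
    have 1: "(x, 0) \<in> p.span D" if "x \<in> s.span A" for x
      using that
    proof (induction rule: s.span_induct_alt)
      case base
      show ?case using p.span_zero by (simp add: zero_prod_def)
    next
      case (step c x y)
      have "pair_scale s t c (x, 0) + (y, 0) \<in> p.span D"
        using step by (intro p.span_add p.span_scale) (auto intro: p.span_base simp: D_def)
      then show ?case by (simp add: pair_scale_Pair)
    qed
    have 2: "(0, x) \<in> p.span D" if "x \<in> t.span B" for x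
      using that
    proof (induction rule: t.span_induct_alt)
      case base
      show ?case using p.span_zero by (simp add: zero_prod_def)
    next
      case (step c x y)
      have "pair_scale s t c (0, x) + (0, y) \<in> p.span D"
        using step by (intro p.span_add p.span_scale) (auto intro: p.span_base simp: D_def)
      then show ?case by (simp add: pair_scale_Pair)
    qed
    have "s.span A \<times> t.span B \<subseteq> p.span D"
    proof clarify
      fix x y assume "x \<in> s.span A" "y \<in> t.span B"
      then have "(x, 0) + (0, y) \<in> p.span D" using 1 2 by (intro p.span_add) auto
      then show "(x, y) \<in> p.span D" by simp
    qed
    moreover have "p.span D \<subseteq> s.span A \<times> t.span B"
    proof (rule p.span_minimal)
      show "D \<subseteq> s.span A \<times> t.span B"
        by (auto simp: D_def s.span_base t.span_base s.span_zero t.span_zero)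
      show "p.subspace (s.span A \<times> t.span B)"
        by (rule p.subspaceI)
          (auto simp: pair_scale_Pair zero_prod_def s.span_zero t.span_zero s.span_add t.span_add
            s.span_scale t.span_scale)
    qed
    ultimately show "fin_dim_subspace (pair_scale s t) (stalk (sheaf_sum F G) \<pi>)"
      unfolding fin_dim_subspace_def sheaf_sum_simps A B
      using A(1) B(1) by (intro exI[of _ D]) (auto simp: D_def)
  next
    fix \<sigma> \<tau> :: 'p assume "\<sigma> \<le> \<tau>"
    then show "linear_between (pair_scale s t) (stalk (sheaf_sum F G) \<sigma>) (pair_scale s t)
        (stalk (sheaf_sum F G) \<tau>) (res (sheaf_sum F G) \<sigma> \<tau>)"
      using is_sheafD(3)[OF F] is_sheafD(3)[OF G]
      by (auto simp: linear_between_def sheaf_sum_simps pair_scale_Pair)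
  next
    fix \<rho> \<sigma> \<tau> x
    assume "\<rho> \<le> \<sigma>" "\<sigma> \<le> \<tau>" "x \<in> stalk (sheaf_sum F G) \<rho>"
    then show "res (sheaf_sum F G) \<sigma> \<tau> (res (sheaf_sum F G) \<rho> \<sigma> x) = res (sheaf_sum F G) \<rho> \<tau> x"
      using is_sheafD(5)[OF F] is_sheafD(5)[OF G] by (auto simp: sheaf_sum_simps)
  next
    fix \<pi> x
    assume "x \<in> stalk (sheaf_sum F G) \<pi>"
    then show "res (sheaf_sum F G) \<pi> \<pi> x = x"
      using is_sheafD(4)[OF F] is_sheafD(4)[OF G] by (auto simp: sheaf_sum_simps)
  qed
qed

lemma quasi_isomorphismD:
  assumes "quasi_isomorphism A B f"
  shows "chain_map A B f"
    and "x \<in> cocycles A d \<pi> \<Longrightarrow> f d \<pi> x \<in> coboundaries B d \<pi> \<Longrightarrow> x \<in> coboundaries A d \<pi>"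
    and "y \<in> cocycles B d \<pi> \<Longrightarrow> \<exists>x\<in>cocycles A d \<pi>. f d \<pi> x - y \<in> coboundaries B d \<pi>"
  using assms by (auto simp: quasi_isomorphism_def)

text \<open>A null homotopy of \<open>f\<close> on the acyclic mapping cone of \<open>q\<close> consists of the extension \<open>g\<close> and
  the homotopy \<open>h\<close>.\<close>

lemma chain_map_extension:
  fixes A B C :: "('p::order, nat \<Rightarrow> 'k::field) cochain"
  assumes A: "is_complex A" and B: "is_complex B" and q: "quasi_isomorphism B A q"
    and C: "is_complex C" and inj: "\<And>d. injective_sheaf (obj C d)"
    and bdd: "\<And>d \<pi>. d < N \<Longrightarrow> stalk (obj C d) \<pi> = {0}"
    and f: "chain_map B C f"
  obtains g h where "chain_map A C g"
    and "\<And>d. nat_trans fscale (obj B d) fscale (obj C (d - 1)) (h d)"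
    and "\<And>d \<pi> x. x \<in> stalk (obj B d) \<pi> \<Longrightarrow>
      f d \<pi> x = g d \<pi> (q d \<pi> x) + diff C (d - 1) \<pi> (h d \<pi> x) + h (d + 1) \<pi> (diff B d \<pi> x)"
proof -
  note qD = chain_mapD[OF quasi_isomorphismD(1)[OF q]]
  note fD = chain_mapD[OF f]
  note shA = is_complexD(1)[OF A] and shB = is_complexD(1)[OF B] and shC = is_complexD(1)[OF C]
  let ?ps = "pair_scale fscale fscale :: 'k \<Rightarrow> _"
  \<comment> \<open>This is the mapping cone of \<open>q\<close>, with \<open>A\<close> shifted by
    one degree. The minus sign makes \<open>\<delta>\<close> square to zero, and the projection to
    \<open>B\<close> commutes with the differentials.\<close>
  define K where "K d = sheaf_sum (obj B d) (obj A (d - 1))" for d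
  define \<delta> where "\<delta> d \<pi> p = (diff B d \<pi> (fst p), q d \<pi> (fst p) - diff A (d - 1) \<pi> (snd p))" for d \<pi> p
  have stK: "(b, a) \<in> stalk (K d) \<pi> \<longleftrightarrow> b \<in> stalk (obj B d) \<pi> \<and> a \<in> stalk (obj A (d - 1)) \<pi>" for a b d \<pi>
    by (simp add: K_def sheaf_sum_simps)
  have K: "is_sheaf ?ps (K d)" for d
    unfolding K_def by (intro is_sheaf_sheaf_sum shA shB)
  have \<delta>: "nat_trans ?ps (K d) ?ps (K (d + 1)) (\<delta> d)" for d
  proof (rule nat_transI)
    note D = nat_transD[OF is_complexD(2)[OF B, of d]] nat_transD[OF is_complexD(3)[OF A, of d]]
      nat_transD[OF qD(1)[of d]]
    fix \<pi> x assume x: "x \<in> stalk (K d) \<pi>"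
    obtain b a where [simp]: "x = (b, a)" by (cases x)
    have ba: "b \<in> stalk (obj B d) \<pi>" "a \<in> stalk (obj A (d - 1)) \<pi>" using x stK by auto
    show "\<delta> d \<pi> x \<in> stalk (K (d + 1)) \<pi>"
      using ba D by (simp add: \<delta>_def stK stalk_closed[OF shA])
    show "\<delta> d \<pi> (pair_scale fscale fscale c x) = pair_scale fscale fscale c (\<delta> d \<pi> x)" for c
      using ba D by (simp add: \<delta>_def pair_scale_Pair fs.scale_right_diff_distrib)
    show "\<delta> d \<pi> (x + y) = \<delta> d \<pi> x + \<delta> d \<pi> y" if "y \<in> stalk (K d) \<pi>" for y
    proof -
      obtain b' a' where [simp]: "y = (b', a')" by (cases y)
      have "b' \<in> stalk (obj B d) \<pi>" "a' \<in> stalk (obj A (d - 1)) \<pi>" using that stK by auto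
      then show ?thesis using ba D by (simp add: \<delta>_def algebra_simps)
    qed
  next
    fix \<sigma> \<tau> :: 'p and x assume le: "\<sigma> \<le> \<tau>" and x: "x \<in> stalk (K d) \<sigma>"
    note D = nat_transD[OF is_complexD(2)[OF B, of d]] nat_transD[OF is_complexD(3)[OF A, of d]]
      nat_transD[OF qD(1)[of d]]
    obtain b a where [simp]: "x = (b, a)" by (cases x)
    have ba: "b \<in> stalk (obj B d) \<sigma>" "a \<in> stalk (obj A (d - 1)) \<sigma>" using x stK by auto
    show "\<delta> d \<tau> (res (K d) \<sigma> \<tau> x) = res (K (d + 1)) \<sigma> \<tau> (\<delta> d \<sigma> x)"
      using ba le D by (simp add: K_def \<delta>_def sheaf_sum_simps res_diff[OF shA])
  qed
  \<comment> \<open>Injectivity of \<open>q\<close> on cohomology makes \<open>b\<close> the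
    coboundary of some \<open>b0\<close>. Then \<open>a - q d \<pi> b0\<close> is a cocycle, and
    surjectivity on cohomology gives a cocycle \<open>b1\<close> whose image differs from it by a
    coboundary.\<close>
  have exact: "\<exists>y\<in>stalk (K d) \<pi>. \<delta> d \<pi> y = x"
    if "x \<in> stalk (K (d + 1)) \<pi>" "\<delta> (d + 1) \<pi> x = 0" for d \<pi> x
  proof -
    obtain b a where [simp]: "x = (b, a)" by (cases x)
    have ba: "b \<in> stalk (obj B (d + 1)) \<pi>" "a \<in> stalk (obj A d) \<pi>"
      "diff B (d + 1) \<pi> b = 0" "q (d + 1) \<pi> b = diff A d \<pi> a"
      using that by (auto simp: stK \<delta>_def zero_prod_def)
    then have "b \<in> coboundaries B (d + 1) \<pi>"
      by (intro quasi_isomorphismD(2)[OF q]) (auto simp: cocycles_def coboundaries_def)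
    then obtain b0 where b0: "b0 \<in> stalk (obj B d) \<pi>" "diff B d \<pi> b0 = b"
      by (auto simp: coboundaries_def)
    have qb0: "q d \<pi> b0 \<in> stalk (obj A d) \<pi>" using nat_transD(2)[OF qD(1) b0(1)] .
    have "diff A d \<pi> (a - q d \<pi> b0) = diff A d \<pi> a - diff A d \<pi> (q d \<pi> b0)"
      by (rule nat_trans_0_diff(2)[OF shA shA is_complexD(2)[OF A] ba(2) qb0])
    also have "\<dots> = 0" using qD(2)[OF b0(1)] b0 ba by simp
    finally have "a - q d \<pi> b0 \<in> cocycles A d \<pi>"
      using ba qb0 by (simp add: cocycles_def stalk_closed[OF shA])
    from quasi_isomorphismD(3)[OF q this]
    obtain b1 a1 where b1: "b1 \<in> cocycles B d \<pi>" and a1: "a1 \<in> stalk (obj A (d - 1)) \<pi>"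
      and eq: "q d \<pi> b1 - (a - q d \<pi> b0) = diff A (d - 1) \<pi> a1"
      by (auto simp: coboundaries_def)
    have "\<delta> d \<pi> (b0 + b1, a1) = x"
      using b0 b1 eq nat_transD(3)[OF is_complexD(2)[OF B]] nat_transD(3)[OF qD(1)]
      by (simp add: \<delta>_def cocycles_def algebra_simps)
    moreover have "(b0 + b1, a1) \<in> stalk (K d) \<pi>"
      using b0 b1 a1 by (simp add: stK cocycles_def stalk_closed[OF shB])
    ultimately show ?thesis by blast
  qed
  have fst: "nat_trans ?ps (K d) fscale (obj B d) (\<lambda>\<pi>. fst)" for d
    by (rule nat_transI) (auto simp: K_def sheaf_sum_simps pair_scale_Pair)
  have inl: "nat_trans fscale (obj B d) ?ps (K d) (\<lambda>\<pi> b. (b, 0))" for d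
    by (rule nat_transI)
      (auto simp: K_def sheaf_sum_simps pair_scale_Pair stalk_closed[OF shA] res_0[OF shA])
  have inr: "nat_trans fscale (obj A d) ?ps (K (d + 1)) (\<lambda>\<pi> a. (0, a))" for d
    by (rule nat_transI)
      (auto simp: K_def sheaf_sum_simps pair_scale_Pair stalk_closed[OF shB] res_0[OF shB])
  have chain: "f (d + 1) \<pi> (fst (\<delta> d \<pi> x)) = diff C d \<pi> (f d \<pi> (fst x))"
    if "x \<in> stalk (K d) \<pi>" for d \<pi> x
    using that fD(2) by (cases x) (simp add: stK \<delta>_def)
  obtain \<sigma> where \<sigma>: "\<And>d. nat_trans ?ps (K d) fscale (obj C (d - 1)) (\<sigma> d)"
    and \<sigma>eq: "\<And>d \<pi> x. x \<in> stalk (K d) \<pi> \<Longrightarrow>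
      f d \<pi> (fst x) = diff C (d - 1) \<pi> (\<sigma> d \<pi> x) + \<sigma> (d + 1) \<pi> (\<delta> d \<pi> x)"
  proof (rule acyclic_null_homotopic[OF K \<delta> exact C inj bdd nat_trans_comp[OF fst fD(1)] chain])
    fix h
    assume "\<And>d. nat_trans ?ps (K d) fscale (obj C (d - 1)) (h d)"
      and "\<And>d \<pi> x. x \<in> stalk (K d) \<pi> \<Longrightarrow>
        f d \<pi> (fst x) = diff C (d - 1) \<pi> (h d \<pi> x) + h (d + 1) \<pi> (\<delta> d \<pi> x)"
    then show thesis by (rule that)
  qed
  \<comment> \<open>The null homotopy has degree -1 and \<open>A\<close> sits one degree higher in
    the cone, so its restriction to \<open>A\<close> has degree 0 and is the desired extension; its
    restriction to \<open>B\<close> is the homotopy.\<close>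
  define g where "g d \<pi> a = \<sigma> (d + 1) \<pi> (0, a)" for d \<pi> a
  define h where "h d \<pi> b = \<sigma> d \<pi> (b, 0)" for d \<pi> b
  have f0: "f d \<pi> 0 = 0" and q0: "q d \<pi> 0 = 0" and dB0: "diff B d \<pi> 0 = 0" and dA0: "diff A d \<pi> 0 = 0"
    and \<sigma>0: "\<sigma> d \<pi> 0 = 0" for d \<pi>
    using nat_trans_0_diff(1)[OF shB shC fD(1)] nat_trans_0_diff(1)[OF shB shA qD(1)]
      nat_trans_0_diff(1)[OF shB shB is_complexD(2)[OF B]]
      nat_trans_0_diff(1)[OF shA shA is_complexD(2)[OF A]]
      nat_trans_0_diff(1)[OF K shC \<sigma>] by blast+
  show thesis
  proof (rule that)
    show "chain_map A C g"
      unfolding chain_map_def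
    proof (intro conjI allI ballI)
      fix d
      have "nat_trans ?ps (K (d + 1)) fscale (obj C d) (\<sigma> (d + 1))"
        using \<sigma>[of "d + 1"] by simp
      from nat_trans_comp[OF inr this]
      show "nat_trans fscale (obj A d) fscale (obj C d) (g d)" by (simp add: g_def[abs_def])
      fix \<pi> x assume x: "x \<in> stalk (obj A d) \<pi>"
      then have dx: "diff A d \<pi> x \<in> stalk (obj A (d + 1)) \<pi>"
        using nat_transD(2)[OF is_complexD(2)[OF A]] by blast
      \<comment> \<open>On \<open>(0, x)\<close> the left side of the homotopy identity vanishes;
        what remains says that \<open>g\<close> commutes with the differentials.\<close>
      have "(0, x) \<in> stalk (K (d + 1)) \<pi>" using x by (simp add: stK stalk_closed[OF shB])
      from \<sigma>eq[OF this]
      have "0 = diff C d \<pi> (g d \<pi> x) + \<sigma> (d + 1 + 1) \<pi> (0, - diff A d \<pi> x)"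
        by (simp add: f0 g_def \<delta>_def q0 dB0)
      moreover have "\<sigma> (d + 1 + 1) \<pi> (0 - (0, diff A d \<pi> x)) = \<sigma> (d + 1 + 1) \<pi> 0 - g (d + 1) \<pi> (diff A d \<pi> x)"
        unfolding g_def
        by (rule nat_trans_0_diff(2)[OF K shC \<sigma>])
          (unfold stK add_diff_cancel_right',
            (intro conjI stalk_closed(1)[OF shB] stalk_closed(1)[OF K] dx)+)
      moreover have "0 - (0, diff A d \<pi> x) = (0 :: nat \<Rightarrow> 'k, - diff A d \<pi> x)"
        by (simp add: zero_prod_def)
      ultimately have "0 = diff C d \<pi> (g d \<pi> x) + (0 - g (d + 1) \<pi> (diff A d \<pi> x))"
        by (simp only: \<sigma>0)
      then have "0 = diff C d \<pi> (g d \<pi> x) - g (d + 1) \<pi> (diff A d \<pi> x)"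
        by (simp only: diff_0 add_uminus_conv_diff)
      from right_minus_eq[THEN iffD1, OF this[symmetric]]
      show "g (d + 1) \<pi> (diff A d \<pi> x) = diff C d \<pi> (g d \<pi> x)" by (rule sym)
    qed
    show "nat_trans fscale (obj B d) fscale (obj C (d - 1)) (h d)" for d
      unfolding h_def[abs_def] by (rule nat_trans_comp[OF inl \<sigma>])
    fix d \<pi> x assume x: "x \<in> stalk (obj B d) \<pi>"
    let ?y = "diff B d \<pi> x" and ?z = "q d \<pi> x"
    have yz: "?y \<in> stalk (obj B (d + 1)) \<pi>" "?z \<in> stalk (obj A d) \<pi>"
      using nat_transD(2)[OF is_complexD(2)[OF B] x] nat_transD(2)[OF qD(1) x] .
    have "(x, 0) \<in> stalk (K d) \<pi>" using x by (simp add: stK stalk_closed[OF shA])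
    from \<sigma>eq[OF this] have "f d \<pi> x = diff C (d - 1) \<pi> (h d \<pi> x) + \<sigma> (d + 1) \<pi> (?y, ?z)"
      by (simp add: h_def \<delta>_def dA0)
    also have "\<sigma> (d + 1) \<pi> (?y, ?z) = \<sigma> (d + 1) \<pi> ((?y, 0) + (0, ?z))" by simp
    also have "\<dots> = h (d + 1) \<pi> ?y + g d \<pi> ?z"
      unfolding h_def g_def
      by (rule nat_transD(3)[OF \<sigma>])
        (use yz in \<open>simp_all add: stK stalk_closed[OF shA] stalk_closed[OF shB]\<close>)
    finally show "f d \<pi> x = g d \<pi> ?z + diff C (d - 1) \<pi> (h d \<pi> x) + h (d + 1) \<pi> ?y"
      by (simp only: ac_simps)
  qed
qed

section \<open>Composition and cancellation of quasi-isomorphisms; straightening zigzags\<close>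

lemma coboundaries_closed:
  assumes C: "is_complex C"
  shows "x \<in> coboundaries C d \<pi> \<Longrightarrow> y \<in> coboundaries C d \<pi> \<Longrightarrow> x + y \<in> coboundaries C d \<pi>"
    and "x \<in> coboundaries C d \<pi> \<Longrightarrow> y \<in> coboundaries C d \<pi> \<Longrightarrow> x - y \<in> coboundaries C d \<pi>"
    and "coboundaries C d \<pi> \<subseteq> cocycles C d \<pi>"
    and "0 \<in> coboundaries C d \<pi>"
proof -
  note sh = is_complexD(1)[OF C] and D = is_complexD(3)[OF C, of d]
  show "x \<in> coboundaries C d \<pi> \<Longrightarrow> y \<in> coboundaries C d \<pi> \<Longrightarrow> x + y \<in> coboundaries C d \<pi>"
    using nat_transD(3)[OF D, symmetric] stalk_closed(2)[OF sh] by (auto simp: coboundaries_def)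
  show "x \<in> coboundaries C d \<pi> \<Longrightarrow> y \<in> coboundaries C d \<pi> \<Longrightarrow> x - y \<in> coboundaries C d \<pi>"
    using nat_trans_0_diff(2)[OF sh sh D, symmetric] stalk_closed(3)[OF sh] by (auto simp: coboundaries_def)
  show "coboundaries C d \<pi> \<subseteq> cocycles C d \<pi>"
    using nat_transD(2)[OF D] is_complexD(5)[OF C] by (auto simp: coboundaries_def cocycles_def)
  show "0 \<in> coboundaries C d \<pi>"
    using nat_trans_0_diff(1)[OF sh sh D] stalk_closed(1)[OF sh] by (force simp: coboundaries_def)
qed

lemma chain_map_cocycles:
  assumes A: "is_complex A" and B: "is_complex B" and f: "chain_map A B f"
  shows "x \<in> cocycles A d \<pi> \<Longrightarrow> f d \<pi> x \<in> cocycles B d \<pi>"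
    and "x \<in> coboundaries A d \<pi> \<Longrightarrow> f d \<pi> x \<in> coboundaries B d \<pi>"
proof -
  note fD = chain_mapD[OF f]
  have "f (d + 1) \<pi> 0 = 0"
    by (rule nat_trans_0_diff(1)[OF is_complexD(1)[OF A] is_complexD(1)[OF B] fD(1)])
  then show "x \<in> cocycles A d \<pi> \<Longrightarrow> f d \<pi> x \<in> cocycles B d \<pi>"
    using fD(2)[of x d \<pi>] nat_transD(2)[OF fD(1)] by (auto simp: cocycles_def)
  show "x \<in> coboundaries A d \<pi> \<Longrightarrow> f d \<pi> x \<in> coboundaries B d \<pi>"
    using fD(2)[of _ "d - 1" \<pi>] nat_transD(2)[OF fD(1)] by (auto simp: coboundaries_def)
qed

lemma quasi_isomorphism_comp:
  assumes A: "is_complex A" and B: "is_complex B" and C: "is_complex C"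
    and f: "quasi_isomorphism A B f" and g: "quasi_isomorphism B C g"
  shows "quasi_isomorphism A C (\<lambda>d \<pi> x. g d \<pi> (f d \<pi> x))"
  unfolding quasi_isomorphism_def
proof (intro conjI allI ballI impI)
  note fc = quasi_isomorphismD(1)[OF f] and gc = quasi_isomorphismD(1)[OF g]
  show "chain_map A C (\<lambda>d \<pi> x. g d \<pi> (f d \<pi> x))"
    unfolding chain_map_def
    using nat_trans_comp[OF chain_mapD(1)[OF fc] chain_mapD(1)[OF gc]]
      chain_mapD(2)[OF fc] chain_mapD(2)[OF gc] nat_transD(2)[OF chain_mapD(1)[OF fc]]
    by simp
  fix d \<pi>
  show "x \<in> coboundaries A d \<pi>" if "x \<in> cocycles A d \<pi>" "g d \<pi> (f d \<pi> x) \<in> coboundaries C d \<pi>" for x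
    using that quasi_isomorphismD(2)[OF f] quasi_isomorphismD(2)[OF g] chain_map_cocycles[OF A B fc]
    by blast
  fix z assume "z \<in> cocycles C d \<pi>"
  then obtain y where y: "y \<in> cocycles B d \<pi>" "g d \<pi> y - z \<in> coboundaries C d \<pi>"
    using quasi_isomorphismD(3)[OF g] by blast
  then obtain x where x: "x \<in> cocycles A d \<pi>" "f d \<pi> x - y \<in> coboundaries B d \<pi>"
    using quasi_isomorphismD(3)[OF f] by blast
  have "g d \<pi> (f d \<pi> x - y) = g d \<pi> (f d \<pi> x) - g d \<pi> y"
    by (rule nat_trans_0_diff(2)[OF is_complexD(1)[OF B] is_complexD(1)[OF C] chain_mapD(1)[OF gc]])
      (use chain_map_cocycles(1)[OF A B fc x(1)] y(1) in \<open>auto simp: cocycles_def\<close>)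
  then have "g d \<pi> (f d \<pi> x) - g d \<pi> y \<in> coboundaries C d \<pi>"
    using chain_map_cocycles(2)[OF B C gc x(2)] by simp
  from coboundaries_closed(1)[OF C this y(2)]
  show "\<exists>x\<in>cocycles A d \<pi>. g d \<pi> (f d \<pi> x) - z \<in> coboundaries C d \<pi>"
    using x(1) by auto
qed

text \<open>On cohomology \<open>g\<close> after \<open>q\<close> equals \<open>f\<close>, and
  \<open>q\<close> and \<open>f\<close> are bijective there, so \<open>g\<close> is too. The
  comparison is asked on cocycles, where one of the two homotopy terms drops out.\<close>

lemma quasi_isomorphism_cancel:
  assumes A: "is_complex A" and B: "is_complex B" and C: "is_complex C"
    and q: "quasi_isomorphism B A q" and f: "quasi_isomorphism B C f" and g: "chain_map A C g"
    and homotopic: "\<And>d \<pi> x. x \<in> cocycles B d \<pi> \<Longrightarrow> f d \<pi> x - g d \<pi> (q d \<pi> x) \<in> coboundaries C d \<pi>"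
  shows "quasi_isomorphism A C g"
  unfolding quasi_isomorphism_def
proof (intro conjI allI ballI impI g)
  note qc = quasi_isomorphismD(1)[OF q]
  fix d \<pi>
  {
    fix x assume x: "x \<in> cocycles A d \<pi>" "g d \<pi> x \<in> coboundaries C d \<pi>"
    obtain b where b: "b \<in> cocycles B d \<pi>" "q d \<pi> b - x \<in> coboundaries A d \<pi>"
      using quasi_isomorphismD(3)[OF q x(1)] by blast
    have "g d \<pi> (q d \<pi> b - x) = g d \<pi> (q d \<pi> b) - g d \<pi> x"
      by (rule nat_trans_0_diff(2)[OF is_complexD(1)[OF A] is_complexD(1)[OF C] chain_mapD(1)[OF g]])
        (use chain_map_cocycles(1)[OF B A qc b(1)] x(1) in \<open>auto simp: cocycles_def\<close>)
    then have "g d \<pi> (q d \<pi> b) - g d \<pi> x \<in> coboundaries C d \<pi>"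
      using chain_map_cocycles(2)[OF A C g b(2)] by simp
    from coboundaries_closed(1)[OF C this x(2)] have "g d \<pi> (q d \<pi> b) \<in> coboundaries C d \<pi>" by simp
    from coboundaries_closed(1)[OF C homotopic[OF b(1)] this]
    have "b \<in> coboundaries B d \<pi>" using quasi_isomorphismD(2)[OF f b(1)] by simp
    then have "q d \<pi> b \<in> coboundaries A d \<pi>" by (rule chain_map_cocycles(2)[OF B A qc])
    from coboundaries_closed(2)[OF A this b(2)] show "x \<in> coboundaries A d \<pi>" by simp
  }
  fix z assume "z \<in> cocycles C d \<pi>"
  then obtain b where b: "b \<in> cocycles B d \<pi>" "f d \<pi> b - z \<in> coboundaries C d \<pi>"
    using quasi_isomorphismD(3)[OF f] by blast
  from coboundaries_closed(2)[OF C b(2) homotopic[OF b(1)]]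
  have "g d \<pi> (q d \<pi> b) - z \<in> coboundaries C d \<pi>" by simp
  then show "\<exists>x\<in>cocycles A d \<pi>. g d \<pi> x - z \<in> coboundaries C d \<pi>"
    using chain_map_cocycles(1)[OF B A qc b(1)] by blast
qed

lemma quasi_isomorphism_id:
  assumes "is_complex C"
  shows "quasi_isomorphism C C (\<lambda>d \<pi> x. x)"
proof -
  have "x - x \<in> coboundaries C d \<pi>" for x d \<pi>
    using coboundaries_closed(4)[OF assms] by simp
  then show ?thesis
    unfolding quasi_isomorphism_def chain_map_def using nat_trans_id by blast
qed

text \<open>This turns a roof \<open>A \<leftarrow> B \<rightarrow> C\<close> into an arrow
  \<open>A \<rightarrow> C\<close>. The homotopy is kept in the conclusion, because minimality needs
  the identity on socles and not just equality on cohomology.\<close>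

lemma quasi_isomorphism_extension_qis:
  assumes A: "is_complex A" and B: "is_complex B" and q: "quasi_isomorphism B A q"
    and C: "is_complex C" and inj: "\<And>d. injective_sheaf (obj C d)"
    and bdd: "\<And>d \<pi>. d < N \<Longrightarrow> stalk (obj C d) \<pi> = {0}"
    and f: "quasi_isomorphism B C f"
  obtains g h where "quasi_isomorphism A C g"
    and "\<And>d. nat_trans fscale (obj B d) fscale (obj C (d - 1)) (h d)"
    and "\<And>d \<pi> x. x \<in> stalk (obj B d) \<pi> \<Longrightarrow>
      f d \<pi> x = g d \<pi> (q d \<pi> x) + diff C (d - 1) \<pi> (h d \<pi> x) + h (d + 1) \<pi> (diff B d \<pi> x)"
proof -
  obtain g h where g: "chain_map A C g"
    and h: "\<And>d. nat_trans fscale (obj B d) fscale (obj C (d - 1)) (h d)"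
    and eq: "\<And>d \<pi> x. x \<in> stalk (obj B d) \<pi> \<Longrightarrow>
      f d \<pi> x = g d \<pi> (q d \<pi> x) + diff C (d - 1) \<pi> (h d \<pi> x) + h (d + 1) \<pi> (diff B d \<pi> x)"
    using chain_map_extension[OF A B q C inj bdd quasi_isomorphismD(1)[OF f]] by blast
  have "quasi_isomorphism A C g"
  proof (rule quasi_isomorphism_cancel[OF A B C q f g])
    fix d \<pi> x assume x: "x \<in> cocycles B d \<pi>"
    have "h (d + 1) \<pi> 0 = 0"
      by (rule nat_trans_0_diff(1)[OF is_complexD(1)[OF B] is_complexD(1)[OF C] h])
    then have "f d \<pi> x - g d \<pi> (q d \<pi> x) = diff C (d - 1) \<pi> (h d \<pi> x)"
      using eq[of x d \<pi>] x by (simp add: cocycles_def)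
    then show "f d \<pi> x - g d \<pi> (q d \<pi> x) \<in> coboundaries C d \<pi>"
      using x nat_transD(2)[OF h] by (auto simp: cocycles_def coboundaries_def)
  qed
  then show thesis using that h eq by blast
qed

text \<open>Induction along the zigzag from its end at \<open>C\<close>: an arrow towards
  \<open>C\<close> is composed, an arrow away from \<open>C\<close> is bypassed by extension into
  the injective complex \<open>C\<close>.\<close>

lemma quasi_isomorphic_imp_quasi_isomorphism:
  assumes JC: "quasi_isomorphic J C" and C: "is_complex C" and inj: "\<And>d. injective_sheaf (obj C d)"
    and bdd: "\<And>d \<pi>. d < N \<Longrightarrow> stalk (obj C d) \<pi> = {0}"
  shows "\<exists>f. quasi_isomorphism J C f"
proof -
  have "is_complex J \<and> (\<exists>f. quasi_isomorphism J C f)"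
    using JC unfolding quasi_isomorphic_def
  proof (induction rule: converse_equivclp_induct)
    case base
    show ?case using C quasi_isomorphism_id by blast
  next
    case (step Y Z)
    then obtain f where Z: "is_complex Z" and f: "quasi_isomorphism Z C f" by blast
    from step(1) show ?case
    proof (elim disjE conjE exE)
      fix q assume "is_complex Y" "quasi_isomorphism Y Z q"
      then show ?thesis using quasi_isomorphism_comp[OF _ Z C _ f] by blast
    next
      fix q assume "is_complex Y" "quasi_isomorphism Z Y q"
      then show ?thesis using quasi_isomorphism_extension_qis[OF _ Z _ C inj bdd f] by metis
    qed
  qed
  then show ?thesis by blast
qed

section \<open>Socles and minimality\<close>

definition socle :: "('p::order, 'v::zero) sheaf \<Rightarrow> 'p \<Rightarrow> 'v set" where
  "socle F \<pi> = {x \<in> stalk F \<pi>. \<forall>\<tau>. \<pi> < \<tau> \<longrightarrow> res F \<pi> \<tau> x = 0}"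

lemma socle_subset: "socle F \<pi> \<subseteq> stalk F \<pi>"
  by (auto simp: socle_def)

text \<open>Coordinate \<open>i\<close> survives the restriction from \<open>\<pi>\<close> to
  \<open>ls ! i\<close>, so a socle element can involve it only if this restriction is not proper,
  that is, if \<open>ls ! i = \<pi>\<close>.\<close>

lemma socle_inj_sheaf:
  "x \<in> socle (inj_sheaf ls) \<pi> \<longleftrightarrow> (\<forall>i. x i \<noteq> 0 \<longrightarrow> i < length ls \<and> ls ! i = \<pi>)"
proof
  assume x: "x \<in> socle (inj_sheaf ls) \<pi>"
  show "\<forall>i. x i \<noteq> 0 \<longrightarrow> i < length ls \<and> ls ! i = \<pi>"
  proof (intro allI impI)
    fix i assume "x i \<noteq> 0"
    then have i: "i < length ls" "\<pi> \<le> ls ! i"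
      using x by (auto simp: socle_def inj_sheaf_simps)
    have "\<not> \<pi> < ls ! i"
    proof
      assume "\<pi> < ls ! i"
      then have "res (inj_sheaf ls) \<pi> (ls ! i) x i = 0" using x by (simp add: socle_def)
      then show False using i \<open>x i \<noteq> 0\<close> by (simp add: inj_sheaf_simps)
    qed
    then show "i < length ls \<and> ls ! i = \<pi>" using i by (simp add: order_less_le)
  qed
next
  assume "\<forall>i. x i \<noteq> 0 \<longrightarrow> i < length ls \<and> ls ! i = \<pi>"
  then show "x \<in> socle (inj_sheaf ls) \<pi>"
    unfolding socle_def by (fastforce simp: fun_eq_iff inj_sheaf_simps)
qed

lemma nat_trans_socle:
  assumes "is_sheaf s F" "is_sheaf t G" "nat_trans s F t G \<phi>" "x \<in> socle F \<pi>"
  shows "\<phi> \<pi> x \<in> socle G \<pi>"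
  using assms(4) nat_transD(2)[OF assms(3)] nat_transD(5)[OF assms(3), symmetric]
    nat_trans_0_diff(1)[OF assms(1-3)]
  by (auto simp: socle_def)

section \<open>Multiplicities of labels compared through socles\<close>

lemma independent_unit_vec:
  assumes "finite S"
  shows "fs.independent ((unit_vec :: nat \<Rightarrow> nat \<Rightarrow> 'k::field) ` S)"
proof (rule fs.independent_if_scalars_zero)
  have inj: "inj_on (unit_vec :: nat \<Rightarrow> nat \<Rightarrow> 'k) S"
    by (auto simp: inj_on_def unit_vec_def fun_eq_iff split: if_splits)
  fix f :: "(nat \<Rightarrow> 'k) \<Rightarrow> 'k" and x :: "nat \<Rightarrow> 'k"
  assume sum: "(\<Sum>x\<in>unit_vec ` S. fscale (f x) x) = 0" and "x \<in> unit_vec ` S"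
  then obtain j where j: "j \<in> S" "x = unit_vec j" by blast
  have "0 = (\<Sum>i\<in>S. fscale (f (unit_vec i)) (unit_vec i)) j"
    using sum inj by (simp only: sum.reindex o_def zero_fun_apply)
  also have "\<dots> = (\<Sum>i\<in>S. if i = j then f (unit_vec j) else 0)"
    by (simp, rule sum.cong) (auto simp: unit_vec_def)
  also have "\<dots> = f x" using assms j by simp
  finally show "f x = 0" ..
qed (use assms in simp)

text \<open>Both socles are coordinate spaces on the positions labeled \<open>\<pi>\<close>, so an
  embedding compares their dimensions.\<close>

lemma socle_embedding_card_le:
  fixes f :: "(nat \<Rightarrow> 'k::field) \<Rightarrow> nat \<Rightarrow> 'k"
  assumes f: "linear_between fscale (socle (inj_sheaf ls) \<pi>) fscale (socle (inj_sheaf ls') \<pi>) f"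
    and inj: "inj_on f (socle (inj_sheaf ls) \<pi>)"
  shows "card {i\<in>{..<length ls}. ls ! i = \<pi>} \<le> card {i\<in>{..<length ls'}. ls' ! i = \<pi>}"
proof -
  interpret ff: vector_space_pair "fscale :: 'k \<Rightarrow> _" "fscale :: 'k \<Rightarrow> _" ..
  define S where "S = {i\<in>{..<length ls}. ls ! i = \<pi>}"
  define S' where "S' = {i\<in>{..<length ls'}. ls' ! i = \<pi>}"
  let ?V = "socle (inj_sheaf ls) \<pi> :: (nat \<Rightarrow> 'k) set"
  let ?B = "(unit_vec :: nat \<Rightarrow> nat \<Rightarrow> 'k) ` S"
  have V: "fs.subspace ?V"
  proof (rule fs.subspaceI)
    show "x + y \<in> ?V" if "x \<in> ?V" "y \<in> ?V" for x y
      using that by (simp add: socle_inj_sheaf) (metis add_0)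
  qed (auto simp: socle_inj_sheaf)
  \<comment> \<open>Independence of an image is argued for maps linear on the whole space. The
    extension \<open>g\<close> is known to be injective only on the span of the unit vectors, which
    suffices.\<close>
  obtain g where g: "Vector_Spaces.linear fscale fscale g" and gf: "\<And>x. x \<in> ?V \<Longrightarrow> g x = f x"
    using linear_extension[OF vector_space_fscale vector_space_fscale V f] by blast
  have BV: "?B \<subseteq> ?V"
    by (auto simp: S_def socle_inj_sheaf unit_vec_def split: if_splits)
  then have "fs.span ?B \<subseteq> ?V" using V by (rule fs.span_minimal)
  then have inj_g: "inj_on g (fs.span ?B)"
    using inj gf unfolding inj_on_def by (metis subsetD)
  have "fs.independent (g ` ?B)"
    by (rule ff.linear_independent_injective_image[OF g independent_unit_vec inj_g])
      (simp add: S_def)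
  moreover have "g ` ?B \<subseteq> fs.span (unit_vec ` S')"
  proof
    fix y assume "y \<in> g ` ?B"
    then have "y \<in> socle (inj_sheaf ls') \<pi>"
      using BV gf linear_betweenD(1)[OF f] by auto
    then have y: "y i = 0" if "i \<notin> S'" for i
      using that by (auto simp: S'_def socle_inj_sheaf)
    have "y = (\<Sum>i\<in>S'. fscale (y i) (unit_vec i))"
      by (rule unit_vec_expansion[OF _ y]) (simp add: S'_def)
    also have "\<dots> \<in> fs.span (unit_vec ` S')"
      by (intro fs.span_sum fs.span_scale fs.span_base) auto
    finally show "y \<in> fs.span (unit_vec ` S')" .
  qed
  ultimately have "card (g ` ?B) \<le> card ((unit_vec :: nat \<Rightarrow> nat \<Rightarrow> 'k) ` S')"
    by (intro fs.independent_span_bound[THEN conjunct2]) (simp add: S'_def)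
  also have "\<dots> \<le> card S'" by (rule card_image_le) (simp add: S'_def)
  also have "card (g ` ?B) = card ?B"
    by (rule card_image) (rule inj_on_subset[OF inj_g fs.span_superset])
  also have "card ?B = card S"
    by (rule card_image) (auto simp: inj_on_def unit_vec_def fun_eq_iff split: if_splits)
  finally show ?thesis by (simp add: S_def S'_def)
qed

lemma length_eq_sum_card:
  assumes "set ls \<subseteq> P" "finite P"
  shows "length ls = (\<Sum>\<pi>\<in>P. card {i\<in>{..<length ls}. ls ! i = \<pi>})"
proof -
  have "(\<Sum>\<pi>\<in>P. \<Sum>i | i \<in> {..<length ls} \<and> ls ! i = \<pi>. 1) = (\<Sum>i<length ls. 1)"
    by (rule sum.group) (use assms nth_mem in auto)
  then have "(\<Sum>\<pi>\<in>P. card {i\<in>{..<length ls}. ls ! i = \<pi>}) = card {..<length ls}"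
    by (simp only: card_eq_sum)
  then show ?thesis by simp
qed

lemma length_le_of_socle_embeddings:
  assumes "\<And>\<pi>. \<exists>f :: (nat \<Rightarrow> 'k::field) \<Rightarrow> nat \<Rightarrow> 'k.
    linear_between fscale (socle (inj_sheaf ls) \<pi>) fscale (socle (inj_sheaf ls') \<pi>) f \<and>
    inj_on f (socle (inj_sheaf ls) \<pi>)"
  shows "length ls \<le> length ls'"
proof -
  let ?P = "set ls \<union> set ls'"
  have "length ls = (\<Sum>\<pi>\<in>?P. card {i\<in>{..<length ls}. ls ! i = \<pi>})"
    by (rule length_eq_sum_card) auto
  also have "\<dots> \<le> (\<Sum>\<pi>\<in>?P. card {i\<in>{..<length ls'}. ls' ! i = \<pi>})"
    by (rule sum_mono) (use assms socle_embedding_card_le in blast)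
  also have "\<dots> = length ls'"
    by (rule length_eq_sum_card[symmetric]) auto
  finally show ?thesis .
qed

text \<open>A homotopy equivalence \<open>C \<rightarrow> J\<close> has a left inverse on socles, where the homotopy terms vanish.\<close>

lemma minimal_complexI:
  fixes C :: "('p::order, nat \<Rightarrow> 'k::field) cochain"
  assumes C: "is_complex C" and inj: "\<And>d. injective_sheaf (obj C d)"
    and bdd: "\<And>d \<pi>. d < N \<Longrightarrow> stalk (obj C d) \<pi> = {0}"
    and socle: "\<And>d \<pi> x. x \<in> socle (obj C d) \<pi> \<Longrightarrow> diff C d \<pi> x = 0"
  shows "minimal_complex C"
  unfolding minimal_complex_def
proof (intro allI impI, elim conjE)
  fix J d m n
  assume J: "bounded_complex J" and injJ: "\<forall>d. injective_sheaf (obj J d)"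
    and JC: "quasi_isomorphic J C"
    and m: "num_summands (obj C d) m" and n: "num_summands (obj J d) n"
  obtain M where Jc: "is_complex J" and "\<And>d \<pi>. \<bar>d\<bar> > M \<Longrightarrow> stalk (obj J d) \<pi> = {0}"
    using J by (auto simp: bounded_complex_def)
  then have bddJ: "stalk (obj J d) \<pi> = {0}" if "d < - M" for d \<pi> using that by simp
  obtain f where f: "quasi_isomorphism J C f"
    using quasi_isomorphic_imp_quasi_isomorphism[OF JC C inj bdd] by blast
  \<comment> \<open>As \<open>J\<close> is injective and bounded below too, the identity of
    \<open>J\<close> extends along \<open>f\<close> to \<open>g\<close>. Extending the identity of
    \<open>C\<close> along \<open>g\<close> in turn yields \<open>g'\<close> and a homotopy from
    \<open>g'\<close> after \<open>g\<close> to the identity.\<close>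
  obtain g where g: "quasi_isomorphism C J g"
    by (rule quasi_isomorphism_extension_qis[OF C Jc f Jc injJ[rule_format] bddJ
          quasi_isomorphism_id[OF Jc]])
  obtain g' h where h: "\<And>d. nat_trans fscale (obj C d) fscale (obj C (d - 1)) (h d)"
    and eq: "\<And>d \<pi> x. x \<in> stalk (obj C d) \<pi> \<Longrightarrow>
      x = g' d \<pi> (g d \<pi> x) + diff C (d - 1) \<pi> (h d \<pi> x) + h (d + 1) \<pi> (diff C d \<pi> x)"
    by (rule quasi_isomorphism_extension_qis[OF Jc C g C inj bdd quasi_isomorphism_id[OF C]])
      (assumption, rule that)
  note sh = is_complexD(1)[OF C] and shJ = is_complexD(1)[OF Jc]
  have gg: "g' d \<pi> (g d \<pi> x) = x" if x: "x \<in> socle (obj C d) \<pi>" for \<pi> x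
  proof -
    \<comment> \<open>The homotopy maps the socle into the socle one degree lower, and the
      differential of \<open>C\<close> vanishes there as well.\<close>
    have "diff C (d - 1) \<pi> (h d \<pi> x) = 0"
      by (rule socle[OF nat_trans_socle[OF sh sh h x]])
    moreover have "h (d + 1) \<pi> (diff C d \<pi> x) = 0"
      unfolding socle[OF x] by (rule nat_trans_0_diff(1)[OF sh sh h])
    ultimately show ?thesis using eq[of x d \<pi>] x socle_subset by fastforce
  qed
  obtain ls \<phi> where ls: "length ls = m" and \<phi>: "nat_trans fscale (obj C d) fscale (inj_sheaf ls) \<phi>"
    and bij: "\<And>\<pi>. bij_betw (\<phi> \<pi>) (stalk (obj C d) \<pi>) (stalk (inj_sheaf ls) \<pi>)"
    using m by (auto simp: num_summands_def sheaf_iso_def)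
  obtain ls' \<psi> where ls': "length ls' = n"
    and \<psi>: "nat_trans fscale (obj J d) fscale (inj_sheaf ls') \<psi>"
    and bij': "\<And>\<pi>. bij_betw (\<psi> \<pi>) (stalk (obj J d) \<pi>) (stalk (inj_sheaf ls') \<pi>)"
    using n by (auto simp: num_summands_def sheaf_iso_def)
  let ?i = "\<lambda>\<pi>. inv_into (stalk (obj C d) \<pi>) (\<phi> \<pi>)"
  note \<phi>' = nat_trans_inverse[OF sh \<phi> bij]
  note gn = chain_mapD(1)[OF quasi_isomorphismD(1)[OF g]]
  \<comment> \<open>Conjugating \<open>g\<close> by the isomorphisms to direct sums of
    \<open>[\<pi>]\<close> turns its injectivity on socles into an embedding of coordinate
    spaces.\<close>
  define \<theta> where "\<theta> \<pi> x = \<psi> \<pi> (g d \<pi> (?i \<pi> x))" for \<pi> x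
  have \<theta>: "nat_trans fscale (inj_sheaf ls) fscale (inj_sheaf ls') \<theta>"
    unfolding \<theta>_def by (rule nat_trans_comp[OF nat_trans_comp[OF \<phi>' gn] \<psi>])
  have "length ls \<le> length ls'"
  proof (rule length_le_of_socle_embeddings, intro exI conjI)
    fix \<pi>
    show "linear_between fscale (socle (inj_sheaf ls) \<pi>) fscale (socle (inj_sheaf ls') \<pi>) (\<theta> \<pi>)"
      unfolding linear_between_def
      by (intro conjI ballI allI nat_transD(3,4)[OF \<theta>] subsetD[OF socle_subset]
          nat_trans_socle[OF is_sheaf_inj_sheaf is_sheaf_inj_sheaf \<theta>])
    show "inj_on (\<theta> \<pi>) (socle (inj_sheaf ls) \<pi>)"
    proof (rule inj_onI)
      fix x y assume xy: "x \<in> socle (inj_sheaf ls) \<pi>" "y \<in> socle (inj_sheaf ls) \<pi>" "\<theta> \<pi> x = \<theta> \<pi> y"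
      note s = xy(1,2)[THEN nat_trans_socle[OF is_sheaf_inj_sheaf sh \<phi>']]
      have st: "g d \<pi> (?i \<pi> x) \<in> stalk (obj J d) \<pi>" "g d \<pi> (?i \<pi> y) \<in> stalk (obj J d) \<pi>"
        using s[THEN subsetD[OF socle_subset]] nat_transD(2)[OF gn] by auto
      have "g d \<pi> (?i \<pi> x) = g d \<pi> (?i \<pi> y)"
        using bij'[of \<pi>] st xy(3) unfolding bij_betw_def \<theta>_def by (meson inj_onD)
      then have "?i \<pi> x = ?i \<pi> y" using gg s by metis
      moreover have "\<phi> \<pi> (?i \<pi> z) = z" if "z \<in> socle (inj_sheaf ls) \<pi>" for z
        using bij[of \<pi>] that socle_subset by (metis bij_betw_inv_into_right subsetD)
      ultimately show "x = y" using xy by metis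
    qed
  qed
  then show "m \<le> n" using ls ls' by simp
qed

section \<open>The step algorithm\<close>

lemma perp_basis_exists: "\<exists>bs. is_basis_of bs (perp ls \<pi> V)"
proof -
  have "fs.subspace (perp ls \<pi> V)"
  proof (rule fs.subspaceI)
    show "x + y \<in> perp ls \<pi> V" if "x \<in> perp ls \<pi> V" "y \<in> perp ls \<pi> V" for x y
      using that stalk_closed(2)[OF is_sheaf_inj_sheaf]
      by (auto simp: perp_def dot_def distrib_right sum.distrib)
    show "fscale c x \<in> perp ls \<pi> V" if "x \<in> perp ls \<pi> V" for c x
      using that stalk_closed(4)[OF is_sheaf_inj_sheaf]
      by (auto simp: perp_def dot_def mult.assoc simp flip: sum_distrib_left)
  qed (auto simp: perp_def dot_def stalk_closed(1)[OF is_sheaf_inj_sheaf])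
  moreover have "u i = 0" if "u \<in> perp ls \<pi> V" "i \<notin> {..<length ls}" for u i
    using that by (auto simp: perp_def inj_sheaf_simps)
  ultimately obtain B where "finite B" "fs.independent B" "fs.span B = perp ls \<pi> V"
    using subspace_finite_support[of "perp ls \<pi> V" "{..<length ls}"] by blast
  then show ?thesis
    using finite_distinct_list[of B] by (auto simp: is_basis_of_def)
qed

lemma make_exact_along_exists: "\<exists>B'. make_exact_along V \<pi>s B B'"
proof (induction \<pi>s arbitrary: B)
  case (Cons \<pi> \<pi>s)
  obtain bs where "is_basis_of bs (perp (col_lab B) \<pi> (V \<pi>))" using perp_basis_exists by blast
  then have "make_exact (V \<pi>) B \<pi> (fold (add_row_if_indep \<pi>) bs B)"
    by (auto simp: make_exact_def)
  then show ?case
    using Cons.IH[of "fold (add_row_if_indep \<pi>) bs B"] by (meson make_exact_along.simps(2))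
qed auto

text \<open>A maximal element of any subset may come first, since nothing in the subset lies above
  it; the rest follows by induction over subsets.\<close>

lemma non_increasing_order_exists:
  "\<exists>\<pi>s :: 'p::{finite, order} list. non_increasing_order \<pi>s"
proof -
  have "\<exists>\<pi>s. distinct \<pi>s \<and> set \<pi>s = A \<and> sorted_wrt (\<lambda>\<sigma> \<tau>. \<not> \<sigma> < \<tau>) \<pi>s" for A :: "'p set"
    using finite[of A]
  proof (induction A rule: finite_psubset_induct)
    case (psubset A)
    show ?case
    proof (cases "A = {}")
      case False
      then obtain m where m: "m \<in> A" "\<And>b. b \<in> A \<Longrightarrow> m \<le> b \<Longrightarrow> m = b"
        using finite_has_maximal[of A] by auto
      then obtain \<pi>s where "distinct \<pi>s" "set \<pi>s = A - {m}" "sorted_wrt (\<lambda>\<sigma> \<tau>. \<not> \<sigma> < \<tau>) \<pi>s"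
        using psubset.IH[of "A - {m}"] by blast
      then show ?thesis
        using m by (intro exI[of _ "m # \<pi>s"]) (auto simp: less_le)
    qed (auto intro: exI[of _ "[]"])
  qed
  then show ?thesis by (auto simp: non_increasing_order_def)
qed

lemma step_output_exists:
  fixes ls :: "'p::{finite, order} list"
  shows "\<exists>M. step_output ls V M"
  using non_increasing_order_exists make_exact_along_exists by (fastforce simp: step_output_def)

lemma algorithm_run_exists:
  fixes F :: "('p::{finite, order}, 'v) sheaf"
  shows "\<exists>\<eta>. algorithm_run F \<alpha> ls \<eta>"
proof -
  have "\<exists>\<eta>. \<forall>n. (n = 0 \<longrightarrow> step_output ls (\<lambda>\<pi>. \<alpha> \<pi> ` stalk F \<pi>) (\<eta> n)) \<and>
      step_output (row_lab (\<eta> n)) (im_at (\<eta> n)) (\<eta> (Suc n))"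
    by (rule dependent_nat_choice) (auto intro: step_output_exists)
  then show ?thesis by (auto simp: algorithm_run_def)
qed

text \<open>The last clause says that, for each \<open>\<pi>\<close>, the rows labeled \<open>\<pi>\<close> are linearly independent
  modulo the rows labeled by larger elements.\<close>

definition row_inv ::
  "'p::order list \<Rightarrow> ('p \<Rightarrow> (nat \<Rightarrow> 'k::field) set) \<Rightarrow> ('p, 'k) lmat \<Rightarrow> bool" where
  "row_inv ls V B \<longleftrightarrow> col_lab B = ls \<and>
     (\<forall>j \<ge> length (row_lab B). entry B j = (\<lambda>i. 0)) \<and>
     (\<forall>j < length (row_lab B). entry B j \<in> perp ls (row_lab B ! j) (V (row_lab B ! j))) \<and>
     (\<forall>\<pi> y. (\<Sum>j | j < length (row_lab B) \<and> \<pi> \<le> row_lab B ! j. fscale (y j) (entry B j)) = 0 \<longrightarrow>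
        (\<forall>j < length (row_lab B). row_lab B ! j = \<pi> \<longrightarrow> y j = 0))"

lemma row_invD:
  assumes "row_inv ls V B"
  shows "col_lab B = ls"
    and "j \<ge> length (row_lab B) \<Longrightarrow> entry B j = (\<lambda>i. 0)"
    and "j < length (row_lab B) \<Longrightarrow> entry B j \<in> perp ls (row_lab B ! j) (V (row_lab B ! j))"
    and "(\<Sum>j | j < length (row_lab B) \<and> \<pi> \<le> row_lab B ! j. fscale (y j) (entry B j)) = 0 \<Longrightarrow>
        j < length (row_lab B) \<Longrightarrow> row_lab B ! j = \<pi> \<Longrightarrow> y j = 0"
  using assms by (auto simp: row_inv_def)

lemma row_inv_support:
  assumes "row_inv ls V B" "j < length (row_lab B)" "entry B j i \<noteq> 0"
  shows "i < length ls" "row_lab B ! j \<le> ls ! i"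
  using row_invD(3)[OF assms(1,2)] assms(3) by (auto simp: perp_def inj_sheaf_simps)

text \<open>A row lies in the stalk at its own label, so it is supported on columns labeled at or
  above that label. A row with label in the star of \<open>\<pi>\<close> therefore loses nothing
  when the columns are cut down to the star.\<close>

lemma mat_at_row_inv:
  assumes "row_inv ls V B"
  shows "mat_at B \<pi> j = (if j < length (row_lab B) \<and> \<pi> \<le> row_lab B ! j then entry B j else (\<lambda>i. 0))"
  using row_inv_support[OF assms, of j] row_invD(1)[OF assms]
  by (auto simp: fun_eq_iff mat_at_def submat_def star_def) (meson order_trans)+

lemma rows_at_row_inv:
  assumes "row_inv ls V B"
  shows "rows_at B \<pi> = entry B ` {j. j < length (row_lab B) \<and> \<pi> \<le> row_lab B ! j}"
  by (auto simp: rows_at_def mat_at_row_inv[OF assms] star_def)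

lemma append_row_simps:
  "col_lab (append_row \<pi> b B) = col_lab B"
  "row_lab (append_row \<pi> b B) = row_lab B @ [\<pi>]"
  "entry (append_row \<pi> b B) j = (if j = length (row_lab B) then b else entry B j)"
  by (auto simp: append_row_def)

text \<open>Only the independence clause at \<open>\<pi>\<close> is at stake. Unless
  \<open>\<sigma> \<le> \<pi>\<close>, the new row does not enter the sum; if
  \<open>\<sigma> < \<pi>\<close>, no row is labeled \<open>\<sigma>\<close> because of the
  processing order; at \<open>\<pi>\<close> itself the new coefficient vanishes, as \<open>b\<close>
  is outside the span of the old rows.\<close>

lemma row_inv_append_row:
  fixes B :: "('p::order, 'k::field) lmat"
  assumes B: "row_inv ls V B" and b: "b \<in> perp ls \<pi> (V \<pi>)" "b \<notin> fs.span (rows_at B \<pi>)"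
    and lab: "\<And>\<sigma>. \<sigma> \<in> set (row_lab B) \<Longrightarrow> \<not> \<sigma> < \<pi>"
  shows "row_inv ls V (append_row \<pi> b B)"
proof -
  let ?n = "length (row_lab B)" and ?B' = "append_row \<pi> b B"
  have "y j = 0"
    if sum: "(\<Sum>j | j < length (row_lab ?B') \<and> \<sigma> \<le> row_lab ?B' ! j. fscale (y j) (entry ?B' j)) = 0"
      and j: "j < length (row_lab ?B')" "row_lab ?B' ! j = \<sigma>" for \<sigma> and y :: "nat \<Rightarrow> 'k" and j
  proof (cases "\<sigma> \<le> \<pi>")
    case False
    have "{j. j < length (row_lab ?B') \<and> \<sigma> \<le> row_lab ?B' ! j} = {j. j < ?n \<and> \<sigma> \<le> row_lab B ! j}"
      using False by (auto simp: append_row_simps nth_append less_Suc_eq)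
    moreover have "(\<Sum>j | j < ?n \<and> \<sigma> \<le> row_lab B ! j. fscale (y j) (entry ?B' j)) =
        (\<Sum>j | j < ?n \<and> \<sigma> \<le> row_lab B ! j. fscale (y j) (entry B j))"
      by (rule sum.cong) (auto simp only: append_row_simps mem_Collect_eq split: if_splits)
    ultimately have "(\<Sum>j | j < ?n \<and> \<sigma> \<le> row_lab B ! j. fscale (y j) (entry B j)) = 0"
      using sum by (simp only:)
    moreover have "j < ?n" "row_lab B ! j = \<sigma>"
      using j False by (auto simp: append_row_simps nth_append less_Suc_eq split: if_splits)
    ultimately show ?thesis by (rule row_invD(4)[OF B])
  next
    case True
    have "\<sigma> = \<pi>"
    proof (rule ccontr)
      assume "\<sigma> \<noteq> \<pi>"
      then have "j < ?n" "row_lab B ! j = \<sigma>"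
        using j by (auto simp: append_row_simps nth_append less_Suc_eq split: if_splits)
      then show False using lab[of \<sigma>] True \<open>\<sigma> \<noteq> \<pi>\<close> nth_mem by force
    qed
    let ?S = "{j. j < ?n \<and> \<pi> \<le> row_lab B ! j}"
    have "{j. j < length (row_lab ?B') \<and> \<sigma> \<le> row_lab ?B' ! j} = insert ?n ?S"
      using \<open>\<sigma> = \<pi>\<close> by (auto simp: append_row_simps nth_append less_Suc_eq)
    moreover have "(\<Sum>j\<in>insert ?n ?S. fscale (y j) (entry ?B' j)) =
        fscale (y ?n) b + (\<Sum>j\<in>?S. fscale (y j) (entry ?B' j))"
      by (subst sum.insert) (simp_all only: append_row_simps, auto)
    moreover have "(\<Sum>j\<in>?S. fscale (y j) (entry ?B' j)) = (\<Sum>j\<in>?S. fscale (y j) (entry B j))"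
      by (rule sum.cong) (auto simp only: append_row_simps mem_Collect_eq split: if_splits)
    ultimately have eq: "fscale (y ?n) b + (\<Sum>j\<in>?S. fscale (y j) (entry B j)) = 0"
      using sum by (simp only:)
    have span: "(\<Sum>j\<in>?S. fscale (y j) (entry B j)) \<in> fs.span (rows_at B \<pi>)"
      unfolding rows_at_row_inv[OF B] by (intro fs.span_sum fs.span_scale fs.span_base imageI)
    have yn: "y ?n = 0"
    proof (rule ccontr)
      assume "y ?n \<noteq> 0"
      have "fscale (y ?n) b = - (\<Sum>j\<in>?S. fscale (y j) (entry B j))"
        using eq by (rule eq_neg_iff_add_eq_0[THEN iffD2])
      then have "fscale (y ?n) b \<in> fs.span (rows_at B \<pi>)"
        using fs.span_neg[OF span] by (simp only:)
      then have "fscale (inverse (y ?n)) (fscale (y ?n) b) \<in> fs.span (rows_at B \<pi>)"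
        by (rule fs.span_scale)
      then show False using \<open>y ?n \<noteq> 0\<close> b(2) by (simp only: fs.scale_scale left_inverse[OF \<open>y ?n \<noteq> 0\<close>] fs.scale_one)
    qed
    then have "(\<Sum>j\<in>?S. fscale (y j) (entry B j)) = 0"
      using eq by (simp only: fs.scale_zero_left add_0)
    then have "y j = 0" if "j < ?n" "row_lab B ! j = \<pi>"
      using that by (rule row_invD(4)[OF B])
    then show ?thesis
      using j \<open>\<sigma> = \<pi>\<close> yn by (cases "j < ?n") (auto simp: append_row_simps nth_append less_Suc_eq)
  qed
  then show ?thesis
    unfolding row_inv_def
    using row_invD(1-3)[OF B] b(1)
    by (auto simp: append_row_simps nth_append less_Suc_eq)
qed

lemma rows_at_append_row:
  assumes B: "row_inv ls V B" and B': "row_inv ls V (append_row \<pi> b B)"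
  shows "rows_at B \<tau> \<subseteq> rows_at (append_row \<pi> b B) \<tau>" and "b \<in> rows_at (append_row \<pi> b B) \<pi>"
  unfolding rows_at_row_inv[OF B] rows_at_row_inv[OF B']
  by (force simp: append_row_simps nth_append image_iff)+

text \<open>Skipped vectors already lie in the span, and appended ones become rows. The inclusion of
  \<open>rows_at\<close> is recorded at every \<open>\<tau>\<close>, since the spans reached at
  elements treated earlier must survive later insertions.\<close>

lemma fold_add_row:
  assumes "row_inv ls V B" "set bs \<subseteq> perp ls \<pi> (V \<pi>)"
    and "\<And>\<sigma>. \<sigma> \<in> set (row_lab B) \<Longrightarrow> \<not> \<sigma> < \<pi>"
  defines "B' \<equiv> fold (add_row_if_indep \<pi>) bs B"
  shows "row_inv ls V B' \<and> set (row_lab B') \<subseteq> insert \<pi> (set (row_lab B)) \<and>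
    (\<forall>\<tau>. rows_at B \<tau> \<subseteq> rows_at B' \<tau>) \<and> set bs \<subseteq> fs.span (rows_at B' \<pi>)"
  using assms(1-3) unfolding B'_def
proof (induction bs arbitrary: B)
  case (Cons b bs)
  define B1 where "B1 = add_row_if_indep \<pi> b B"
  have B1: "row_inv ls V B1 \<and> set (row_lab B1) \<subseteq> insert \<pi> (set (row_lab B)) \<and>
    (\<forall>\<tau>. rows_at B \<tau> \<subseteq> rows_at B1 \<tau>) \<and> b \<in> fs.span (rows_at B1 \<pi>)"
  proof (cases "b \<in> fs.span (rows_at B \<pi>)")
    case True
    then show ?thesis using Cons.prems by (auto simp: B1_def add_row_if_indep_def)
  next
    case False
    then have eq: "B1 = append_row \<pi> b B" by (simp add: B1_def add_row_if_indep_def)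
    have inv: "row_inv ls V B1"
      unfolding eq by (rule row_inv_append_row) (use Cons.prems False in auto)
    show ?thesis
      using inv rows_at_append_row[OF Cons.prems(1) inv[unfolded eq]]
      by (auto simp: eq append_row_simps intro: fs.span_base)
  qed
  define B2 where "B2 = fold (add_row_if_indep \<pi>) bs B1"
  have B2: "row_inv ls V B2 \<and> set (row_lab B2) \<subseteq> insert \<pi> (set (row_lab B1)) \<and>
    (\<forall>\<tau>. rows_at B1 \<tau> \<subseteq> rows_at B2 \<tau>) \<and> set bs \<subseteq> fs.span (rows_at B2 \<pi>)"
    unfolding B2_def by (rule Cons.IH) (use B1 Cons.prems in auto)
  have "fold (add_row_if_indep \<pi>) (b # bs) B = B2" by (simp add: B2_def B1_def)
  moreover have "b \<in> fs.span (rows_at B2 \<pi>)"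
    using B1 B2 fs.span_mono[of "rows_at B1 \<pi>" "rows_at B2 \<pi>"] by blast
  ultimately show ?case using B1 B2 by (simp del: fscale_apply) blast
qed auto

text \<open>The last hypothesis carries the processing order through the induction: labels present
  so far are never strictly below an element still to come, which is the condition for appending
  rows.\<close>

lemma make_exact_along_row_inv:
  assumes "make_exact_along V \<pi>s B M" "row_inv ls V B" "sorted_wrt (\<lambda>\<sigma> \<tau>. \<not> \<sigma> < \<tau>) \<pi>s"
    and "\<And>\<sigma> \<pi>. \<sigma> \<in> set (row_lab B) \<Longrightarrow> \<pi> \<in> set \<pi>s \<Longrightarrow> \<not> \<sigma> < \<pi>"
  shows "row_inv ls V M \<and> (\<forall>\<tau>. rows_at B \<tau> \<subseteq> rows_at M \<tau>) \<and>
    (\<forall>\<pi>\<in>set \<pi>s. perp ls \<pi> (V \<pi>) \<subseteq> fs.span (rows_at M \<pi>))"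
  using assms
proof (induction \<pi>s arbitrary: B)
  case (Cons \<pi> \<pi>s)
  obtain bs B' where bs: "is_basis_of bs (perp (col_lab B) \<pi> (V \<pi>))"
    and eq: "B' = fold (add_row_if_indep \<pi>) bs B" and M: "make_exact_along V \<pi>s B' M"
    using Cons.prems(1) by (auto simp: make_exact_def)
  have bs: "fs.span (set bs) = perp ls \<pi> (V \<pi>)"
    using bs row_invD(1)[OF Cons.prems(2)] by (simp add: is_basis_of_def)
  have B': "row_inv ls V B' \<and> set (row_lab B') \<subseteq> insert \<pi> (set (row_lab B)) \<and>
    (\<forall>\<tau>. rows_at B \<tau> \<subseteq> rows_at B' \<tau>) \<and> set bs \<subseteq> fs.span (rows_at B' \<pi>)"
    unfolding eq
    by (rule fold_add_row) (use Cons.prems bs fs.span_superset[of "set bs"] in auto)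
  have IH: "row_inv ls V M \<and> (\<forall>\<tau>. rows_at B' \<tau> \<subseteq> rows_at M \<tau>) \<and>
    (\<forall>\<pi>\<in>set \<pi>s. perp ls \<pi> (V \<pi>) \<subseteq> fs.span (rows_at M \<pi>))"
  proof (rule Cons.IH[OF M])
    show "\<not> \<sigma> < \<rho>" if "\<sigma> \<in> set (row_lab B')" "\<rho> \<in> set \<pi>s" for \<sigma> \<rho>
      using that B' Cons.prems(3,4) by auto
  qed (use B' Cons.prems in auto)
  have "perp ls \<pi> (V \<pi>) \<subseteq> fs.span (rows_at B' \<pi>)"
    using B' fs.span_minimal[OF _ fs.subspace_span] unfolding bs[symmetric] by blast
  also have "\<dots> \<subseteq> fs.span (rows_at M \<pi>)"
    using IH by (intro fs.span_mono) blast
  finally have \<pi>: "perp ls \<pi> (V \<pi>) \<subseteq> fs.span (rows_at M \<pi>)" .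
  show ?case
  proof (intro conjI allI ballI)
    show "row_inv ls V M" using IH by blast
    show "rows_at B \<tau> \<subseteq> rows_at M \<tau>" for \<tau> using IH B' by blast
    show "perp ls \<rho> (V \<rho>) \<subseteq> fs.span (rows_at M \<rho>)" if "\<rho> \<in> set (\<pi> # \<pi>s)" for \<rho>
      using that \<pi> IH by (cases "\<rho> = \<pi>") simp_all
  qed
qed simp

lemma step_output_row_inv:
  assumes "step_output ls V M"
  shows "row_inv ls V M" and "perp ls \<pi> (V \<pi>) \<subseteq> fs.span (rows_at M \<pi>)"
proof -
  obtain \<pi>s where \<pi>s: "non_increasing_order \<pi>s" "make_exact_along V \<pi>s (no_rows ls) M"
    using assms by (auto simp: step_output_def)
  have "row_inv ls V (no_rows ls)" by (simp add: row_inv_def no_rows_def)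
  then have "row_inv ls V M \<and> (\<forall>\<pi>\<in>set \<pi>s. perp ls \<pi> (V \<pi>) \<subseteq> fs.span (rows_at M \<pi>))"
    using make_exact_along_row_inv[OF \<pi>s(2)] \<pi>s(1)
    by (simp add: non_increasing_order_def no_rows_def)
  then show "row_inv ls V M" "perp ls \<pi> (V \<pi>) \<subseteq> fs.span (rows_at M \<pi>)"
    using \<pi>s(1) by (auto simp: non_increasing_order_def)
qed

section \<open>Kernel and image of the matrix produced by a step\<close>

definition subsheaf_of :: "'p::order list \<Rightarrow> ('p \<Rightarrow> (nat \<Rightarrow> 'k::field) set) \<Rightarrow> bool" where
  "subsheaf_of ls V \<longleftrightarrow>
     (\<forall>\<pi>. fs.subspace (V \<pi>) \<and> V \<pi> \<subseteq> stalk (inj_sheaf ls) \<pi>) \<and>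
     (\<forall>\<sigma> \<tau>. \<sigma> \<le> \<tau> \<longrightarrow> (\<forall>v\<in>V \<sigma>. res (inj_sheaf ls) \<sigma> \<tau> v \<in> V \<tau>))"

lemma subsheaf_of_image:
  assumes "is_sheaf s F" "nat_trans s F fscale (inj_sheaf ls) \<phi>"
  shows "subsheaf_of ls (\<lambda>\<pi>. \<phi> \<pi> ` stalk F \<pi>)"
  unfolding subsheaf_of_def
proof (intro conjI allI impI ballI)
  note D = nat_transD[OF assms(2)] and F = stalk_closed[OF assms(1)]
  show "fs.subspace (\<phi> \<pi> ` stalk F \<pi>)" for \<pi>
  proof (rule fs.subspaceI)
    show "0 \<in> \<phi> \<pi> ` stalk F \<pi>"
      using nat_trans_0_diff(1)[OF assms(1) is_sheaf_inj_sheaf assms(2)] F(1)[of \<pi>] by force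
    show "x + y \<in> \<phi> \<pi> ` stalk F \<pi>" if "x \<in> \<phi> \<pi> ` stalk F \<pi>" "y \<in> \<phi> \<pi> ` stalk F \<pi>" for x y
      using that F(2)[of _ \<pi>] by (auto simp flip: D(3))
    show "fscale c x \<in> \<phi> \<pi> ` stalk F \<pi>" if "x \<in> \<phi> \<pi> ` stalk F \<pi>" for c x
      using that F(4)[of _ \<pi>] by (auto simp flip: D(4) simp del: fscale_apply)
  qed
  show "\<phi> \<pi> ` stalk F \<pi> \<subseteq> stalk (inj_sheaf ls) \<pi>" for \<pi> using D(2) by blast
  show "res (inj_sheaf ls) \<sigma> \<tau> v \<in> \<phi> \<tau> ` stalk F \<tau>" if "\<sigma> \<le> \<tau>" "v \<in> \<phi> \<sigma> ` stalk F \<sigma>" for \<sigma> \<tau> v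
    using that res_in_stalk[OF assms(1) that(1)] D(5)[OF that(1), symmetric] by auto
qed

lemma labeled_matrix_row_inv: "row_inv ls V M \<Longrightarrow> labeled_matrix M"
  unfolding labeled_matrix_def
  using row_inv_support[of ls V M] row_invD(1,2)[of ls V M] by (metis linorder_not_less)

lemma mat_trans_row_inv:
  assumes "row_inv ls V M"
  shows "mat_trans M \<pi> v j =
    (if j < length (row_lab M) \<and> \<pi> \<le> row_lab M ! j then \<Sum>i<length ls. entry M j i * v i else 0)"
  by (simp add: mat_trans_def mat_at_row_inv[OF assms] row_invD(1)[OF assms] dot_def)

lemma nat_trans_mat_trans:
  assumes M: "row_inv ls V M"
  shows "nat_trans fscale (inj_sheaf ls) fscale (inj_sheaf (row_lab M)) (mat_trans M)"
proof (rule nat_transI)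
  fix \<pi> and x y :: "nat \<Rightarrow> 'b"
  show "mat_trans M \<pi> x \<in> stalk (inj_sheaf (row_lab M)) \<pi>"
    by (simp add: inj_sheaf_simps mat_trans_row_inv[OF M])
  show "mat_trans M \<pi> (x + y) = mat_trans M \<pi> x + mat_trans M \<pi> y"
    by (rule ext) (simp add: mat_trans_row_inv[OF M] distrib_left sum.distrib)
  show "mat_trans M \<pi> (fscale c x) = fscale c (mat_trans M \<pi> x)" for c
    by (rule ext) (simp add: mat_trans_row_inv[OF M] sum_distrib_left mult.left_commute)
next
  fix \<sigma> \<tau> :: 'a and x
  assume le: "\<sigma> \<le> \<tau>"
  have "(\<Sum>i<length ls. entry M j i * res (inj_sheaf ls) \<sigma> \<tau> x i) = (\<Sum>i<length ls. entry M j i * x i)"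
    if "j < length (row_lab M)" "\<tau> \<le> row_lab M ! j" for j
    by (rule sum.cong)
      (use row_inv_support[OF M that(1)] that(2) in \<open>auto simp: inj_sheaf_simps intro: order_trans\<close>)
  then show "mat_trans M \<tau> (res (inj_sheaf ls) \<sigma> \<tau> x) =
      res (inj_sheaf (row_lab M)) \<sigma> \<tau> (mat_trans M \<sigma> x)"
    using le by (intro ext) (auto simp: mat_trans_row_inv[OF M] inj_sheaf_simps dest: order_trans)
qed

text \<open>All vectors of the stalk are supported on the positions in \<open>?S\<close>, so the
  separating vector can be taken in the stalk and is then an element of the annihilator.\<close>

lemma subsheaf_separation:
  assumes V: "subsheaf_of ls V" and v: "v \<in> stalk (inj_sheaf ls) \<pi>" "v \<notin> V \<pi>"
  obtains w where "w \<in> perp ls \<pi> (V \<pi>)" "dot (length ls) w v \<noteq> 0"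
proof -
  let ?S = "{i. i < length ls \<and> \<pi> \<le> ls ! i}"
  obtain w where w: "\<And>i. i \<notin> ?S \<Longrightarrow> w i = 0"
    "\<And>u. u \<in> V \<pi> \<Longrightarrow> (\<Sum>i\<in>?S. w i * u i) = 0" "(\<Sum>i\<in>?S. w i * v i) \<noteq> 0"
  proof (rule coordinate_separation[of "V \<pi>" v ?S])
    show "u i = 0" if "u \<in> insert v (V \<pi>)" "i \<notin> ?S" for u i
    proof -
      have "u \<in> stalk (inj_sheaf ls) \<pi>" using that(1) v(1) V by (auto simp: subsheaf_of_def)
      then show ?thesis using that(2) by (auto simp: inj_sheaf_simps)
    qed
  qed (use V v in \<open>auto simp: subsheaf_of_def\<close>)
  have dot: "dot (length ls) w u = (\<Sum>i\<in>?S. w i * u i)" for u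
    unfolding dot_def by (rule sum.mono_neutral_right) (use w(1) in auto)
  show thesis
    by (rule that[of w]) (use w in \<open>auto simp: perp_def dot inj_sheaf_simps\<close>)
qed

text \<open>If \<open>v\<close> is in \<open>V \<pi>\<close>, a row with label \<open>\<tau>\<close>
  above \<open>\<pi>\<close> kills it: the row sees only the restriction of \<open>v\<close> to
  \<open>\<tau>\<close>, which is in \<open>V \<tau>\<close> because \<open>V\<close> is closed
  under restriction. Conversely, a vector outside \<open>V \<pi>\<close> is detected by an element
  of the annihilator, and this element lies in the span of the rows.\<close>

lemma step_output_kernel:
  assumes M: "step_output ls V M" and V: "subsheaf_of ls V" and v: "v \<in> stalk (inj_sheaf ls) \<pi>"
  shows "mat_trans M \<pi> v = 0 \<longleftrightarrow> v \<in> V \<pi>"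
proof
  note inv = step_output_row_inv(1)[OF M]
  assume v': "v \<in> V \<pi>"
  show "mat_trans M \<pi> v = 0"
  proof
    fix j
    show "mat_trans M \<pi> v j = 0 j"
    proof (cases "j < length (row_lab M) \<and> \<pi> \<le> row_lab M ! j")
      case True
      then have res: "res (inj_sheaf ls) \<pi> (row_lab M ! j) v \<in> V (row_lab M ! j)"
        using V v' by (simp add: subsheaf_of_def)
      have "(\<Sum>i<length ls. entry M j i * v i) =
          dot (length ls) (entry M j) (res (inj_sheaf ls) \<pi> (row_lab M ! j) v)"
        unfolding dot_def using row_inv_support[OF inv, of j] True
        by (intro sum.cong) (auto simp: inj_sheaf_simps)
      also have "\<dots> = 0" using row_invD(3)[OF inv] True res by (simp add: perp_def)
      finally show ?thesis by (simp add: mat_trans_row_inv[OF inv])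
    qed (auto simp: mat_trans_row_inv[OF inv])
  qed
next
  note inv = step_output_row_inv(1)[OF M]
  assume 0: "mat_trans M \<pi> v = 0"
  show "v \<in> V \<pi>"
  proof (rule ccontr)
    assume "v \<notin> V \<pi>"
    then obtain w where w: "w \<in> perp ls \<pi> (V \<pi>)" "dot (length ls) w v \<noteq> 0"
      using subsheaf_separation[OF V v] by blast
    have "w \<in> fs.span (rows_at M \<pi>)" using w(1) step_output_row_inv(2)[OF M] by blast
    then have "dot (length ls) w v = 0"
    proof (induction rule: fs.span_induct_alt)
      case base
      show ?case by (simp add: dot_def)
    next
      case (step c x y)
      obtain j where "x = entry M j" "j < length (row_lab M)" "\<pi> \<le> row_lab M ! j"
        using step(1) by (auto simp: rows_at_row_inv[OF inv])
      then have "dot (length ls) x v = mat_trans M \<pi> v j"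
        by (simp add: mat_trans_row_inv[OF inv] dot_def)
      then have "dot (length ls) x v = 0" using 0 by simp
      moreover have "dot (length ls) (fscale c x + y) v = c * dot (length ls) x v + dot (length ls) y v"
        by (simp add: dot_def distrib_right sum.distrib sum_distrib_left mult.assoc)
      ultimately show ?case using step(2) by (simp only: mult_zero_right add_0)
    qed
    then show False using w(2) by simp
  qed
qed

lemma im_at_row_inv:
  assumes "row_inv ls V M"
  shows "im_at M = (\<lambda>\<pi>. mat_trans M \<pi> ` stalk (inj_sheaf ls) \<pi>)"
  by (simp add: fun_eq_iff im_at_def row_invD(1)[OF assms])

lemma subsheaf_of_im_at: "row_inv ls V M \<Longrightarrow> subsheaf_of (row_lab M) (im_at M)"
  unfolding im_at_row_inv by (rule subsheaf_of_image[OF is_sheaf_inj_sheaf nat_trans_mat_trans])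

text \<open>A socle element outside the image would be detected by a vector \<open>w\<close>
  annihilating the image. Such a \<open>w\<close> is a linear relation between the rows with labels
  at or above \<open>\<pi>\<close>, so by independence its coefficients at rows labeled
  \<open>\<pi>\<close> vanish; yet the socle element is supported on just those positions.\<close>

lemma socle_subset_im_at:
  assumes inv: "row_inv ls V M"
  shows "socle (inj_sheaf (row_lab M)) \<pi> \<subseteq> im_at M \<pi>"
proof (rule subsetI, rule ccontr)
  let ?n = "length (row_lab M)"
  let ?S = "{j. j < ?n \<and> \<pi> \<le> row_lab M ! j}"
  fix x assume x: "x \<in> socle (inj_sheaf (row_lab M)) \<pi>" "x \<notin> im_at M \<pi>"
  then obtain w where w: "w \<in> perp (row_lab M) \<pi> (im_at M \<pi>)" "dot ?n w x \<noteq> 0"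
    using subsheaf_separation[OF subsheaf_of_im_at[OF inv]] socle_subset by blast
  have dot: "dot ?n w u = (\<Sum>j\<in>?S. w j * u j)" for u
    unfolding dot_def
    by (rule sum.mono_neutral_right) (use w(1) in \<open>auto simp: perp_def inj_sheaf_simps\<close>)
  \<comment> \<open>In a column labeled at or above \<open>\<pi>\<close>, test \<open>w\<close> on
    the image of the unit vector; in any other column all rows of \<open>?S\<close> vanish.\<close>
  have "(\<Sum>j\<in>?S. w j * entry M j i) = 0" for i
  proof (cases "i < length ls \<and> \<pi> \<le> ls ! i")
    case True
    have "(\<Sum>j\<in>?S. w j * entry M j i) = dot ?n w (mat_trans M \<pi> (unit_vec i))"
      unfolding dot
    proof (rule sum.cong)
      fix j assume "j \<in> ?S"
      moreover have "(\<Sum>i'<length ls. entry M j i' * unit_vec i i') =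
          (\<Sum>i'<length ls. if i' = i then entry M j i else 0)"
        by (rule sum.cong) (auto simp: unit_vec_def)
      ultimately show "w j * entry M j i = w j * mat_trans M \<pi> (unit_vec i) j"
        using True by (simp add: mat_trans_row_inv[OF inv])
    qed simp
    also have "\<dots> = 0"
    proof -
      have "unit_vec i \<in> stalk (inj_sheaf ls) \<pi>"
        using True by (auto simp: inj_sheaf_simps unit_vec_def split: if_splits)
      then show ?thesis using w(1) by (auto simp: perp_def im_at_row_inv[OF inv])
    qed
    finally show ?thesis .
  next
    case False
    have "entry M j i = 0" if "j \<in> ?S" for j
      using row_inv_support[OF inv, of j i] that False order_trans by blast
    then show ?thesis by (intro sum.neutral) simp
  qed
  then have "(\<Sum>j\<in>?S. fscale (w j) (entry M j)) = 0"
    by (simp add: fun_eq_iff)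
  from row_invD(4)[OF inv this]
  have "w j * x j = 0" for j using x(1) by (auto simp: socle_inj_sheaf)
  then have "dot ?n w x = 0" unfolding dot_def by (intro sum.neutral) blast
  then show False using w(2) by simp
qed

text \<open>A row labeled \<open>\<pi>\<close> is nonzero by independence and supported on columns
  labeled at or above \<open>\<pi>\<close>. On a column labeled exactly \<open>\<pi>\<close> it
  vanishes, because the unit vector there is in the socle, hence in \<open>V \<pi>\<close>, which
  the row annihilates.\<close>

lemma row_label_less:
  assumes M: "step_output ls V M" and ess: "\<And>\<pi>. socle (inj_sheaf ls) \<pi> \<subseteq> V \<pi>"
    and \<pi>: "\<pi> \<in> set (row_lab M)"
  shows "\<exists>\<tau>\<in>set ls. \<pi> < \<tau>"
proof -
  note inv = step_output_row_inv(1)[OF M]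
  obtain j where j: "j < length (row_lab M)" "row_lab M ! j = \<pi>"
    using \<pi> by (auto simp: in_set_conv_nth)
  have "\<exists>i. entry M j i \<noteq> 0"
  proof (rule ccontr)
    assume "\<nexists>i. entry M j i \<noteq> 0"
    \<comment> \<open>A zero row would give a relation with coefficient 1 at
      \<open>j\<close>.\<close>
    then have "(\<Sum>j' | j' < length (row_lab M) \<and> \<pi> \<le> row_lab M ! j'. fscale (unit_vec j j') (entry M j')) = 0"
      by (auto simp: fun_eq_iff unit_vec_def intro!: sum.neutral)
    from row_invD(4)[OF inv this j] show False by (simp add: unit_vec_def)
  qed
  then obtain i where i: "entry M j i \<noteq> 0" by blast
  have le: "i < length ls" "\<pi> \<le> ls ! i" using row_inv_support[OF inv j(1) i] j by auto
  have "\<pi> \<noteq> ls ! i"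
  proof
    assume eq: "\<pi> = ls ! i"
    have "unit_vec i \<in> V \<pi>"
      using ess[of \<pi>] le(1) eq by (auto simp: socle_inj_sheaf unit_vec_def subset_iff)
    then have "dot (length ls) (entry M j) (unit_vec i) = 0"
      using row_invD(3)[OF inv j(1)] j by (auto simp: perp_def)
    moreover have "dot (length ls) (entry M j) (unit_vec i) =
        (\<Sum>i'<length ls. if i' = i then entry M j i else 0)"
      unfolding dot_def by (rule sum.cong) (auto simp: unit_vec_def)
    ultimately show False using i le by simp
  qed
  then show ?thesis using le by (intro bexI[of _ "ls ! i"]) (auto simp: less_le)
qed

section \<open>The resolution produced by the algorithm\<close>

text \<open>Treating the image of \<open>\<alpha>\<close> like the image of a matrix in degree -1
  makes the first application of the step no special case.\<close>

definition run_image ::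
  "('p::order, 'v) sheaf \<Rightarrow> ('p \<Rightarrow> 'v \<Rightarrow> nat \<Rightarrow> 'k::field) \<Rightarrow> (nat \<Rightarrow> ('p, 'k) lmat) \<Rightarrow>
   nat \<Rightarrow> 'p \<Rightarrow> (nat \<Rightarrow> 'k) set" where
  "run_image F \<alpha> \<eta> n = (case n of 0 \<Rightarrow> (\<lambda>\<pi>. \<alpha> \<pi> ` stalk F \<pi>) | Suc m \<Rightarrow> im_at (\<eta> m))"

lemma label_list_simps:
  "d < 0 \<Longrightarrow> label_list ls \<eta> d = []"
  "label_list ls \<eta> 0 = ls"
  "label_list ls \<eta> (int n + 1) = row_lab (\<eta> n)"
  "label_list ls \<eta> (int (Suc n)) = row_lab (\<eta> n)"
  by (auto simp: label_list_def nat_add_distrib)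

lemma output_complex_simps:
  "obj (output_complex ls \<eta>) d = inj_sheaf (label_list ls \<eta> d)"
  "d < 0 \<Longrightarrow> diff (output_complex ls \<eta>) d = (\<lambda>\<pi> v. 0)"
  "diff (output_complex ls \<eta>) (int n) = mat_trans (\<eta> n)"
  by (auto simp: output_complex_def)

lemma stalk_inj_sheaf_Nil: "stalk (inj_sheaf []) \<pi> = {0}"
  by (auto simp: inj_sheaf_simps fun_eq_iff)

lemma algorithm_run_step:
  assumes "algorithm_run F \<alpha> ls \<eta>"
  shows "step_output (label_list ls \<eta> (int n)) (run_image F \<alpha> \<eta> n) (\<eta> n)"
  using assms
  by (cases n) (simp_all add: algorithm_run_def run_image_def label_list_simps del: of_nat_Suc)

lemma algorithm_run_row_inv:
  assumes "algorithm_run F \<alpha> ls \<eta>"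
  shows "row_inv (label_list ls \<eta> (int n)) (run_image F \<alpha> \<eta> n) (\<eta> n)"
  by (rule step_output_row_inv(1)[OF algorithm_run_step[OF assms]])

context
  fixes s :: "'k::field \<Rightarrow> 'v::ab_group_add \<Rightarrow> 'v" and F :: "('p::order, 'v) sheaf"
    and \<alpha> :: "'p \<Rightarrow> 'v \<Rightarrow> nat \<Rightarrow> 'k" and ls :: "'p list" and \<eta> :: "nat \<Rightarrow> ('p, 'k) lmat"
  assumes F: "is_sheaf s F" and \<alpha>: "nat_trans s F fscale (inj_sheaf ls) \<alpha>"
    and run: "algorithm_run F \<alpha> ls \<eta>"
begin

lemma subsheaf_of_run_image: "subsheaf_of (label_list ls \<eta> (int n)) (run_image F \<alpha> \<eta> n)"
proof (cases n)
  case 0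
  then show ?thesis
    using subsheaf_of_image[OF F \<alpha>] by (simp add: run_image_def label_list_simps)
next
  case (Suc m)
  then show ?thesis
    using subsheaf_of_im_at[OF algorithm_run_row_inv[OF run, of m]]
    by (simp add: run_image_def label_list_simps del: of_nat_Suc)
qed

text \<open>The kernel computation for a single step applies in each degree. In positive degrees the
  coboundaries are the same subspaces by construction, so the complex property and exactness both
  follow.\<close>

lemma cocycles_output_complex: "cocycles (output_complex ls \<eta>) (int n) \<pi> = run_image F \<alpha> \<eta> n \<pi>"
proof -
  have "mat_trans (\<eta> n) \<pi> v = 0 \<longleftrightarrow> v \<in> run_image F \<alpha> \<eta> n \<pi>"
    if "v \<in> stalk (inj_sheaf (label_list ls \<eta> (int n))) \<pi>" for v
    by (rule step_output_kernel[OF algorithm_run_step[OF run] subsheaf_of_run_image that])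
  then show ?thesis
    using subsheaf_of_run_image[of n] by (auto simp: cocycles_def output_complex_simps subsheaf_of_def)
qed

lemma coboundaries_output_complex:
  "coboundaries (output_complex ls \<eta>) (int (Suc n)) \<pi> = run_image F \<alpha> \<eta> (Suc n) \<pi>"
proof -
  have "int (Suc n) - 1 = int n" by simp
  then show ?thesis
    by (simp only: coboundaries_def output_complex_simps run_image_def nat.case
        im_at_row_inv[OF algorithm_run_row_inv[OF run]])
qed

lemma is_complex_output_complex: "is_complex (output_complex ls \<eta>)"
  unfolding is_complex_def
proof (intro conjI allI ballI)
  let ?C = "output_complex ls \<eta>"
  show "is_sheaf fscale (obj ?C d)" for d
    by (simp add: output_complex_simps is_sheaf_inj_sheaf)
  show "nat_trans fscale (obj ?C d) fscale (obj ?C (d + 1)) (diff ?C d)" for d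
  proof (cases "d < 0")
    case True
    then show ?thesis
      by (simp only: output_complex_simps nat_trans_zero[OF is_sheaf_inj_sheaf is_sheaf_inj_sheaf])
  next
    case False
    then obtain n where "d = int n" by (metis nonneg_int_cases not_less)
    then show ?thesis
      using nat_trans_mat_trans[OF algorithm_run_row_inv[OF run, of n]]
      by (simp only: output_complex_simps label_list_simps)
  qed
  show "diff ?C (d + 1) \<pi> (diff ?C d \<pi> x) = 0" if x: "x \<in> stalk (obj ?C d) \<pi>" for d \<pi> x
  proof (cases "d < 0")
    case True
    \<comment> \<open>For \<open>d = -1\<close> the outer differential is that of
      \<open>\<eta> 0\<close>, applied to zero.\<close>
    have "mat_trans (\<eta> 0) \<pi> 0 = 0"
      by (rule ext) (simp add: mat_trans_row_inv[OF algorithm_run_row_inv[OF run, of 0]])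
    then show ?thesis
      using True output_complex_simps(3)[of ls \<eta> 0]
      by (cases "d + 1 = 0") (simp_all add: output_complex_simps(2))
  next
    case False
    then obtain n where d: "d = int n" by (metis nonneg_int_cases not_less)
    have "diff ?C d \<pi> x \<in> coboundaries ?C (int (Suc n)) \<pi>"
      using x by (simp add: coboundaries_def d)
    then have "diff ?C d \<pi> x \<in> cocycles ?C (int (Suc n)) \<pi>"
      unfolding coboundaries_output_complex cocycles_output_complex .
    then show ?thesis by (simp add: cocycles_def d add.commute)
  qed
qed

lemma injective_resolution_output_complex:
  assumes "\<And>\<pi>. inj_on (\<alpha> \<pi>) (stalk F \<pi>)"
  shows "injective_resolution s F \<alpha> (output_complex ls \<eta>)"
  unfolding injective_resolution_def
proof (intro conjI allI impI is_complex_output_complex assms)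
  let ?C = "output_complex ls \<eta>"
  show "stalk (obj ?C d) \<pi> = {0}" if "d < 0" for d \<pi>
    using that by (simp add: output_complex_simps label_list_simps stalk_inj_sheaf_Nil)
  show "injective_sheaf (obj ?C d)" for d
    by (simp add: output_complex_simps injective_inj_sheaf)
  show "nat_trans s F fscale (obj ?C 0) \<alpha>"
    using \<alpha> by (simp add: output_complex_simps label_list_simps)
  show "\<alpha> \<pi> ` stalk F \<pi> = cocycles ?C 0 \<pi>" for \<pi>
    using cocycles_output_complex[of 0 \<pi>] by (simp add: run_image_def)
  show "coboundaries ?C d \<pi> = cocycles ?C d \<pi>" if d: "0 < d" for d \<pi>
  proof -
    obtain n where "d = int (Suc n)" using d by (metis zero_less_imp_eq_int gr0_implies_Suc)
    then show ?thesis
      by (simp only: coboundaries_output_complex cocycles_output_complex)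
  qed
qed

context
  assumes essential: "\<And>\<pi>. socle (inj_sheaf ls) \<pi> \<subseteq> \<alpha> \<pi> ` stalk F \<pi>"
begin

text \<open>Essentiality is assumed for \<open>\<alpha>\<close> alone; in positive degrees the
  independence of the rows provides it.\<close>

lemma socle_subset_run_image:
  "socle (inj_sheaf (label_list ls \<eta> (int n))) \<pi> \<subseteq> run_image F \<alpha> \<eta> n \<pi>"
proof (cases n)
  case 0
  then show ?thesis using essential by (simp add: run_image_def label_list_simps)
next
  case (Suc m)
  then show ?thesis
    using socle_subset_im_at[OF algorithm_run_row_inv[OF run, of m]]
    by (simp add: run_image_def label_list_simps del: of_nat_Suc)
qed

lemma minimal_injective_resolution_output_complex:
  assumes "\<And>\<pi>. inj_on (\<alpha> \<pi>) (stalk F \<pi>)"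
  shows "minimal_injective_resolution s F \<alpha> (output_complex ls \<eta>)"
  unfolding minimal_injective_resolution_def
proof (intro conjI injective_resolution_output_complex assms)
  let ?C = "output_complex ls \<eta>"
  show "minimal_complex ?C"
  proof (rule minimal_complexI[OF is_complex_output_complex])
    show "injective_sheaf (obj ?C d)" for d
      by (simp add: output_complex_simps injective_inj_sheaf)
    show "stalk (obj ?C d) \<pi> = {0}" if "d < 0" for d \<pi>
      using that by (simp add: output_complex_simps label_list_simps stalk_inj_sheaf_Nil)
    show "diff ?C d \<pi> x = 0" if x: "x \<in> socle (obj ?C d) \<pi>" for d \<pi> x
    proof (cases "d < 0")
      case False
      then obtain n where d: "d = int n" by (metis nonneg_int_cases not_less)
      have "x \<in> cocycles ?C d \<pi>"
        using x socle_subset_run_image unfolding d cocycles_output_complex output_complex_simps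
        by blast
      then show ?thesis by (simp add: cocycles_def)
    qed (simp add: output_complex_simps)
  qed
qed

text \<open>A label in degree \<open>n + 1\<close> lies strictly below some label in degree
  \<open>n\<close>, and its star is strictly larger. Counting the star thus bounds the length of
  descending chains of labels.\<close>

lemma label_list_height:
  assumes "finite (UNIV :: 'p set)" "\<pi> \<in> set (label_list ls \<eta> (int n))"
  shows "n < card (star \<pi>)"
  using assms(2)
proof (induction n arbitrary: \<pi>)
  case 0
  have "\<pi> \<in> star \<pi>" by (simp add: star_def)
  then show ?case using assms(1) by (auto simp: card_gt_0_iff intro: finite_subset)
next
  case (Suc n)
  have "\<pi> \<in> set (row_lab (\<eta> n))" using Suc.prems by (simp only: label_list_simps)
  from row_label_less[OF algorithm_run_step[OF run] socle_subset_run_image this]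
  obtain \<tau> where \<tau>: "\<tau> \<in> set (label_list ls \<eta> (int n))" "\<pi> < \<tau>" by blast
  have "n < card (star \<tau>)" by (rule Suc.IH[OF \<tau>(1)])
  moreover have "card (star \<tau>) < card (star \<pi>)"
  proof (rule psubset_card_mono)
    show "finite (star \<pi>)" using assms(1) by (rule finite_subset[rotated]) simp
    show "star \<tau> \<subset> star \<pi>"
    proof (rule psubsetI)
      show "star \<tau> \<subseteq> star \<pi>" using \<tau>(2) by (auto simp: star_def)
      have "\<pi> \<in> star \<pi>" "\<pi> \<notin> star \<tau>" using \<tau>(2) by (auto simp: star_def)
      then show "star \<tau> \<noteq> star \<pi>" by blast
    qed
  qed
  ultimately show ?case by simp
qed

text \<open>Boundedness makes the output eligible as a competitor in the definition of
  minimality.\<close>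

lemma bounded_complex_output_complex:
  assumes "finite (UNIV :: 'p set)"
  shows "bounded_complex (output_complex ls \<eta>)"
  unfolding bounded_complex_def
proof (intro conjI is_complex_output_complex exI allI impI)
  fix d \<pi> assume d: "int (card (UNIV :: 'p set)) < \<bar>d\<bar>"
  have "label_list ls \<eta> d = []"
  proof (cases "d < 0")
    case False
    then obtain n where n: "d = int n" by (metis nonneg_int_cases not_less)
    have "\<tau> \<notin> set (label_list ls \<eta> d)" for \<tau>
      using label_list_height[OF assms, of \<tau> n] card_mono[OF assms subset_UNIV, of "star \<tau>"] d
      by (auto simp: n)
    then show ?thesis by (metis ex_in_conv set_empty)
  qed (simp add: label_list_simps)
  then show "stalk (obj (output_complex ls \<eta>) d) \<pi> = {0}"
    by (simp add: output_complex_simps stalk_inj_sheaf_Nil)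
qed

end

end

section \<open>Minimal injective hulls\<close>

lemma is_sheaf_subsheaf_of:
  assumes V: "subsheaf_of ls V"
  shows "is_sheaf fscale \<lparr>stalk = V, res = res (inj_sheaf ls)\<rparr>"
  unfolding is_sheaf_def
proof (intro conjI allI impI ballI vector_space_fscale; simp only: sheaf.simps)
  note I = is_sheaf_inj_sheaf[of ls]
  have stalk: "v \<in> V \<pi> \<Longrightarrow> v \<in> stalk (inj_sheaf ls) \<pi>" for v \<pi>
    using V by (auto simp: subsheaf_of_def)
  show "fin_dim_subspace fscale (V \<pi>)" for \<pi>
  proof -
    have "\<exists>B. finite B \<and> fs.independent B \<and> fs.span B = V \<pi>"
      by (rule subspace_finite_support[of _ "{..<length ls}"])
        (use V stalk in \<open>auto simp: subsheaf_of_def inj_sheaf_simps\<close>)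
    then show ?thesis unfolding fin_dim_subspace_def by blast
  qed
  show "linear_between fscale (V \<sigma>) fscale (V \<tau>) (res (inj_sheaf ls) \<sigma> \<tau>)" if "\<sigma> \<le> \<tau>" for \<sigma> \<tau>
    unfolding linear_between_def
  proof (intro conjI ballI allI)
    show "res (inj_sheaf ls) \<sigma> \<tau> x \<in> V \<tau>" if "x \<in> V \<sigma>" for x
      using V \<open>\<sigma> \<le> \<tau>\<close> that by (simp add: subsheaf_of_def)
  qed (intro linear_betweenD(2,3)[OF is_sheafD(3)[OF I that]] stalk; assumption)+
  show "res (inj_sheaf ls) \<pi> \<pi> x = x" if "x \<in> V \<pi>" for \<pi> x
    using is_sheafD(4)[OF I] stalk that by blast
  show "res (inj_sheaf ls) \<sigma> \<tau> (res (inj_sheaf ls) \<rho> \<sigma> x) = res (inj_sheaf ls) \<rho> \<tau> x"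
    if "\<rho> \<le> \<sigma>" "\<sigma> \<le> \<tau>" "x \<in> V \<rho>" for \<rho> \<sigma> \<tau> x
    using is_sheafD(5)[OF I] stalk that by blast
qed

definition concentrated :: "('p, nat \<Rightarrow> 'k::field) sheaf \<Rightarrow> ('p, nat \<Rightarrow> 'k) cochain" where
  "concentrated G = \<lparr> obj = (\<lambda>d. if d = 0 then G else \<lparr>stalk = (\<lambda>\<pi>. {0}), res = (\<lambda>\<sigma> \<tau> x. 0)\<rparr>),
     diff = (\<lambda>d \<pi> x. 0) \<rparr>"

lemma is_complex_concentrated:
  fixes G :: "('p::order, nat \<Rightarrow> 'k::field) sheaf"
  assumes "is_sheaf fscale G"
  shows "is_complex (concentrated G)"
proof -
  have "fin_dim_subspace fscale {0 :: nat \<Rightarrow> 'k}"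
    unfolding fin_dim_subspace_def by (rule exI[of _ "{}"]) simp
  then have "is_sheaf fscale \<lparr>stalk = (\<lambda>\<pi> :: 'p. {0 :: nat \<Rightarrow> 'k}), res = (\<lambda>\<sigma> \<tau> x. 0)\<rparr>"
    by (simp add: is_sheaf_def vector_space_fscale linear_between_def del: fscale_apply)
  then have sh: "is_sheaf fscale (obj (concentrated G) d)" for d
    using assms by (simp add: concentrated_def del: fscale_apply)
  have "diff (concentrated G) d = (\<lambda>\<pi> x. 0)" for d
    by (simp add: concentrated_def)
  then show ?thesis
    unfolding is_complex_def using sh nat_trans_zero by metis
qed

lemma injective_resolution_quasi_isomorphism:
  assumes G: "is_sheaf fscale G" and I: "injective_resolution fscale G \<beta> I"
  shows "quasi_isomorphism (concentrated G) I (\<lambda>d \<pi> x. if d = 0 then \<beta> \<pi> x else 0)"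
    (is "quasi_isomorphism ?G I ?f")
proof -
  have cI: "is_complex I" and neg: "\<And>d \<pi>. d < 0 \<Longrightarrow> stalk (obj I d) \<pi> = {0}"
    and \<beta>: "nat_trans fscale G fscale (obj I 0) \<beta>" and inj: "\<And>\<pi>. inj_on (\<beta> \<pi>) (stalk G \<pi>)"
    and im: "\<And>\<pi>. \<beta> \<pi> ` stalk G \<pi> = cocycles I 0 \<pi>"
    and exact: "\<And>d \<pi>. 0 < d \<Longrightarrow> coboundaries I d \<pi> = cocycles I d \<pi>"
    using I by (auto simp: injective_resolution_def)
  note sh = is_complexD(1)[OF cI] and cG = is_complex_concentrated[OF G]
  have diffI0: "diff I d \<pi> 0 = 0" for d \<pi>
    by (rule nat_trans_0_diff(1)[OF sh sh is_complexD(2)[OF cI]])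
  have \<beta>0: "\<beta> \<pi> 0 = 0" for \<pi>
    by (rule nat_trans_0_diff(1)[OF G sh \<beta>])
  have stG: "stalk (obj ?G d) \<pi> = (if d = 0 then stalk G \<pi> else {0})"
    and dG: "diff ?G d \<pi> x = 0" for d \<pi> x
    by (auto simp: concentrated_def)
  show ?thesis
    unfolding quasi_isomorphism_def chain_map_def
  proof (intro conjI allI ballI impI)
    fix d
    show "nat_trans fscale (obj ?G d) fscale (obj I d) (?f d)"
    proof (cases "d = 0")
      case True
      then show ?thesis using \<beta> by (simp add: concentrated_def del: fscale_apply)
    next
      case False
      then show ?thesis
        using nat_trans_zero[OF is_complexD(1)[OF cG] sh, of d d] by (simp del: fscale_apply)
    qed
    fix \<pi>
    show "?f (d + 1) \<pi> (diff ?G d \<pi> x) = diff I d \<pi> (?f d \<pi> x)" if x: "x \<in> stalk (obj ?G d) \<pi>" for x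
    proof (cases "d = 0")
      case True
      then have "\<beta> \<pi> x \<in> cocycles I 0 \<pi>" using x im by (auto simp: stG)
      then show ?thesis using True by (simp add: cocycles_def)
    qed (simp add: dG \<beta>0 diffI0)
    show "x \<in> coboundaries ?G d \<pi>"
      if x: "x \<in> cocycles ?G d \<pi>" and fx: "?f d \<pi> x \<in> coboundaries I d \<pi>" for x
    proof -
      have "x = 0"
      proof (cases "d = 0")
        case True
        \<comment> \<open>The stalk in degree -1 is zero, so zero is the only coboundary in degree
          0.\<close>
        then have "\<beta> \<pi> x = \<beta> \<pi> 0"
          using fx neg[of "-1"] diffI0 \<beta>0 by (auto simp: coboundaries_def)
        then show ?thesis
          using True x inj[of \<pi>] stalk_closed(1)[OF G] by (auto simp: cocycles_def stG inj_on_def)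
      next
        case False
        then show ?thesis using x by (simp add: cocycles_def stG)
      qed
      then show ?thesis using coboundaries_closed(4)[OF cG] by blast
    qed
    show "\<exists>x\<in>cocycles ?G d \<pi>. ?f d \<pi> x - y \<in> coboundaries I d \<pi>" if y: "y \<in> cocycles I d \<pi>" for y
    proof (cases "d = 0")
      case True
      then obtain x where x: "x \<in> stalk G \<pi>" "y = \<beta> \<pi> x" using y im by blast
      then have "x \<in> cocycles ?G d \<pi>" "?f d \<pi> x - y = 0" using True by (simp_all add: cocycles_def stG dG)
      then show ?thesis using coboundaries_closed(4)[OF cI] by metis
    next
      case False
      have "y \<in> coboundaries I d \<pi>"
      proof (cases "d < 0")
        case True
        then have "y = 0" using y neg by (simp add: cocycles_def)
        then show ?thesis using coboundaries_closed(4)[OF cI] by blast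
      next
        assume "\<not> d < 0"
        then show ?thesis using False y exact by simp
      qed
      \<comment> \<open>Away from degree 0 the map is zero, so surjectivity on cohomology asks for
        the negative of \<open>y\<close> to be a coboundary.\<close>
      then have "0 - y \<in> coboundaries I d \<pi>"
        by (rule coboundaries_closed(2)[OF cI coboundaries_closed(4)[OF cI]])
      moreover have "0 \<in> cocycles ?G d \<pi>" using False by (simp add: cocycles_def stG dG)
      ultimately show ?thesis using False by (intro bexI[of _ 0]) simp_all
    qed
  qed
qed

lemma injective_resolution_transfer:
  assumes F: "is_sheaf s F" and \<theta>: "nat_trans s F t G \<theta>"
    and bij: "\<And>\<pi>. bij_betw (\<theta> \<pi>) (stalk F \<pi>) (stalk G \<pi>)"
    and I: "injective_resolution s F \<alpha> I"
  shows "injective_resolution t G (\<lambda>\<pi> y. \<alpha> \<pi> (inv_into (stalk F \<pi>) (\<theta> \<pi>) y)) I"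
proof -
  let ?i = "\<lambda>\<pi>. inv_into (stalk F \<pi>) (\<theta> \<pi>)"
  have \<alpha>: "nat_trans s F fscale (obj I 0) \<alpha>" and inj: "\<And>\<pi>. inj_on (\<alpha> \<pi>) (stalk F \<pi>)"
    and im: "\<And>\<pi>. \<alpha> \<pi> ` stalk F \<pi> = cocycles I 0 \<pi>"
    using I by (auto simp: injective_resolution_def)
  have i: "bij_betw (?i \<pi>) (stalk G \<pi>) (stalk F \<pi>)" for \<pi> by (rule bij_betw_inv_into[OF bij])
  have "inj_on (\<lambda>y. \<alpha> \<pi> (?i \<pi> y)) (stalk G \<pi>)" for \<pi>
    using comp_inj_on[of "?i \<pi>" "stalk G \<pi>" "\<alpha> \<pi>"] inj[of \<pi>] i[of \<pi>]
    by (simp add: bij_betw_def o_def)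
  moreover have "(\<lambda>y. \<alpha> \<pi> (?i \<pi> y)) ` stalk G \<pi> = cocycles I 0 \<pi>" for \<pi>
    using i[of \<pi>] im[of \<pi>] by (simp add: bij_betw_def flip: image_image[of "\<alpha> \<pi>" "?i \<pi>"])
  moreover have "nat_trans t G fscale (obj I 0) (\<lambda>\<pi> y. \<alpha> \<pi> (?i \<pi> y))"
    by (rule nat_trans_comp[OF nat_trans_inverse[OF F \<theta> bij] \<alpha>])
  ultimately show ?thesis using I by (simp add: injective_resolution_def del: fscale_apply)
qed

text \<open>Both complexes receive a quasi-isomorphism from the sheaf placed in degree 0. Complexes
  are carried by \<open>nat \<Rightarrow> 'k\<close> and \<open>F\<close> by an arbitrary space, so
  \<open>F\<close> is first replaced by its image under the embedding
  \<open>\<alpha>\<close>.\<close>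

lemma injective_resolutions_quasi_isomorphic:
  assumes F: "is_sheaf s F" and \<alpha>: "nat_trans s F fscale (inj_sheaf ls) \<alpha>"
    and inj: "\<And>\<pi>. inj_on (\<alpha> \<pi>) (stalk F \<pi>)"
    and I: "injective_resolution s F \<beta> I" and J: "injective_resolution s F \<gamma> J"
  shows "quasi_isomorphic J I"
proof -
  define G where "G = \<lparr>stalk = (\<lambda>\<pi>. \<alpha> \<pi> ` stalk F \<pi>), res = res (inj_sheaf ls)\<rparr>"
  have G: "is_sheaf fscale G"
    unfolding G_def by (rule is_sheaf_subsheaf_of[OF subsheaf_of_image[OF F \<alpha>]])
  have \<theta>: "nat_trans s F fscale G \<alpha>"
    using \<alpha> by (auto simp: nat_trans_def linear_between_def G_def simp del: fscale_apply)
  have bij: "bij_betw (\<alpha> \<pi>) (stalk F \<pi>) (stalk G \<pi>)" for \<pi>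
    using inj by (simp add: bij_betw_def G_def)
  note cG = is_complex_concentrated[OF G]
  note qI = injective_resolution_quasi_isomorphism[OF G injective_resolution_transfer[OF F \<theta> bij I]]
  note qJ = injective_resolution_quasi_isomorphism[OF G injective_resolution_transfer[OF F \<theta> bij J]]
  have cI: "is_complex I" and cJ: "is_complex J"
    using I J by (simp_all add: injective_resolution_def)
  let ?R = "\<lambda>A B. is_complex A \<and> is_complex B \<and> (\<exists>f. quasi_isomorphism A B f)"
  have "equivclp ?R (concentrated G) J" by (rule r_into_equivclp) (use cG cJ qJ in blast)
  then have "equivclp ?R J (concentrated G)" by (rule equivclp_sym)
  moreover have "equivclp ?R (concentrated G) I" by (rule r_into_equivclp) (use cG cI qI in blast)
  ultimately show ?thesis unfolding quasi_isomorphic_def by (rule equivclp_trans)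
qed

section \<open>Hulls with the least number of summands\<close>

lemma num_summands_inj_sheaf:
  "num_summands (inj_sheaf ls :: ('p::order, nat \<Rightarrow> 'k::field) sheaf) (length ls)"
  unfolding num_summands_def sheaf_iso_def
  by (intro exI[of _ ls] conjI refl exI[of _ "\<lambda>\<pi> x. x"] nat_trans_id allI) (simp add: bij_betw_def)

text \<open>If a vector \<open>x\<close> in the socle of a hull is not in the image, then the copy of \<open>[\<pi>]\<close> it generates
  meets the image trivially and can be split off. The projection along it eliminates coordinate \<open>m\<close>.\<close>

lemma hull_drop_summand:
  fixes \<alpha> :: "'p::order \<Rightarrow> 'v::ab_group_add \<Rightarrow> nat \<Rightarrow> 'k::field"
  assumes F: "is_sheaf s F" and \<alpha>: "nat_trans s F fscale (inj_sheaf ls) \<alpha>"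
    and inj: "\<And>\<pi>. inj_on (\<alpha> \<pi>) (stalk F \<pi>)"
    and x: "x \<in> socle (inj_sheaf ls) \<pi>" "x \<notin> \<alpha> \<pi> ` stalk F \<pi>"
  shows "\<exists>ls' \<alpha>'. length ls' < length ls \<and> nat_trans s F fscale (inj_sheaf ls') \<alpha>' \<and>
    (\<forall>\<pi>. inj_on (\<alpha>' \<pi>) (stalk F \<pi> :: 'v set))"
proof -
  interpret s: vector_space s using F by (rule is_sheafD)
  note D = nat_transD[OF \<alpha>] and F0 = stalk_closed[OF F]
  have "0 \<in> \<alpha> \<pi> ` stalk F \<pi>"
    using nat_trans_0_diff(1)[OF F is_sheaf_inj_sheaf \<alpha>] F0(1)[of \<pi>] by force
  then have "x \<noteq> 0" using x(2) by blast
  then obtain m where m: "x m \<noteq> 0" by (auto simp: fun_eq_iff)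
  then have lm: "m < length ls" "ls ! m = \<pi>" using x(1) by (auto simp: socle_inj_sheaf)
  \<comment> \<open>\<open>skip\<close> enumerates the positions other than \<open>m\<close>. The
    map \<open>\<alpha>'\<close> subtracts the multiple of \<open>x\<close> that clears coordinate
    \<open>m\<close> and then deletes that coordinate.\<close>
  define skip where "skip j = (if j < m then j else Suc j)" for j
  define ls' where "ls' = take m ls @ drop (Suc m) ls"
  have len: "length ls' = length ls - 1" using lm by (simp add: ls'_def)
  have nth: "ls' ! j = ls ! skip j" if "j < length ls'" for j
    using that lm by (auto simp: ls'_def skip_def nth_append min_def)
  have skip_lt: "skip j < length ls \<longleftrightarrow> j < length ls'" for j
    using lm by (auto simp: len skip_def)
  define \<alpha>' where "\<alpha>' \<sigma> y j = \<alpha> \<sigma> y (skip j) - \<alpha> \<sigma> y m / x m * x (skip j)" for \<sigma> y j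
  have x_supp: "x i \<noteq> 0 \<Longrightarrow> i < length ls \<and> ls ! i = \<pi>" for i
    using x(1) by (auto simp: socle_inj_sheaf)
  have nt: "nat_trans s F fscale (inj_sheaf ls') \<alpha>'"
  proof (rule nat_transI)
    fix \<sigma> y assume y: "y \<in> stalk F \<sigma>"
    have supp: "\<alpha> \<sigma> y i \<noteq> 0 \<Longrightarrow> i < length ls \<and> \<sigma> \<le> ls ! i" for i
      using D(2)[OF y] by (auto simp: inj_sheaf_simps)
    show "\<alpha>' \<sigma> y \<in> stalk (inj_sheaf ls') \<sigma>"
      unfolding inj_sheaf_simps
    proof (intro allI impI)
      fix j assume "\<alpha>' \<sigma> y j \<noteq> 0"
      then have "\<alpha> \<sigma> y (skip j) \<noteq> 0 \<or> \<alpha> \<sigma> y m \<noteq> 0 \<and> x (skip j) \<noteq> 0" by (auto simp: \<alpha>'_def)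
      then have "skip j < length ls \<and> \<sigma> \<le> ls ! skip j"
        using supp[of "skip j"] supp[of m] x_supp[of "skip j"] lm by auto
      then show "j < length ls' \<and> \<sigma> \<le> ls' ! j" using nth skip_lt by auto
    qed
    show "\<alpha>' \<sigma> (y + z) = \<alpha>' \<sigma> y + \<alpha>' \<sigma> z" if "z \<in> stalk F \<sigma>" for z
      by (rule ext) (simp add: \<alpha>'_def D(3)[OF y that] add_divide_distrib algebra_simps)
    show "\<alpha>' \<sigma> (s c y) = fscale c (\<alpha>' \<sigma> y)" for c
      by (rule ext) (simp add: \<alpha>'_def D(4)[OF y] field_simps)
  next
    fix \<sigma> \<tau> :: 'p and y
    assume le: "\<sigma> \<le> \<tau>" and y: "y \<in> stalk F \<sigma>"
    have r: "\<alpha> \<tau> (res F \<sigma> \<tau> y) i = (if i < length ls \<and> \<tau> \<le> ls ! i then \<alpha> \<sigma> y i else 0)" for i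
      by (simp add: D(5)[OF le y] inj_sheaf_simps)
    show "\<alpha>' \<tau> (res F \<sigma> \<tau> y) = res (inj_sheaf ls') \<sigma> \<tau> (\<alpha>' \<sigma> y)"
    proof
      fix j
      \<comment> \<open>If \<open>x\<close> does not vanish at \<open>skip j\<close>, this position
        and \<open>m\<close> both carry the label \<open>\<pi>\<close>, so restriction keeps or
        kills the two terms of \<open>\<alpha>'\<close> together.\<close>
      show "\<alpha>' \<tau> (res F \<sigma> \<tau> y) j = res (inj_sheaf ls') \<sigma> \<tau> (\<alpha>' \<sigma> y) j"
        using nth[of j] skip_lt[of j] x_supp[of "skip j"] lm
        by (cases "x (skip j) = 0") (auto simp: \<alpha>'_def inj_sheaf_simps r)
    qed
  qed
  have ker: "y = 0" if y: "y \<in> stalk F \<sigma>" and 0: "\<alpha>' \<sigma> y = 0" for \<sigma> y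
  proof -
    define c where "c = \<alpha> \<sigma> y m / x m"
    have eq: "\<alpha> \<sigma> y i = c * x i" for i
    proof (cases "i = m")
      case True
      then show ?thesis using m by (simp add: c_def)
    next
      case False
      then have "skip (if i < m then i else i - 1) = i" by (auto simp: skip_def)
      then show ?thesis
        using fun_cong[OF 0, of "if i < m then i else i - 1"] by (simp add: \<alpha>'_def c_def)
    qed
    \<comment> \<open>A nonzero \<open>c\<close> would put \<open>x\<close> into the image:
      restricting \<open>y\<close> to \<open>\<pi>\<close> changes nothing on the support of
      \<open>x\<close>, and dividing by \<open>c\<close> yields \<open>x\<close>.\<close>
    have "c = 0"
    proof (rule ccontr)
      assume "c \<noteq> 0"
      then have "\<alpha> \<sigma> y m \<noteq> 0" using m by (simp add: eq)
      then have le: "\<sigma> \<le> \<pi>" using D(2)[OF y] lm by (auto simp: inj_sheaf_simps)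
      have ry: "res F \<sigma> \<pi> y \<in> stalk F \<pi>" by (rule res_in_stalk[OF F le y])
      have "\<alpha> \<pi> (s (inverse c) (res F \<sigma> \<pi> y)) = x"
      proof
        fix i
        show "\<alpha> \<pi> (s (inverse c) (res F \<sigma> \<pi> y)) i = x i"
          using x_supp[of i] \<open>c \<noteq> 0\<close>
          by (cases "x i = 0") (simp_all add: D(4)[OF ry] D(5)[OF le y] inj_sheaf_simps eq)
      qed
      then show False using x(2) F0(4)[OF ry] by blast
    qed
    then have "\<alpha> \<sigma> y = \<alpha> \<sigma> 0"
      using nat_trans_0_diff(1)[OF F is_sheaf_inj_sheaf \<alpha>] by (simp add: fun_eq_iff eq)
    then show ?thesis using inj[of \<sigma>] y F0(1) by (meson inj_onD)
  qed
  have "inj_on (\<alpha>' \<sigma>) (stalk F \<sigma>)" for \<sigma>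
  proof (rule inj_onI)
    fix y z assume yz: "y \<in> stalk F \<sigma>" "z \<in> stalk F \<sigma>" "\<alpha>' \<sigma> y = \<alpha>' \<sigma> z"
    have "\<alpha>' \<sigma> (y - z) = 0"
      using nat_trans_0_diff(2)[OF F is_sheaf_inj_sheaf nt yz(1,2)] yz(3) by simp
    then show "y = z" using ker[OF F0(3)[OF yz(1,2)]] by simp
  qed
  then show ?thesis using nt len lm by (intro exI[of _ ls'] exI[of _ \<alpha>']) auto
qed

lemma minimal_injective_hull_socle:
  fixes F :: "('p::{finite, order}, 'v::ab_group_add) sheaf"
    and \<alpha> :: "'p \<Rightarrow> 'v \<Rightarrow> nat \<Rightarrow> 'k::field"
  assumes F: "is_sheaf s F" and hull: "minimal_injective_hull s F \<alpha> (inj_sheaf ls)"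
  shows "socle (inj_sheaf ls) \<pi> \<subseteq> \<alpha> \<pi> ` stalk F \<pi>"
proof -
  obtain I where I: "injective_resolution s F \<alpha> I" and "minimal_complex I"
    and I0: "obj I 0 = inj_sheaf ls"
    using hull by (auto simp: minimal_injective_hull_def minimal_injective_resolution_def)
  define hull_length where "hull_length n \<longleftrightarrow> (\<exists>ls' (\<alpha>' :: 'p \<Rightarrow> 'v \<Rightarrow> nat \<Rightarrow> 'k). length ls' = n \<and>
    nat_trans s F fscale (inj_sheaf ls') \<alpha>' \<and> (\<forall>\<pi>. inj_on (\<alpha>' \<pi>) (stalk F \<pi>)))" for n
  have \<alpha>: "nat_trans s F fscale (inj_sheaf ls) \<alpha>" "\<And>\<pi>. inj_on (\<alpha> \<pi>) (stalk F \<pi>)"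
    using hull by (auto simp: minimal_injective_hull_def injective_hull_def)
  then have "hull_length (length ls)" by (auto simp: hull_length_def)
  then obtain n where n: "hull_length n" "\<And>k. hull_length k \<Longrightarrow> n \<le> k"
    by (metis LeastI Least_le)
  \<comment> \<open>Stated for every hull with at most \<open>n\<close> summands, since it is
    applied to the least hull and, at the end, to the given one.\<close>
  have essential: "socle (inj_sheaf ls') \<pi> \<subseteq> \<alpha>' \<pi> ` stalk F \<pi>"
    if "length ls' \<le> n" "nat_trans s F fscale (inj_sheaf ls') \<alpha>'" "\<And>\<pi>. inj_on (\<alpha>' \<pi>) (stalk F \<pi>)"
    for ls' and \<alpha>' :: "'p \<Rightarrow> 'v \<Rightarrow> nat \<Rightarrow> 'k" and \<pi>
  proof (rule subsetI, rule ccontr)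
    fix x assume "x \<in> socle (inj_sheaf ls') \<pi>" "x \<notin> \<alpha>' \<pi> ` stalk F \<pi>"
    from hull_drop_summand[OF F that(2,3) this]
    obtain k where "k < length ls'" "hull_length k" by (auto simp: hull_length_def)
    then show False using n(2)[of k] that(1) by simp
  qed
  obtain ls' and \<alpha>' :: "'p \<Rightarrow> 'v \<Rightarrow> nat \<Rightarrow> 'k" where len: "length ls' = n"
    and \<alpha>': "nat_trans s F fscale (inj_sheaf ls') \<alpha>'" "\<And>\<pi>. inj_on (\<alpha>' \<pi>) (stalk F \<pi>)"
    using n(1) by (auto simp: hull_length_def)
  obtain \<eta> where run: "algorithm_run F \<alpha>' ls' \<eta>" using algorithm_run_exists by blast
  define J where "J = output_complex ls' \<eta>"
  have J: "injective_resolution s F \<alpha>' J"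
    unfolding J_def by (rule injective_resolution_output_complex[OF F \<alpha>'(1) run \<alpha>'(2)])
  have "socle (inj_sheaf ls') \<pi> \<subseteq> \<alpha>' \<pi> ` stalk F \<pi>" for \<pi>
    by (rule essential[OF _ \<alpha>']) (simp add: len)
  then have "bounded_complex J"
    unfolding J_def by (rule bounded_complex_output_complex[OF F \<alpha>'(1) run]) (rule finite)
  moreover have "\<forall>d. injective_sheaf (obj J d)" using J by (simp add: injective_resolution_def)
  moreover have "quasi_isomorphic J I"
    by (rule injective_resolutions_quasi_isomorphic[OF F \<alpha> I J])
  moreover have "obj J 0 = inj_sheaf ls'"
    by (simp add: J_def output_complex_simps label_list_simps)
  \<comment> \<open>Minimality of \<open>I\<close> in degree 0 bounds the given hull by the least
    one, so no summand can be split off from it either.\<close>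
  ultimately have "length ls \<le> length ls'"
    using \<open>minimal_complex I\<close> num_summands_inj_sheaf I0 unfolding minimal_complex_def by metis
  then show ?thesis using essential[OF _ \<alpha>] len by simp
qed

text \<open>Bases and processing orders are free choices, so the claim concerns all runs; the
  existence of a run keeps it from being vacuous.\<close>

theorem lemma4p20:
  fixes scale :: "'k::field \<Rightarrow> 'v::ab_group_add \<Rightarrow> 'v"
    and F :: "('p::{finite, order}, 'v) sheaf"
    and \<alpha> :: "'p \<Rightarrow> 'v \<Rightarrow> nat \<Rightarrow> 'k"
    and ls :: "'p list"
  assumes "is_sheaf scale F"
    and "minimal_injective_hull scale F \<alpha> (inj_sheaf ls)"
  shows "(\<exists>\<eta> :: nat \<Rightarrow> ('p, 'k) lmat. algorithm_run F \<alpha> ls \<eta>) \<and>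
    (\<forall>\<eta> :: nat \<Rightarrow> ('p, 'k) lmat. algorithm_run F \<alpha> ls \<eta> \<longrightarrow>
       (\<forall>d. labeled_matrix (\<eta> d)) \<and>
       minimal_injective_resolution scale F \<alpha> (output_complex ls \<eta>))"
proof (intro conjI allI impI)
  show "\<exists>\<eta> :: nat \<Rightarrow> ('p, 'k) lmat. algorithm_run F \<alpha> ls \<eta>"
    by (rule algorithm_run_exists)
  fix \<eta> :: "nat \<Rightarrow> ('p, 'k) lmat"
  assume run: "algorithm_run F \<alpha> ls \<eta>"
  show "labeled_matrix (\<eta> d)" for d
    by (rule labeled_matrix_row_inv[OF algorithm_run_row_inv[OF run]])
  have "nat_trans scale F fscale (inj_sheaf ls) \<alpha>" "\<And>\<pi>. inj_on (\<alpha> \<pi>) (stalk F \<pi>)"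
    using assms(2) by (auto simp: minimal_injective_hull_def injective_hull_def)
  then show "minimal_injective_resolution scale F \<alpha> (output_complex ls \<eta>)"
    by (intro minimal_injective_resolution_output_complex[OF assms(1) _ run]
        minimal_injective_hull_socle[OF assms])
qed

end
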